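(* Assume the following. (1) The weight $w$ is bounded and Lipschitz. (2) $K_Z:\mathbb R^d\to[0,\infty)$ and $K_U:\mathbb R^2\to[0,\infty)$ are bounded, Lipschitz, integrate to one, are supported in the closed unit balls of $\mathbb R^d$ and $\mathbb R^2$ respectively, and there are $\rho_{K,Z},\rho_{K,U},k_Z,k_U>0$ with $K_Z(x)\ge k_Z$ whenever $\|x\|\le\rho_{K,Z}$ and $K_U(y)\ge k_U$ whenever $\|y\|\le\rho_{K,U}$. (3) $\mathcal Z\subset\mathbb R^d$ is compact and there are $\rho_Z,\eta_Z>0$ such that for every $z\in\mathcal Z$ there is a unit vector $\xi_z$ with $\{z+tv:0<t<\rho_Z,\ \|v\|=1,\ \|v-\xi_z\|<\eta_Z\}\subset\mathcal Z$. (4) The law of $Z$ has a density $p_Z$ on $\mathcal Z$ with $0<c_Z\le p_Z(z)\le C_Z<\infty$ for all $z\in\mathcal Z$. (5) $\Lambda_z^w$ is absolutely continuous with respect to Lebesgue measure on $\overline\Omega_L$, with density $\lambda_w:\mathcal Z\times\overline\Omega_L\to[0,\infty)$ that is bounded and uniformly continuous. (6) There is $M_w<\infty$ with $\mu_i^w(\overline\Omega_L)\le M_w$ almost surely. (7) There are $s_Z,s_U\in(0,1]$ and $L_Z,L_U<\infty$ such that $|\lambda_w(z,u)-\lambda_w(z',u')|\le L_Z\|z-z'\|^{s_Z}+L_U\|u-u'\|^{s_U}$ for all $z,z'\in\mathcal Z$, $u,u'\in\overline\Omega_L$. Then, for any positive bandwidth sequences $h_Z=h_{Z,n}$, $h_U=h_{U,n}$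 with $h_Z\to0$, $h_U\to0$ and $nh_Z^dh_U^2/\log n\to\infty$, $$\sup_{z\in\mathcal Z,u\in\overline\Omega_L}|\widehat\lambda_{w,n}(z,u)-\lambda_w(z,u)|=O_P\left(h_Z^{s_Z}+h_U^{s_U}+\sqrt{\frac{\log n}{nh_Z^dh_U^2}}+\frac{\log n}{nh_Z^dh_U^2}\right).$$ In particular, choosing $$h_Z\asymp\left(\frac{\log n}{n}\right)^{1/(2s_Z+d+2s_Z/s_U)},\qquad h_U\asymp\left(\frac{\log n}{n}\right)^{1/(2s_U+2+ds_U/s_Z)}$$ gives $$\sup_{z\in\mathcal Z,u\in\overline\Omega_L}|\widehat\lambda_{w,n}(z,u)-\lambda_w(z,u)|=O_P\left[\left(\frac{\log n}{n}\right)^{1/(2+d/s_Z+2/s_U)}\right].$$ In the isotropic case $s_Z=s_U=s$, this becomes $$\sup_{z\in\mathcal Z,u\in\overline\Omega_L}|\widehat\lambda_{w,n}(z,u)-\lambda_w(z,u)|=O_P\left[\left(\frac{\log n}{n}\right)^{s/(2s+d+2)}\right].$$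
   Context: Fix $L>0$ and let $\Omega_L=\{(b,t):0\le b<t\le L\}$, $\overline\Omega_L=\{(b,t):0\le b\le t\le L\}$, $\Delta_L=\{(b,b):0\le b\le L\}$. $\|\cdot\|$ is the Euclidean norm. A persistence diagram $D$ supported in $\Omega_L$ is identified with a locally finite counting measure $\mu_D=\sum_{x\in D}a_x\delta_x$, $a_x\in\mathbb N$. A weight is a measurable $w:\overline\Omega_L\to[0,\infty)$ with $w=0$ on $\Delta_L$; the weighted persistence measure is $\mu_D^w(A)=\int_Aw\,d\mu_D$ for Borel $A\subseteq\overline\Omega_L$. $(Z_i,D_i)$, $i=1,\dots,n$, are i.i.d. copies of $(Z,D)$, with $Z\in\mathcal Z\subset\mathbb R^d$ and $D$ a random persistence diagram. Put $\mu_i^w=\mu_{D_i}^w$ and $\Lambda_z^w(A)=\mathbb E[\mu_i^w(A)\mid Z_i=z]$. For kernels $K_Z,K_U$ and $h>0$ define $c_{Z,h}(z)=\int_{\mathcal Z}h^{-d}K_Z((z'-z)/h)\,dz'$, $c_{U,h}(u)=\int_{\overline\Omega_L}h^{-2}K_U((v-u)/h)\,dv$, $\kappa_{Z,h}(z,z')=h^{-d}K_Z((z'-z)/h)/c_{Z,h}(z)$ and $\kappa_{U,h}(u,v)=h^{-2}K_U((v-u)/h)/c_{U,h}(u)$. Set $Y^w_{i,h_U}(u)=\int_{\overline\Omega_L}\kappa_{U,h_U}(u,v)\,d\mu_i^w(v)$ and $$\widehat\lambda_{w,n}(z,u)=\frac{\sum_{i=1}^n\kappa_{Z,h_Z}(z,Z_i)Y^w_{i,h_U}(u)}{\sum_{i=1}^n\kappa_{Z,h_Z}(z,Z_i)},$$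 with $\widehat\lambda_{w,n}(z,u)=0$ when the denominator is zero. $a_n\asymp b_n$ means that $a_n/b_n$ is bounded above and below by positive constants for large $n$. *)

theory Defs
  imports "HOL-Probability.Probability" "HOL-Library.Landau_Symbols"
begin

definition Omega :: "real \<Rightarrow> (real \<times> real) set" where
  "Omega L = {(b, t). 0 \<le> b \<and> b < t \<and> t \<le> L}"

definition Omega_bar :: "real \<Rightarrow> (real \<times> real) set" where
  "Omega_bar L = {(b, t). 0 \<le> b \<and> b \<le> t \<and> t \<le> L}"

definition Delta :: "real \<Rightarrow> (real \<times> real) set" where
  "Delta L = {(b, b) | b. 0 \<le> b \<and> b \<le> L}"

text \<open>A diagram is given by its multiplicities \<open>a x\<close>. Local finiteness is meant in \<open>Omega L\<close>,
  so points may accumulate at the diagonal.\<close>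

type_synonym diagram = "real \<times> real \<Rightarrow> nat"

definition diagrams :: "real \<Rightarrow> diagram set" where
  "diagrams L = {a. (\<forall>x. x \<notin> Omega L \<longrightarrow> a x = 0) \<and>
     (\<forall>C. compact C \<and> C \<subseteq> Omega L \<longrightarrow> finite {x \<in> C. a x \<noteq> 0})}"

text \<open>The measure that sums \<open>a x\<close> times the unit mass at \<open>x\<close>, on the Borel sets of the plane; the
  \<open>distr\<close> along the identity only shrinks the sigma-algebra from all subsets to the Borel sets.\<close>

definition diagram_measure :: "diagram \<Rightarrow> (real \<times> real) measure" where
  "diagram_measure a = distr (density (count_space UNIV) (\<lambda>x. of_nat (a x))) borel (\<lambda>x. x)"

lemma sets_diagram_measure [simp]: "sets (diagram_measure a) = sets borel"
  by (simp add: diagram_measure_def)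

lemma space_diagram_measure [simp]: "space (diagram_measure a) = UNIV"
  by (simp add: diagram_measure_def)

lemma emeasure_diagram_measure:
  assumes "A \<in> sets borel"
  shows "emeasure (diagram_measure a) A = (\<integral>\<^sup>+x\<in>A. of_nat (a x) \<partial>count_space UNIV)"
  using assms by (simp add: diagram_measure_def emeasure_distr emeasure_density)

text \<open>Diagrams carry the sigma-algebra generated by the evaluations at Borel sets; a random
  persistence diagram is a measurable map into this space.\<close>

definition diagram_space :: "real \<Rightarrow> diagram measure" where
  "diagram_space L = sigma (diagrams L)
     {{a \<in> diagrams L. emeasure (diagram_measure a) A \<in> B} | A B. A \<in> sets borel \<and> B \<in> sets borel}"

definition is_weight :: "real \<Rightarrow> (real \<times> real \<Rightarrow> real) \<Rightarrow> bool" where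
  "is_weight L w \<longleftrightarrow> w \<in> borel_measurable (restrict_space borel (Omega_bar L)) \<and>
     (\<forall>u\<in>Omega_bar L. 0 \<le> w u) \<and> (\<forall>u\<in>Delta L. w u = 0)"

definition weighted_measure ::
  "real \<Rightarrow> (real \<times> real \<Rightarrow> real) \<Rightarrow> diagram \<Rightarrow> (real \<times> real) measure" where
  "weighted_measure L w a =
     density (restrict_space (diagram_measure a) (Omega_bar L)) (\<lambda>x. ennreal (w x))"

text \<open>\<open>g\<close> is a version, measurable on \<open>S\<close>, of the map \<open>z \<mapsto> E[X | Z = z]\<close>.\<close>

definition is_cond_exp_given ::
  "'o measure \<Rightarrow> ('o \<Rightarrow> 'z::topological_space) \<Rightarrow> 'z set \<Rightarrow> ('o \<Rightarrow> ennreal) \<Rightarrow> ('z \<Rightarrow> ennreal) \<Rightarrow> bool"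
  where
  "is_cond_exp_given M Z S X g \<longleftrightarrow> g \<in> borel_measurable (restrict_space borel S) \<and>
     (AE \<omega> in M. nn_cond_exp M (vimage_algebra (space M) Z borel) X \<omega> = g (Z \<omega>))"

definition is_kernel :: "('a::euclidean_space \<Rightarrow> real) \<Rightarrow> bool" where
  "is_kernel K \<longleftrightarrow> (\<forall>x. 0 \<le> K x) \<and> bounded (range K) \<and> (\<exists>C. C-lipschitz_on UNIV K) \<and>
     has_bochner_integral lborel K 1 \<and> (\<forall>x. norm x > 1 \<longrightarrow> K x = 0) \<and>
     (\<exists>\<rho> k. \<rho> > 0 \<and> k > 0 \<and> (\<forall>x. norm x \<le> \<rho> \<longrightarrow> K x \<ge> k))"

text \<open>Boundary-corrected kernels on a domain \<open>S\<close> of a Euclidean space. They are used for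
  \<open>S \<subseteq> real ^ 'd\<close>, of dimension \<open>CARD('d)\<close>, and for \<open>S = Omega_bar L\<close>, where
  \<open>DIM(real \<times> real) = 2\<close>.\<close>

definition kernel_mass :: "'a::euclidean_space set \<Rightarrow> ('a \<Rightarrow> real) \<Rightarrow> real \<Rightarrow> 'a \<Rightarrow> real" where
  "kernel_mass S K h x = (LINT y:S|lborel. K ((y - x) /\<^sub>R h) / h ^ DIM('a))"

definition kappa :: "'a::euclidean_space set \<Rightarrow> ('a \<Rightarrow> real) \<Rightarrow> real \<Rightarrow> 'a \<Rightarrow> 'a \<Rightarrow> real" where
  "kappa S K h x y = (K ((y - x) /\<^sub>R h) / h ^ DIM('a)) / kernel_mass S K h x"

definition smoothed_diagram ::
  "real \<Rightarrow> (real \<times> real \<Rightarrow> real) \<Rightarrow> (real \<times> real \<Rightarrow> real) \<Rightarrow> real \<Rightarrow> diagram \<Rightarrow> real \<times> real \<Rightarrow> real"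
  where
  "smoothed_diagram L w KU h a u =
     (\<integral>v. kappa (Omega_bar L) KU h u v \<partial>weighted_measure L w a)"

definition lambda_hat ::
  "real \<Rightarrow> (real \<times> real \<Rightarrow> real) \<Rightarrow> (real ^ 'd) set \<Rightarrow> (real ^ 'd \<Rightarrow> real) \<Rightarrow> (real \<times> real \<Rightarrow> real) \<Rightarrow>
   real \<Rightarrow> real \<Rightarrow> nat \<Rightarrow> (nat \<Rightarrow> real ^ 'd) \<Rightarrow> (nat \<Rightarrow> diagram) \<Rightarrow> real ^ 'd \<Rightarrow> real \<times> real \<Rightarrow> real"
  where
  "lambda_hat L w \<Z> KZ KU hZ hU n Zs Ds z u =
     (if (\<Sum>i=1..n. kappa \<Z> KZ hZ z (Zs i)) = 0 then 0
      else (\<Sum>i=1..n. kappa \<Z> KZ hZ z (Zs i) * smoothed_diagram L w KU hU (Ds i) u) /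
           (\<Sum>i=1..n. kappa \<Z> KZ hZ z (Zs i)))"

text \<open>The supremum is taken in the extended reals, where it is meaningful without boundedness.\<close>

definition sup_dist :: "'a set \<Rightarrow> 'b set \<Rightarrow> ('a \<Rightarrow> 'b \<Rightarrow> real) \<Rightarrow> ('a \<Rightarrow> 'b \<Rightarrow> real) \<Rightarrow> ereal" where
  "sup_dist A B f g = (SUP z\<in>A. SUP u\<in>B. ereal \<bar>f z u - g z u\<bar>)"

definition cone_condition :: "'a::real_normed_vector set \<Rightarrow> bool" where
  "cone_condition S \<longleftrightarrow> (\<exists>\<rho> \<eta>. \<rho> > 0 \<and> \<eta> > 0 \<and> (\<forall>z\<in>S. \<exists>\<xi>. norm \<xi> = 1 \<and>
     {z + t *\<^sub>R v | t v. 0 < t \<and> t < \<rho> \<and> norm v = 1 \<and> norm (v - \<xi>) < \<eta>} \<subseteq> S))"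

text \<open>\<open>X n = O\<^sub>P(r n)\<close>. The exceptional set \<open>{\<bar>X n\<bar> > C * r n}\<close> is only required to be contained
  in an event of probability at most \<open>\<epsilon>\<close>, so that no measurability of the (uncountable) suprema
  \<open>X n\<close> is presupposed; for measurable \<open>X n\<close> this is the usual definition.\<close>

definition big_OP :: "'o measure \<Rightarrow> (nat \<Rightarrow> 'o \<Rightarrow> ereal) \<Rightarrow> (nat \<Rightarrow> real) \<Rightarrow> bool" where
  "big_OP M X r \<longleftrightarrow> (\<forall>\<epsilon>>0. \<exists>C. \<forall>\<^sub>F n in sequentially.
     \<exists>E\<in>sets M. {\<omega> \<in> space M. \<bar>X n \<omega>\<bar> > ereal (C * r n)} \<subseteq> E \<and> measure M E \<le> \<epsilon>)"

end

theory Submission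
  imports Defs "HOL-Real_Asymp.Real_Asymp"
begin

text \<open>The estimator is a ratio of two averages: with \<open>\<kappa>\<close> the boundary-corrected kernels,
  \<open>N(z,u) = \<Sum>\<^sub>i \<kappa>(z, Z\<^sub>i) Y\<^sub>i(u)\<close> is divided by \<open>P(z) = \<Sum>\<^sub>i \<kappa>(z, Z\<^sub>i)\<close>. Hence the error is
  \<open>(N - \<lambda> P) / P\<close>, and \<open>N - \<lambda> P\<close> splits into the fluctuation of \<open>N\<close>, the fluctuation of \<open>P\<close>
  times the bounded factor \<open>\<lambda>\<close>, and the bias \<open>E N - \<lambda> E P\<close>.

  The bias is a smoothing error. Conditioning on \<open>Z\<^sub>i\<close> replaces \<open>Y\<^sub>i(u)\<close> by the integral of
  \<open>\<kappa>(u, v) \<lambda>(Z\<^sub>i, v)\<close> over \<open>v\<close>. Both kernels integrate to one over their domain and vanish beyond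
  one bandwidth, so Hoelder continuity bounds the bias per observation by a multiple of
  \<open>h\<^sub>Z\<close> to the power \<open>s\<^sub>Z\<close> plus \<open>h\<^sub>U\<close> to the power \<open>s\<^sub>U\<close>
  (\<open>cond_intensity_integral\<close>, \<open>weighted_obs_mean\<close>).

  For the fluctuations put \<open>H = h\<^sub>Z\<^sup>d h\<^sub>U\<^sup>2\<close>. A summand is nonnegative, is at most of
  order \<open>1/H\<close> and has a bounded mean, so its second moment is also only of order \<open>1/H\<close>. This is where a Bernstein
  inequality is needed: deviations of the average by \<open>t \<surd>(ln n / (n H))\<close> have probability at most
  a power of \<open>n\<close> whose exponent can be made as negative as desired by the choice of \<open>t\<close>. The
  summands are Lipschitz in \<open>(z, u)\<close> with a constant polynomial in the inverse bandwidths, and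
  \<open>n H / ln n \<rightarrow> \<infinity>\<close> eventually keeps the bandwidths above \<open>1/n\<close>; hence a net of polynomially many points
  turns the pointwise bound into a uniform one (\<open>uniform_deviation_rate\<close>).

  All constants rest on a lower bound for the kernel masses near the boundary of the two domains.
  It holds because near every point of the domain, at every small scale, there is a ball of
  comparable radius inside the domain; the cone condition gives this for the covariate domain,
  convexity gives it for the triangle (\<open>kernel_bounds_small_bandwidth\<close>).
  Since the covariate density is at least \<open>c\<^sub>Z\<close>, the mean of \<open>P\<close> is at least \<open>n c\<^sub>Z\<close>, and the
  denominator stays away from zero. The two special rates follow by inserting the
  bandwidths that balance bias and fluctuation.\<close>

section \<open>A Bernstein inequality\<close>

lemma exp_le_quadratic:
  fixes x :: real
  assumes "x \<le> 1"
  shows "exp x \<le> 1 + x + x\<^sup>2"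
proof (cases "0 \<le> x")
  case True
  then show ?thesis using exp_bound[of x] assms by simp
next
  case False
  define y where "y = - x"
  have y: "y > 0" using False by (simp add: y_def)
  have "1 \<le> (1 - y + y\<^sup>2) * (1 + y)"
    using y by (simp add: algebra_simps power2_eq_square)
  also have "\<dots> \<le> (1 - y + y\<^sup>2) * exp y"
  proof (rule mult_left_mono)
    have "1 - y + y\<^sup>2 = (y - 1/2)\<^sup>2 + 3/4" by (simp add: power2_eq_square algebra_simps)
    then show "0 \<le> 1 - y + y\<^sup>2" by simp
  qed (rule exp_ge_add_one_self)
  finally have "exp (- y) \<le> 1 - y + y\<^sup>2"
    by (simp add: exp_minus field_simps)
  then show ?thesis by (simp add: y_def)
qed

context prob_space
begin

text \<open>Second-order control of the centred exponential moment: the bound on \<open>X\<close> only restricts the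
  range of \<open>l\<close>, while the size of the moment is governed by the second moment \<open>v\<close>.\<close>

lemma exp_moment_le:
  fixes X :: "'a \<Rightarrow> real" and b v l :: real
  assumes X [measurable]: "random_variable borel X"
    and bdd: "AE \<omega> in M. \<bar>X \<omega>\<bar> \<le> b"
    and var: "expectation (\<lambda>\<omega>. (X \<omega>)\<^sup>2) \<le> v"
    and l: "0 \<le> l" "2 * l * b \<le> 1"
  shows "(\<integral>\<^sup>+\<omega>. ennreal (exp (l * (X \<omega> - expectation X))) \<partial>M) \<le> ennreal (exp (l\<^sup>2 * v))"
proof -
  define m where "m = expectation X"
  have int: "integrable M X"
    by (rule integrable_const_bound[where B = b]) (use bdd in auto)
  have "AE \<omega> in M. (X \<omega>)\<^sup>2 \<le> b\<^sup>2"
    using bdd by eventually_elim (metis abs_le_square_iff abs_of_nonneg abs_ge_zero order.trans)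
  then have int2: "integrable M (\<lambda>\<omega>. (X \<omega>)\<^sup>2)"
    by (intro integrable_const_bound[where B = "b\<^sup>2"]) auto
  have lo: "- b \<le> m" unfolding m_def
    by (rule integral_ge_const[OF int]) (use bdd in \<open>auto elim!: eventually_mono\<close>)
  have int_q: "integrable M (\<lambda>\<omega>. 1 + l * (X \<omega> - m) + l\<^sup>2 * ((X \<omega>)\<^sup>2 - 2 * m * X \<omega> + m\<^sup>2))"
    by (intro Bochner_Integration.integrable_add Bochner_Integration.integrable_diff integrable_mult_right
        integrable_const int int2)
  have "(\<integral>\<^sup>+\<omega>. ennreal (exp (l * (X \<omega> - m))) \<partial>M)
      \<le> (\<integral>\<^sup>+\<omega>. ennreal (1 + l * (X \<omega> - m) + l\<^sup>2 * ((X \<omega>)\<^sup>2 - 2 * m * X \<omega> + m\<^sup>2)) \<partial>M)"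
  proof (rule nn_integral_mono_AE)
    show "AE \<omega> in M. ennreal (exp (l * (X \<omega> - m)))
        \<le> ennreal (1 + l * (X \<omega> - m) + l\<^sup>2 * ((X \<omega>)\<^sup>2 - 2 * m * X \<omega> + m\<^sup>2))"
      using bdd
    proof eventually_elim
      case (elim \<omega>)
      have "l * (X \<omega> - m) \<le> l * (2 * b)"
        by (rule mult_left_mono) (use elim lo l in auto)
      also have "\<dots> \<le> 1" using l by (simp add: mult_ac)
      finally have "exp (l * (X \<omega> - m)) \<le> 1 + l * (X \<omega> - m) + (l * (X \<omega> - m))\<^sup>2"
        by (rule exp_le_quadratic)
      then show ?case
        by (intro ennreal_leI) (simp add: power2_eq_square algebra_simps)
    qed
  qed
  also have "\<dots> = ennreal (expectation (\<lambda>\<omega>. 1 + l * (X \<omega> - m) + l\<^sup>2 * ((X \<omega>)\<^sup>2 - 2 * m * X \<omega> + m\<^sup>2)))"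
  proof (rule nn_integral_eq_integral[OF int_q])
    show "AE \<omega> in M. 0 \<le> 1 + l * (X \<omega> - m) + l\<^sup>2 * ((X \<omega>)\<^sup>2 - 2 * m * X \<omega> + m\<^sup>2)"
    proof (rule AE_I2)
      fix \<omega>
      have "1 + l * (X \<omega> - m) + l\<^sup>2 * ((X \<omega>)\<^sup>2 - 2 * m * X \<omega> + m\<^sup>2)
          = (l * (X \<omega> - m) + 1/2)\<^sup>2 + 3/4"
        by (simp add: power2_eq_square algebra_simps)
      then show "0 \<le> 1 + l * (X \<omega> - m) + l\<^sup>2 * ((X \<omega>)\<^sup>2 - 2 * m * X \<omega> + m\<^sup>2)" by simp
    qed
  qed
  also have "expectation (\<lambda>\<omega>. 1 + l * (X \<omega> - m) + l\<^sup>2 * ((X \<omega>)\<^sup>2 - 2 * m * X \<omega> + m\<^sup>2))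
      = 1 + l\<^sup>2 * (expectation (\<lambda>\<omega>. (X \<omega>)\<^sup>2) - m\<^sup>2)"
    using int int2 by (simp add: prob_space m_def power2_eq_square)
  also have "\<dots> \<le> 1 + l\<^sup>2 * v"
  proof -
    have "expectation (\<lambda>\<omega>. (X \<omega>)\<^sup>2) - m\<^sup>2 \<le> v" using var zero_le_power2[of m] by linarith
    from mult_left_mono[OF this, of "l\<^sup>2"] show ?thesis by simp
  qed
  also have "\<dots> \<le> exp (l\<^sup>2 * v)" by (rule exp_ge_add_one_self)
  finally show ?thesis by (simp add: m_def ennreal_leI)
qed

text \<open>Chernoff's method with the exponent \<open>l = \<epsilon> / (2 v)\<close>, which minimises \<open>l\<^sup>2 v - l \<epsilon>\<close>. The side
  condition \<open>\<epsilon> b \<le> v\<close> is the Gaussian regime of Bernstein's inequality; it says exactly that this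
  \<open>l\<close> is admissible for the exponential moment bound.\<close>

lemma bernstein_upper:
  fixes X :: "'i \<Rightarrow> 'a \<Rightarrow> real" and b v \<epsilon> :: real
  assumes I: "finite I" and indep: "indep_vars (\<lambda>_. borel) X I"
    and bdd: "\<And>i. i \<in> I \<Longrightarrow> AE \<omega> in M. \<bar>X i \<omega>\<bar> \<le> b"
    and var: "\<And>i. i \<in> I \<Longrightarrow> expectation (\<lambda>\<omega>. (X i \<omega>)\<^sup>2) \<le> v"
    and eps: "0 < \<epsilon>" "\<epsilon> * b \<le> v" and v: "0 < v"
  shows "prob {\<omega>\<in>space M. card I * \<epsilon> \<le> (\<Sum>i\<in>I. X i \<omega> - expectation (X i))} \<le> exp (- (card I * \<epsilon>\<^sup>2 / (4 * v)))"
proof -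
  define l where "l = \<epsilon> / (2 * v)"
  have l: "0 < l" "2 * l * b \<le> 1"
    using eps v by (simp_all add: l_def divide_le_eq)
  have rv [measurable]: "random_variable borel (X i)" if "i \<in> I" for i
    using indep that by (auto simp: indep_vars_def)
  have "ennreal (prob {\<omega>\<in>space M. card I * \<epsilon> \<le> (\<Sum>i\<in>I. X i \<omega> - expectation (X i))})
      = emeasure M {\<omega>\<in>space M. card I * \<epsilon> \<le> (\<Sum>i\<in>I. X i \<omega> - expectation (X i))}"
    by (simp add: emeasure_eq_measure)
  also have "\<dots> \<le> ennreal (exp (- l * (card I * \<epsilon>)))
      * (\<integral>\<^sup>+\<omega>\<in>space M. exp (l * (\<Sum>i\<in>I. X i \<omega> - expectation (X i))) \<partial>M)"
    by (intro Chernoff_ineq_nn_integral_ge l) auto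
  also have "(\<integral>\<^sup>+\<omega>\<in>space M. exp (l * (\<Sum>i\<in>I. X i \<omega> - expectation (X i))) \<partial>M)
      = (\<integral>\<^sup>+\<omega>. (\<Prod>i\<in>I. ennreal (exp (l * (X i \<omega> - expectation (X i))))) \<partial>M)"
    by (intro nn_integral_cong) (simp add: sum_distrib_left exp_sum I prod_ennreal)
  also have "\<dots> = (\<Prod>i\<in>I. \<integral>\<^sup>+\<omega>. ennreal (exp (l * (X i \<omega> - expectation (X i)))) \<partial>M)"
    by (intro indep_vars_nn_integral I indep_vars_compose2[OF indep]) auto
  also have "ennreal (exp (- l * (card I * \<epsilon>))) * \<dots>
      \<le> ennreal (exp (- l * (card I * \<epsilon>))) * (\<Prod>i\<in>I. ennreal (exp (l\<^sup>2 * v)))"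
    by (intro mult_left_mono prod_mono_ennreal exp_moment_le[where b = b] bdd var rv)
       (use l in auto)
  also have "\<dots> = ennreal (exp (- l * (card I * \<epsilon>)) * exp (l\<^sup>2 * v) ^ card I)"
    by (simp add: ennreal_mult ennreal_power)
  also have "exp (- l * (card I * \<epsilon>)) * exp (l\<^sup>2 * v) ^ card I = exp (- (card I * \<epsilon>\<^sup>2 / (4 * v)))"
  proof -
    have "- l * (card I * \<epsilon>) + card I * (l\<^sup>2 * v) = - (card I * \<epsilon>\<^sup>2 / (4 * v))"
      unfolding l_def using v by (simp add: power2_eq_square divide_simps)
    then show ?thesis by (simp only: exp_of_nat_mult[symmetric] exp_add[symmetric])
  qed
  finally show ?thesis by simp
qed

lemma bernstein_two_sided:
  fixes X :: "'i \<Rightarrow> 'a \<Rightarrow> real" and b v \<epsilon> :: real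
  assumes I: "finite I" and indep: "indep_vars (\<lambda>_. borel) X I"
    and bdd: "\<And>i. i \<in> I \<Longrightarrow> AE \<omega> in M. \<bar>X i \<omega>\<bar> \<le> b"
    and var: "\<And>i. i \<in> I \<Longrightarrow> expectation (\<lambda>\<omega>. (X i \<omega>)\<^sup>2) \<le> v"
    and eps: "0 < \<epsilon>" "\<epsilon> * b \<le> v" and v: "0 < v"
  shows "prob {\<omega>\<in>space M. card I * \<epsilon> \<le> \<bar>\<Sum>i\<in>I. X i \<omega> - expectation (X i)\<bar>}
    \<le> 2 * exp (- (card I * \<epsilon>\<^sup>2 / (4 * v)))"
proof -
  have rv [measurable]: "random_variable borel (X i)" if "i \<in> I" for i
    using indep that by (auto simp: indep_vars_def)
  have indep': "indep_vars (\<lambda>_. borel) (\<lambda>i \<omega>. - X i \<omega>) I"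
    by (rule indep_vars_compose2[OF indep]) auto
  define c where "c = real (card I) * \<epsilon>"
  define S where "S \<omega> = (\<Sum>i\<in>I. X i \<omega> - expectation (X i))" for \<omega>
  have neg: "(\<Sum>i\<in>I. - X i \<omega> - expectation (\<lambda>\<omega>. - X i \<omega>)) = - S \<omega>" for \<omega>
  proof -
    have "(\<Sum>i\<in>I. - X i \<omega> - expectation (\<lambda>\<omega>. - X i \<omega>)) = (\<Sum>i\<in>I. - (X i \<omega> - expectation (X i)))"
      by (rule sum.cong) simp_all
    also have "\<dots> = - S \<omega>" unfolding S_def by (rule sum_negf)
    finally show ?thesis .
  qed
  have S [measurable]: "random_variable borel S" unfolding S_def[abs_def] by measurable
  have upper: "prob {\<omega>\<in>space M. c \<le> S \<omega>} \<le> exp (- (card I * \<epsilon>\<^sup>2 / (4 * v)))"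
    unfolding S_def c_def by (rule bernstein_upper[OF I indep bdd var eps v])
  have lower: "prob {\<omega>\<in>space M. c \<le> - S \<omega>} \<le> exp (- (card I * \<epsilon>\<^sup>2 / (4 * v)))"
    unfolding neg[symmetric] c_def
  proof (rule bernstein_upper[OF I indep' _ _ eps v])
    fix i assume i: "i \<in> I"
    show "AE \<omega> in M. \<bar>- X i \<omega>\<bar> \<le> b" unfolding abs_minus_cancel by (rule bdd[OF i])
    show "expectation (\<lambda>\<omega>. (- X i \<omega>)\<^sup>2) \<le> v" unfolding power2_minus by (rule var[OF i])
  qed
  have "{\<omega>\<in>space M. c \<le> \<bar>S \<omega>\<bar>} = {\<omega>\<in>space M. c \<le> S \<omega>} \<union> {\<omega>\<in>space M. c \<le> - S \<omega>}"
    by auto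
  also have "prob \<dots> \<le> prob {\<omega>\<in>space M. c \<le> S \<omega>} + prob {\<omega>\<in>space M. c \<le> - S \<omega>}"
    by (rule measure_Un_le) measurable
  also have "\<dots> \<le> 2 * exp (- (card I * \<epsilon>\<^sup>2 / (4 * v)))"
    using upper lower by simp
  finally show ?thesis unfolding S_def c_def .
qed

text \<open>A nonnegative variable whose mean is small compared with its bound has a second moment far
  below the square of that bound. For the local averages this replaces \<open>1/H\<^sup>2\<close> by \<open>1/H\<close>, where \<open>H\<close> is the product of the
  bandwidth volumes.\<close>

lemma second_moment_le:
  fixes f :: "'a \<Rightarrow> real"
  assumes f: "f \<in> borel_measurable M" and f0: "\<And>\<omega>. 0 \<le> f \<omega>" and bd: "AE \<omega> in M. f \<omega> \<le> c"
    and E: "expectation f \<le> m" and c: "0 \<le> c"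
  shows "expectation (\<lambda>\<omega>. (f \<omega>)\<^sup>2) \<le> c * m"
proof -
  have int: "integrable M f"
    by (rule integrable_const_bound[where B = c]) (use bd f0 f in simp_all)
  have sq: "AE \<omega> in M. (f \<omega>)\<^sup>2 \<le> c * f \<omega>"
    using bd by (rule eventually_mono) (simp add: power2_eq_square mult_right_mono f0)
  have "integrable M (\<lambda>\<omega>. (f \<omega>)\<^sup>2)"
    by (rule Bochner_Integration.integrable_bound[OF integrable_mult_right[OF int, of c]])
       (use f sq f0 c in simp_all)
  then have "expectation (\<lambda>\<omega>. (f \<omega>)\<^sup>2) \<le> expectation (\<lambda>\<omega>. c * f \<omega>)"
    using int sq by (intro integral_mono_AE) simp_all
  also have "\<dots> \<le> c * m" using E c by (simp add: mult_left_mono)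
  finally show ?thesis .
qed

end

section \<open>Uniform deviations over a bounded index set\<close>

text \<open>Round the coordinates to a grid of mesh \<open>\<delta> / D\<close>, where \<open>D\<close> is the dimension, and keep one point
  of the set for each occupied cell; two points in the same cell differ by at most \<open>\<delta> / D\<close> in each
  coordinate.\<close>

lemma finite_net:
  fixes T :: "'a::euclidean_space set"
  assumes "bounded T"
  shows "\<exists>C>0. \<forall>\<delta>\<in>{0<..1}. \<exists>F. finite F \<and> F \<subseteq> T \<and> real (card F) \<le> C / \<delta> ^ DIM('a) \<and>
    (\<forall>x\<in>T. \<exists>y\<in>F. dist x y \<le> \<delta>)"
proof -
  obtain R where R: "0 < R" "\<And>x. x \<in> T \<Longrightarrow> norm x \<le> R"
    using assms bounded_pos by metis
  define D where "D = real DIM('a)"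
  have D: "1 \<le> D" using DIM_positive[where 'a='a] unfolding D_def by linarith
  define C where "C = (2 * D * R + 3) ^ DIM('a)"
  have "\<exists>F. finite F \<and> F \<subseteq> T \<and> real (card F) \<le> C / \<delta> ^ DIM('a) \<and> (\<forall>x\<in>T. \<exists>y\<in>F. dist x y \<le> \<delta>)"
    if \<delta>: "0 < \<delta>" "\<delta> \<le> 1" for \<delta>
  proof -
    define cell :: "'a \<Rightarrow> 'a \<Rightarrow> int" where
      "cell x = (\<lambda>b\<in>Basis. \<lfloor>D / \<delta> * (x \<bullet> b)\<rfloor>)" for x
    define K where "K = \<lceil>D * R / \<delta>\<rceil>"
    have "0 \<le> D * R / \<delta>" using R(1) D \<delta> by simp
    then have K: "0 \<le> K" unfolding K_def by linarith
    have sub: "cell ` T \<subseteq> Basis \<rightarrow>\<^sub>E {-K..K}"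
    proof (rule image_subsetI)
      fix x assume x: "x \<in> T"
      have "\<lfloor>D / \<delta> * (x \<bullet> b)\<rfloor> \<in> {-K..K}" if b: "b \<in> Basis" for b
      proof -
        have "\<bar>x \<bullet> b\<bar> \<le> R" using Basis_le_norm[OF b, of x] R(2)[OF x] by linarith
        then have "\<bar>D / \<delta> * (x \<bullet> b)\<bar> \<le> D * R / \<delta>"
          using D \<delta> by (simp add: abs_mult divide_right_mono mult_left_mono)
        then have "- of_int K \<le> D / \<delta> * (x \<bullet> b)" "D / \<delta> * (x \<bullet> b) \<le> of_int K"
          unfolding K_def using le_of_int_ceiling[of "D * R / \<delta>"] by linarith+
        then show ?thesis by (simp add: floor_le_iff le_floor_iff)
      qed
      then show "cell x \<in> Basis \<rightarrow>\<^sub>E {-K..K}" by (auto simp: cell_def)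
    qed
    have fin: "finite (cell ` T)"
      by (rule finite_subset[OF sub]) (auto intro: finite_PiE)
    obtain F where F: "F \<subseteq> T" "cell ` F = cell ` T" "inj_on cell F"
      using subset_image_inj[of "cell ` T" cell T] by auto
    have finF: "finite F" using fin F finite_imageD by metis
    have "card F = card (cell ` T)" using F card_image by metis
    also have "\<dots> \<le> card (Basis \<rightarrow>\<^sub>E {-K..K} :: ('a \<Rightarrow> int) set)"
      by (rule card_mono[OF _ sub]) (auto intro: finite_PiE)
    also have "\<dots> = nat (2 * K + 1) ^ DIM('a)" by (simp add: card_PiE)
    finally have "real (card F) \<le> real (nat (2 * K + 1) ^ DIM('a))" by linarith
    also have "\<dots> = (2 * of_int K + 1) ^ DIM('a)" using K by (simp add: of_nat_nat)
    also have "\<dots> \<le> ((2 * D * R + 3) / \<delta>) ^ DIM('a)"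
    proof (rule power_mono)
      have "2 * of_int K + 1 \<le> 2 * (D * R / \<delta> + 1) + 1"
        unfolding K_def using of_int_ceiling_le_add_one[of "D * R / \<delta>"] by (intro add_right_mono mult_left_mono) auto
      also have "\<dots> \<le> (2 * D * R + 3) / \<delta>" using \<delta> by (simp add: field_simps)
      finally show "2 * real_of_int K + 1 \<le> (2 * D * R + 3) / \<delta>" .
    qed (use K in auto)
    finally have card: "real (card F) \<le> C / \<delta> ^ DIM('a)" by (simp add: C_def power_divide)
    have "\<exists>y\<in>F. dist x y \<le> \<delta>" if x: "x \<in> T" for x
    proof -
      obtain y where y: "y \<in> F" "cell y = cell x" using F(2) x by (metis imageE imageI)
      have "norm (x - y) \<le> (\<Sum>b\<in>Basis. \<bar>(x - y) \<bullet> b\<bar>)" by (rule norm_le_l1)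
      also have "\<dots> \<le> (\<Sum>b\<in>(Basis::'a set). \<delta> / D)"
      proof (rule sum_mono)
        fix b :: 'a assume b: "b \<in> Basis"
        have "\<lfloor>D / \<delta> * (x \<bullet> b)\<rfloor> = \<lfloor>D / \<delta> * (y \<bullet> b)\<rfloor>"
          using fun_cong[OF y(2), of b] b by (simp add: cell_def)
        then have "\<bar>D / \<delta> * (x \<bullet> b) - D / \<delta> * (y \<bullet> b)\<bar> \<le> 1" by linarith
        then have "D / \<delta> * \<bar>(x - y) \<bullet> b\<bar> \<le> 1"
          using D \<delta> unfolding right_diff_distrib[symmetric] inner_diff_left[symmetric] abs_mult
          by simp
        then show "\<bar>(x - y) \<bullet> b\<bar> \<le> \<delta> / D" using D \<delta> by (simp add: field_simps)
      qed
      also have "\<dots> = \<delta>" using D by (simp add: D_def)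
      finally show ?thesis using y by (auto simp: dist_norm)
    qed
    with finF F(1) card show ?thesis by blast
  qed
  moreover have "0 < C" using D R by (simp add: C_def add_nonneg_pos)
  ultimately show ?thesis by (intro exI[of _ C] conjI ballI) auto
qed

context prob_space
begin

text \<open>Union bound over the net. Moving from a point to the nearest net point costs \<open>l \<delta>\<close> for
  each variable and once more for its expectation, hence the term \<open>2 l \<delta>\<close>. Since the index set is
  uncountable, the supremum itself need not be measurable; the exceptional event \<open>E\<close> is built from
  the net and one null set.\<close>

lemma uniform_deviation_on_net:
  fixes f :: "'i \<Rightarrow> 'x::metric_space \<Rightarrow> 'a \<Rightarrow> real" and \<delta> \<epsilon> b v l :: real
  assumes I: "finite I" and F: "finite F" "F \<subseteq> T" and net: "\<And>x. x \<in> T \<Longrightarrow> \<exists>y\<in>F. dist x y \<le> \<delta>"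
    and indep: "\<And>x. x \<in> T \<Longrightarrow> indep_vars (\<lambda>_. borel) (\<lambda>i. f i x) I"
    and bdd: "\<And>i x. i \<in> I \<Longrightarrow> x \<in> T \<Longrightarrow> AE \<omega> in M. \<bar>f i x \<omega>\<bar> \<le> b"
    and var: "\<And>i x. i \<in> I \<Longrightarrow> x \<in> T \<Longrightarrow> expectation (\<lambda>\<omega>. (f i x \<omega>)\<^sup>2) \<le> v"
    and lip: "\<And>i. i \<in> I \<Longrightarrow> AE \<omega> in M. \<forall>x\<in>T. \<forall>y\<in>T. \<bar>f i x \<omega> - f i y \<omega>\<bar> \<le> l * dist x y"
    and l: "0 \<le> l" and eps: "0 < \<epsilon>" "\<epsilon> * b \<le> v" and v: "0 < v"
  shows "\<exists>E\<in>events. prob E \<le> card F * (2 * exp (- (card I * \<epsilon>\<^sup>2 / (4 * v)))) \<and>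
    (\<forall>\<omega>\<in>space M - E. \<forall>x\<in>T. \<bar>\<Sum>i\<in>I. f i x \<omega> - expectation (f i x)\<bar> \<le> card I * (\<epsilon> + 2 * (l * \<delta>)))"
proof -
  have rv: "random_variable borel (f i x)" if "i \<in> I" "x \<in> T" for i x
    using indep[OF that(2)] that(1) by (auto simp: indep_vars_def)
  have int: "integrable M (f i x)" if "i \<in> I" "x \<in> T" for i x
    using bdd[OF that] rv[OF that] by (intro integrable_const_bound[where B = b]) simp_all
  have lipE: "\<bar>expectation (f i x) - expectation (f i y)\<bar> \<le> l * dist x y"
    if i: "i \<in> I" and xy: "x \<in> T" "y \<in> T" for i x y
  proof -
    have ixy: "integrable M (\<lambda>\<omega>. f i x \<omega> - f i y \<omega>)"
      by (intro Bochner_Integration.integrable_diff int i xy)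
    have "expectation (f i x) - expectation (f i y) = expectation (\<lambda>\<omega>. f i x \<omega> - f i y \<omega>)"
      using int[OF i xy(1)] int[OF i xy(2)] by simp
    also have "\<bar>\<dots>\<bar> \<le> expectation (\<lambda>\<omega>. \<bar>f i x \<omega> - f i y \<omega>\<bar>)" by (rule integral_abs_bound)
    also have "\<dots> \<le> l * dist x y"
    proof (rule integral_le_const)
      show "integrable M (\<lambda>\<omega>. \<bar>f i x \<omega> - f i y \<omega>\<bar>)" by (rule integrable_abs[OF ixy])
      show "AE \<omega> in M. \<bar>f i x \<omega> - f i y \<omega>\<bar> \<le> l * dist x y"
        using lip[OF i] by (rule eventually_mono) (use xy in blast)
    qed
    finally show ?thesis .
  qed
  have "AE \<omega> in M. \<forall>i\<in>I. \<forall>x\<in>T. \<forall>y\<in>T. \<bar>f i x \<omega> - f i y \<omega>\<bar> \<le> l * dist x y"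
    by (rule AE_finite_allI[OF I lip])
  then obtain N where N: "N \<in> null_sets M"
    and lipN: "\<And>\<omega> i x y. \<omega> \<in> space M - N \<Longrightarrow> i \<in> I \<Longrightarrow> x \<in> T \<Longrightarrow> y \<in> T \<Longrightarrow>
      \<bar>f i x \<omega> - f i y \<omega>\<bar> \<le> l * dist x y"
    by (rule AE_E3) blast
  define A where "A y = {\<omega>\<in>space M. card I * \<epsilon> \<le> \<bar>\<Sum>i\<in>I. f i y \<omega> - expectation (f i y)\<bar>}" for y
  have Am: "A y \<in> events" if "y \<in> F" for y
  proof -
    have "y \<in> T" using F that by auto
    note rv[OF _ this, measurable]
    show ?thesis unfolding A_def by measurable
  qed
  define E where "E = N \<union> (\<Union>y\<in>F. A y)"
  have Em: "E \<in> events" using N Am F by (auto simp: E_def intro!: sets.finite_UN)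
  have UA: "(\<Union>y\<in>F. A y) \<in> events" using Am F by (intro sets.finite_UN) auto
  have "prob E \<le> prob N + prob (\<Union>y\<in>F. A y)"
    unfolding E_def using N UA by (intro measure_Un_le) auto
  also have "prob N = 0" using N by (rule measure_eq_0_null_sets)
  also have "prob (\<Union>y\<in>F. A y) \<le> (\<Sum>y\<in>F. prob (A y))"
    by (rule measure_UNION_le) (use Am F in auto)
  also have "\<dots> \<le> (\<Sum>y\<in>F. 2 * exp (- (card I * \<epsilon>\<^sup>2 / (4 * v))))"
  proof (rule sum_mono)
    fix y assume "y \<in> F"
    then have y: "y \<in> T" using F by auto
    show "prob (A y) \<le> 2 * exp (- (card I * \<epsilon>\<^sup>2 / (4 * v)))"
      unfolding A_def by (rule bernstein_two_sided[OF I indep[OF y] bdd[OF _ y] var[OF _ y] eps v])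
  qed
  finally have pE: "prob E \<le> card F * (2 * exp (- (card I * \<epsilon>\<^sup>2 / (4 * v))))" by simp
  have dev: "\<bar>\<Sum>i\<in>I. f i x \<omega> - expectation (f i x)\<bar> \<le> card I * (\<epsilon> + 2 * (l * \<delta>))"
    if \<omega>: "\<omega> \<in> space M - E" and x: "x \<in> T" for \<omega> x
  proof -
    obtain y where y: "y \<in> F" "dist x y \<le> \<delta>" using net[OF x] by auto
    have yT: "y \<in> T" using y F by auto
    have "\<omega> \<notin> A y" "\<omega> \<in> space M - N" "\<omega> \<in> space M" using \<omega> y by (auto simp: E_def)
    then have fy: "\<bar>\<Sum>i\<in>I. f i y \<omega> - expectation (f i y)\<bar> \<le> card I * \<epsilon>" by (auto simp: A_def)
    have ld: "l * dist x y \<le> l * \<delta>" using y l by (intro mult_left_mono)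
    have "\<bar>(\<Sum>i\<in>I. f i x \<omega> - expectation (f i x)) - (\<Sum>i\<in>I. f i y \<omega> - expectation (f i y))\<bar>
        = \<bar>\<Sum>i\<in>I. (f i x \<omega> - f i y \<omega>) - (expectation (f i x) - expectation (f i y))\<bar>"
      unfolding sum_subtractf[symmetric]
      by (intro arg_cong[where f = abs] sum.cong refl) linarith
    also have "\<dots> \<le> (\<Sum>i\<in>I. \<bar>(f i x \<omega> - f i y \<omega>) - (expectation (f i x) - expectation (f i y))\<bar>)"
      by (rule sum_abs)
    also have "\<dots> \<le> (\<Sum>i\<in>I. 2 * (l * \<delta>))"
    proof (rule sum_mono)
      fix i assume i: "i \<in> I"
      show "\<bar>(f i x \<omega> - f i y \<omega>) - (expectation (f i x) - expectation (f i y))\<bar> \<le> 2 * (l * \<delta>)"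
        using lipN[OF \<open>\<omega> \<in> space M - N\<close> i x yT] lipE[OF i x yT] ld by linarith
    qed
    finally have "\<bar>(\<Sum>i\<in>I. f i x \<omega> - expectation (f i x)) - (\<Sum>i\<in>I. f i y \<omega> - expectation (f i y))\<bar>
        \<le> card I * (2 * (l * \<delta>))" by simp
    with fy show ?thesis unfolding distrib_left by linarith
  qed
  show ?thesis
  proof (intro bexI[of _ E] conjI ballI)
    show "prob E \<le> card F * (2 * exp (- (card I * \<epsilon>\<^sup>2 / (4 * v))))" by (rule pE)
  qed (fact Em | rule dev; assumption)+
qed

text \<open>The tuning of mesh and deviation level: a mesh of \<open>n\<close> to the power \<open>-(p+1)\<close> makes the
  discretisation error \<open>O(1/n)\<close>, which is below the target rate, and costs \<open>O(n\<^sup>q)\<close> net points. The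
  factor \<open>t\<close> is chosen so that a single deviation has probability at most of order \<open>n\<close> to the
  power \<open>-(q+1)\<close>; the union bound then leaves \<open>O(1/n)\<close>.\<close>

lemma uniform_deviation_rate:
  fixes f :: "nat \<Rightarrow> nat \<Rightarrow> 'x::euclidean_space \<Rightarrow> 'a \<Rightarrow> real" and H :: "nat \<Rightarrow> real" and B :: real
  assumes T: "bounded T" and B: "0 < B"
    and H: "\<forall>\<^sub>F n in sequentially. 0 < H n \<and> H n \<le> 1"
    and lim: "(\<lambda>n. ln (real n) / (real n * H n)) \<longlonglongrightarrow> 0"
    and indep: "\<forall>\<^sub>F n in sequentially. \<forall>x\<in>T. indep_vars (\<lambda>_. borel) (\<lambda>i. f n i x) {1..n}"
    and bdd: "\<forall>\<^sub>F n in sequentially. \<forall>i\<in>{1..n}. \<forall>x\<in>T. AE \<omega> in M. \<bar>f n i x \<omega>\<bar> \<le> B / H n"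
    and var: "\<forall>\<^sub>F n in sequentially. \<forall>i\<in>{1..n}. \<forall>x\<in>T. expectation (\<lambda>\<omega>. (f n i x \<omega>)\<^sup>2) \<le> B / H n"
    and lip: "\<forall>\<^sub>F n in sequentially. \<forall>i\<in>{1..n}. AE \<omega> in M. \<forall>x\<in>T. \<forall>y\<in>T.
      \<bar>f n i x \<omega> - f n i y \<omega>\<bar> \<le> B * real n ^ p * dist x y"
  shows "\<exists>C>0. \<forall>\<epsilon>>0. \<forall>\<^sub>F n in sequentially. \<exists>E\<in>events. prob E \<le> \<epsilon> \<and>
    (\<forall>\<omega>\<in>space M - E. \<forall>x\<in>T. \<bar>\<Sum>i=1..n. f n i x \<omega> - expectation (f n i x)\<bar>
      \<le> real n * (C * sqrt (ln (real n) / (real n * H n))))"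
proof -
  from finite_net[OF T] obtain C0 where C0: "0 < C0 \<and> (\<forall>\<delta>\<in>{0<..1}. \<exists>F. finite F \<and> F \<subseteq> T \<and>
    real (card F) \<le> C0 / \<delta> ^ DIM('x) \<and> (\<forall>x\<in>T. \<exists>y\<in>F. dist x y \<le> \<delta>))" ..
  define q where "q = (p + 1) * DIM('x)"
  \<comment> \<open>This makes the Bernstein exponent equal to \<open>(q + 1) ln n\<close>.\<close>
  define t :: real where "t = sqrt (4 * B * real (q + 1))"
  have "0 < 4 * B * real (q + 1)" using B by simp
  then have t: "0 < t" "t\<^sup>2 = 4 * B * real (q + 1)"
    unfolding t_def by (rule real_sqrt_gt_zero, intro real_sqrt_pow2 less_imp_le)
  define r where "r n = sqrt (ln (real n) / (real n * H n))" for n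
  have "(\<lambda>n. t * r n) \<longlonglongrightarrow> t * sqrt 0"
    unfolding r_def by (intro tendsto_intros lim)
  then have small: "\<forall>\<^sub>F n in sequentially. t * r n < 1"
    by (intro order_tendstoD(2)[of _ 0]) auto
  have "\<forall>\<^sub>F n in sequentially. \<exists>E\<in>events. prob E \<le> \<epsilon> \<and>
    (\<forall>\<omega>\<in>space M - E. \<forall>x\<in>T. \<bar>\<Sum>i=1..n. f n i x \<omega> - expectation (f n i x)\<bar>
      \<le> real n * ((t + 2 * B) * r n))" if \<epsilon>: "0 < \<epsilon>" for \<epsilon>
  proof -
    have "(\<lambda>n. 2 * C0 / real n) \<longlonglongrightarrow> 0" by (rule lim_const_over_n)
    then have "\<forall>\<^sub>F n in sequentially. 2 * C0 / real n < \<epsilon>"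
      by (rule order_tendstoD(2)[OF _ \<epsilon>])
    then show ?thesis
      using H indep bdd var lip small eventually_ge_at_top[of 3]
    proof eventually_elim
      case (elim n)
      note indep_n = elim(3) and bdd_n = elim(4) and var_n = elim(5) and lip_n = elim(6)
      have n: "3 \<le> n" "0 < real n" using elim(8) by auto
      have Hn: "0 < H n" "H n \<le> 1" using elim(2) by auto
      have tr: "t * r n \<le> 1" using elim(7) by simp
      have "exp 1 \<le> real n" using exp_le n by linarith
      then have ln: "1 \<le> ln (real n)" using n by (simp add: ln_ge_iff)
      define \<delta> where "\<delta> = 1 / real n ^ (p + 1)"
      have "1 \<le> real n ^ (p + 1)" using n by (intro one_le_power) simp
      then have \<delta>: "0 < \<delta>" "\<delta> \<le> 1" unfolding \<delta>_def by simp_all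
      from C0 \<delta> have "\<exists>F. finite F \<and> F \<subseteq> T \<and>
        real (card F) \<le> C0 / \<delta> ^ DIM('x) \<and> (\<forall>x\<in>T. \<exists>y\<in>F. dist x y \<le> \<delta>)" by simp
      then obtain F where F0: "finite F \<and> F \<subseteq> T \<and>
        real (card F) \<le> C0 / \<delta> ^ DIM('x) \<and> (\<forall>x\<in>T. \<exists>y\<in>F. dist x y \<le> \<delta>)" ..
      then have F: "finite F" "F \<subseteq> T" "real (card F) \<le> C0 / \<delta> ^ DIM('x)"
        "\<And>x. x \<in> T \<Longrightarrow> \<exists>y\<in>F. dist x y \<le> \<delta>" by simp_all
      have r0: "0 < r n" using n ln Hn by (simp add: r_def)
      have r2: "(r n)\<^sup>2 = ln (real n) / (real n * H n)" using n ln Hn by (simp add: r_def)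
      have "\<exists>E\<in>events. prob E \<le> card F * (2 * exp (- (card {1..n} * (t * r n)\<^sup>2 / (4 * (B / H n))))) \<and>
        (\<forall>\<omega>\<in>space M - E. \<forall>x\<in>T. \<bar>\<Sum>i\<in>{1..n}. f n i x \<omega> - expectation (f n i x)\<bar>
          \<le> card {1..n} * (t * r n + 2 * (B * real n ^ p * \<delta>)))"
      proof (rule uniform_deviation_on_net[where b = "B / H n"])
        show "t * r n * (B / H n) \<le> B / H n"
          using t r0 tr B Hn by (intro mult_left_le_one_le) auto
        show "finite {1..n}" by simp
        show "finite F" "F \<subseteq> T" by fact+
        show "\<exists>y\<in>F. dist x y \<le> \<delta>" if "x \<in> T" for x by (rule F(4)[OF that])
        show "indep_vars (\<lambda>_. borel) (\<lambda>i. f n i x) {1..n}" if "x \<in> T" for x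
          using indep_n that by blast
        show "AE \<omega> in M. \<bar>f n i x \<omega>\<bar> \<le> B / H n" if "i \<in> {1..n}" "x \<in> T" for i x
          using bdd_n that by blast
        show "expectation (\<lambda>\<omega>. (f n i x \<omega>)\<^sup>2) \<le> B / H n" if "i \<in> {1..n}" "x \<in> T" for i x
          using var_n that by blast
        show "AE \<omega> in M. \<forall>x\<in>T. \<forall>y\<in>T. \<bar>f n i x \<omega> - f n i y \<omega>\<bar> \<le> B * real n ^ p * dist x y"
          if "i \<in> {1..n}" for i using lip_n that by blast
        show "0 \<le> B * real n ^ p" "0 < t * r n" "0 < B / H n" using B t r0 Hn by auto
      qed
      then obtain E where E: "E \<in> events"
        and E': "prob E \<le> card F * (2 * exp (- (card {1..n} * (t * r n)\<^sup>2 / (4 * (B / H n))))) \<and>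
        (\<forall>\<omega>\<in>space M - E. \<forall>x\<in>T. \<bar>\<Sum>i\<in>{1..n}. f n i x \<omega> - expectation (f n i x)\<bar>
          \<le> card {1..n} * (t * r n + 2 * (B * real n ^ p * \<delta>)))" ..
      note pE = conjunct1[OF E'] and dev = bspec[OF bspec[OF conjunct2[OF E']]]
      have expo: "card {1..n} * (t * r n)\<^sup>2 / (4 * (B / H n)) = real (q + 1) * ln (real n)"
      proof -
        have gen: "m * (4 * B * k * (lg / (m * h))) / (4 * (B / h)) = k * lg"
          if "0 < m" "0 < h" for m k lg h :: real
          using B that by simp
        show ?thesis unfolding power_mult_distrib t(2) r2 card_atLeastAtMost
          using gen[OF n(2) Hn(1)] by simp
      qed
      have "exp (real (q + 1) * ln (real n)) = real n ^ (q + 1)"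
        unfolding exp_of_nat_mult using n(2) by (simp only: exp_ln)
      then have "exp (- (card {1..n} * (t * r n)\<^sup>2 / (4 * (B / H n)))) = 1 / real n ^ (q + 1)"
        unfolding expo exp_minus by (simp only: inverse_eq_divide)
      from pE[unfolded this] have "prob E \<le> card F * (2 * (1 / real n ^ (q + 1)))" .
      also have "\<dots> \<le> (C0 / \<delta> ^ DIM('x)) * (2 * (1 / real n ^ (q + 1)))"
        by (rule mult_right_mono[OF F(3)]) simp
      also have "\<delta> ^ DIM('x) = 1 / real n ^ q"
        unfolding \<delta>_def q_def power_mult power_one_over ..
      also have "C0 / (1 / real n ^ q) * (2 * (1 / real n ^ (q + 1))) = 2 * C0 / real n"
      proof -
        have gen: "C0 / (1 / x) * (2 * (1 / (m * x))) = 2 * C0 / m" if "0 < x" "0 < m" for x m :: real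
          using that by simp
        show ?thesis using gen[of "real n ^ q" "real n"] n(2) by simp
      qed
      finally have "prob E \<le> \<epsilon>" using elim(1) by linarith
      moreover have "\<bar>\<Sum>i=1..n. f n i x \<omega> - expectation (f n i x)\<bar> \<le> real n * ((t + 2 * B) * r n)"
        if "\<omega> \<in> space M - E" "x \<in> T" for \<omega> x
      proof -
        have "real n ^ p * \<delta> = 1 / real n" using n by (simp add: \<delta>_def field_simps)
        also have "\<dots> \<le> r n"
        proof -
          have "1 / (real n * real n) \<le> ln (real n) / (real n * H n)"
            using n ln Hn by (intro frac_le mult_left_mono) auto
          then have "(1 / real n)\<^sup>2 \<le> (r n)\<^sup>2" unfolding r2 by (simp add: power2_eq_square)
          then show ?thesis by (rule power2_le_imp_le) (use r0 in simp)
        qed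
        finally have "B * real n ^ p * \<delta> \<le> B * r n" using B by (simp add: mult.assoc)
        then have "real n * (t * r n + 2 * (B * real n ^ p * \<delta>)) \<le> real n * ((t + 2 * B) * r n)"
          by (intro mult_left_mono) (auto simp: algebra_simps)
        then show ?thesis using dev[OF that] by simp
      qed
      ultimately show ?case using E by (intro bexI[of _ E] conjI ballI)
    qed
  qed
  then show ?thesis using t(1) B unfolding r_def
    by (intro exI[of _ "t + 2 * B"] conjI allI impI) simp_all
qed

end

section \<open>Boundary-corrected kernels\<close>

text \<open>A corkscrew condition: at every small scale \<open>s\<close>, the part of the set near any of its
  points contains a ball of radius proportional to \<open>s\<close>. It is what the cone condition and convexity
  have in common as far as lower bounds on kernel masses are concerned.\<close>

definition interior_balls :: "'a::euclidean_space set \<Rightarrow> bool" where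
  "interior_balls S \<longleftrightarrow> (\<exists>s0>0. \<exists>\<kappa>>0. \<forall>x\<in>S. \<forall>s. 0 < s \<and> s \<le> s0 \<longrightarrow>
     (\<exists>y. ball y (\<kappa> * s) \<subseteq> S \<inter> cball x s))"

text \<open>The facts about a normalised kernel at one bandwidth that enter the estimates, collected
  so that a single constant \<open>A\<close> serves all small bandwidths. The exponent in the Lipschitz bound is
  not sharp; any power of the bandwidth would do.\<close>

definition kernel_bounds :: "'a::euclidean_space set \<Rightarrow> ('a \<Rightarrow> real) \<Rightarrow> real \<Rightarrow> real \<Rightarrow> bool" where
  "kernel_bounds S K A h \<longleftrightarrow> is_kernel K \<and> 1 \<le> A \<and> 0 < h \<and> h \<le> 1 \<and>
    (\<forall>x\<in>S. \<forall>y. 0 \<le> kappa S K h x y \<and> kappa S K h x y \<le> A / h ^ DIM('a)) \<and>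
    (\<forall>x\<in>S. (\<integral>\<^sup>+y. ennreal (kappa S K h x y) * indicator S y \<partial>lborel) = 1) \<and>
    (\<forall>x\<in>S. \<forall>x'\<in>S. \<forall>y. \<bar>kappa S K h x y - kappa S K h x' y\<bar> \<le> A / h ^ (2 * DIM('a) + 1) * dist x x') \<and>
    (\<forall>x\<in>S. \<forall>y. kappa S K h x y \<noteq> 0 \<longrightarrow> norm (y - x) \<le> h)"

text \<open>Everything reduces to a lower bound for the normalising mass. The kernel is at least
  \<open>k\<close> on the ball of radius \<open>\<rho> h\<close>, a fixed proportion of which lies in \<open>S\<close>, so the mass is at least
  a constant \<open>c\<close> independent of \<open>h\<close> and of the point. The upper bound and the Lipschitz bound for
  the quotient follow from those for numerator and mass.\<close>

lemma kernel_bounds_small_bandwidth: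
  fixes S :: "'a::euclidean_space set" and K :: "'a \<Rightarrow> real"
  assumes S: "compact S" and balls: "interior_balls S" and K: "is_kernel K"
  shows "\<exists>A h0. 0 < h0 \<and> (\<forall>h. 0 < h \<and> h \<le> h0 \<longrightarrow> kernel_bounds S K A h)"
proof -
  let ?D = "DIM('a)"
  obtain s0 \<kappa> where s0: "0 < s0" and \<kappa>: "0 < \<kappa>"
    and ball: "\<And>x s. x \<in> S \<Longrightarrow> 0 < s \<Longrightarrow> s \<le> s0 \<Longrightarrow> \<exists>y. ball y (\<kappa> * s) \<subseteq> S \<inter> cball x s"
    using balls unfolding interior_balls_def by blast
  obtain B where B: "0 < B" "\<And>x. K x \<le> B"
    using K unfolding is_kernel_def bounded_pos
    by (metis abs_le_D1 rangeI real_norm_def)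
  obtain l where l: "l-lipschitz_on UNIV K"
    using K unfolding is_kernel_def by auto
  have l0: "0 \<le> l" using l by (rule lipschitz_on_nonneg)
  have K0: "0 \<le> K x" for x using K unfolding is_kernel_def by auto
  have Ksupp: "norm x \<le> 1" if "K x \<noteq> 0" for x
    using K that unfolding is_kernel_def by (meson linorder_not_less)
  obtain \<rho> k where \<rho>: "0 < \<rho>" and k: "0 < k" and Klow: "\<And>x. norm x \<le> \<rho> \<Longrightarrow> k \<le> K x"
    using K unfolding is_kernel_def by auto
  have Kmeas [measurable]: "K \<in> borel_measurable borel"
    using l by (intro borel_measurable_continuous_onI lipschitz_on_continuous_on)
  have Smeas [measurable]: "S \<in> sets borel" using S by (simp add: compact_imp_closed)
  define V where "V = measure lborel S"
  have V0: "0 \<le> V" by (simp add: V_def)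
  have Sfin: "emeasure lborel S < \<infinity>" using S emeasure_compact_finite by blast
  define kk where "kk h x y = K ((y - x) /\<^sub>R h) / h ^ ?D" for h x y
  have [measurable]: "kk h x \<in> borel_measurable borel" for h x
    unfolding kk_def[abs_def] by measurable
  have kk0: "0 \<le> kk h x y" if "0 < h" for h x y using that K0 by (simp add: kk_def)
  have kkB: "kk h x y \<le> B / h ^ ?D" if "0 < h" for h x y
    using that B by (simp add: kk_def divide_right_mono)
  have kkL: "\<bar>kk h x y - kk h x' y\<bar> \<le> l / h ^ (?D + 1) * dist x x'" if h: "0 < h" for h x x' y
  proof -
    have "\<bar>K ((y - x) /\<^sub>R h) - K ((y - x') /\<^sub>R h)\<bar> \<le> l * dist ((y - x) /\<^sub>R h) ((y - x') /\<^sub>R h)"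
      using lipschitz_onD[OF l, of "(y - x) /\<^sub>R h" "(y - x') /\<^sub>R h"] by (simp add: dist_real_def)
    also have "dist ((y - x) /\<^sub>R h) ((y - x') /\<^sub>R h) = dist x x' / h"
      using h by (simp add: dist_norm norm_minus_commute divide_inverse mult.commute
          flip: scaleR_diff_right)
    finally have "\<bar>K ((y - x) /\<^sub>R h) - K ((y - x') /\<^sub>R h)\<bar> / h ^ ?D \<le> l * (dist x x' / h) / h ^ ?D"
      using h by (intro divide_right_mono) auto
    then show ?thesis using h by (simp add: kk_def abs_divide mult_ac flip: diff_divide_distrib)
  qed
  have int: "set_integrable lborel S (kk h x)" if h: "0 < h" for h x
    unfolding set_integrable_def
    by (rule integrableI_bounded_set_indicator[where B = "B / h ^ ?D"])
       (use kk0[OF h] kkB[OF h] Sfin in \<open>auto intro!: AE_I2\<close>)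
  define c where "c = min 1 (k * unit_ball_vol (real ?D) * (\<kappa> * \<rho>) ^ ?D)"
  have c: "0 < c" "c \<le> 1" using k \<kappa> \<rho> by (auto simp: c_def)
  have mass_kk: "kernel_mass S K h x = (LINT y:S|lborel. kk h x y)" for h x
    by (simp add: kernel_mass_def kk_def)
  \<comment> \<open>The scale \<open>\<rho> h\<close> is admissible for the interior balls once \<open>h \<le> s0 / \<rho>\<close>.\<close>
  have mass_low: "c \<le> kernel_mass S K h x" if h: "0 < h" "h \<le> s0 / \<rho>" and x: "x \<in> S" for h x
  proof -
    obtain y where y: "ball y (\<kappa> * (\<rho> * h)) \<subseteq> S \<inter> cball x (\<rho> * h)"
      using ball[OF x, of "\<rho> * h"] h \<rho> by (auto simp: field_simps)
    let ?b = "ball y (\<kappa> * (\<rho> * h))"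
    have "c \<le> k / h ^ ?D * (unit_ball_vol (real ?D) * (\<kappa> * (\<rho> * h)) ^ ?D)"
      using h by (simp add: c_def power_mult_distrib)
    also have "\<dots> = (LINT y:?b|lborel. k / h ^ ?D)"
      using h \<kappa> \<rho> by (simp add: set_lebesgue_integral_def content_ball)
    also have "\<dots> \<le> (LINT y:?b|lborel. kk h x y)"
    proof (rule set_integral_mono)
      show "set_integrable lborel ?b (\<lambda>y. k / h ^ ?D)"
        using emeasure_bounded_finite[OF bounded_ball[of y "\<kappa> * (\<rho> * h)"]]
        by (simp add: set_integrable_def)
      show "set_integrable lborel ?b (kk h x)"
        by (rule set_integrable_subset[OF int[OF h(1)]]) (use y in auto)
      fix v assume "v \<in> ?b"
      then have "v \<in> cball x (\<rho> * h)" using y by blast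
      then have "norm (v - x) \<le> \<rho> * h" by (simp add: dist_norm norm_minus_commute)
      then have "norm (v - x) / h \<le> \<rho>" using h by (simp add: divide_le_eq)
      moreover have "norm ((v - x) /\<^sub>R h) = norm (v - x) / h"
        using h by (simp only: norm_scaleR) (simp add: divide_inverse mult.commute)
      ultimately have "k \<le> K ((v - x) /\<^sub>R h)" by (intro Klow) (simp only:)
      then show "k / h ^ ?D \<le> kk h x v" using h by (simp add: kk_def divide_right_mono)
    qed
    also have "\<dots> \<le> (LINT y:S|lborel. kk h x y)"
      unfolding set_lebesgue_integral_def
    proof (rule integral_mono)
      show "integrable lborel (\<lambda>v. indicator ?b v *\<^sub>R kk h x v)"
        using set_integrable_subset[OF int[OF h(1), of x], of ?b] y by (simp add: set_integrable_def)
      show "integrable lborel (\<lambda>v. indicator S v *\<^sub>R kk h x v)"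
        using int[OF h(1), of x] by (simp add: set_integrable_def)
      show "indicator ?b v *\<^sub>R kk h x v \<le> indicator S v *\<^sub>R kk h x v" for v
        using y kk0[OF h(1), of x v] by (auto simp: indicator_def simp del: mem_ball)
    qed
    finally show ?thesis by (simp add: mass_kk)
  qed
  have mass_lip: "\<bar>kernel_mass S K h x - kernel_mass S K h x'\<bar> \<le> V * (l / h ^ (?D + 1) * dist x x')"
    if h: "0 < h" for h x x'
  proof -
    have "kernel_mass S K h x - kernel_mass S K h x' = (LINT y:S|lborel. kk h x y - kk h x' y)"
      unfolding mass_kk by (rule set_integral_diff(2)[symmetric]) (intro int h)+
    also have "\<bar>\<dots>\<bar> \<le> (LINT y:S|lborel. \<bar>kk h x y - kk h x' y\<bar>)"
      using set_integral_norm_bound[OF set_integral_diff(1)[OF int[OF h] int[OF h]], of x x'] by simp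
    also have "\<dots> \<le> (LINT y:S|lborel. l / h ^ (?D + 1) * dist x x')"
    proof (rule set_integral_mono)
      show "set_integrable lborel S (\<lambda>y. \<bar>kk h x y - kk h x' y\<bar>)"
        by (intro set_integrable_abs set_integral_diff(1) int h)
      show "set_integrable lborel S (\<lambda>y. l / h ^ (?D + 1) * dist x x')"
        using Sfin by (simp add: set_integrable_def)
    qed (rule kkL[OF h])
    also have "\<dots> = V * (l / h ^ (?D + 1) * dist x x')"
      using Sfin by (simp add: V_def set_lebesgue_integral_def)
    finally show ?thesis .
  qed
  have kappa_eq: "kappa S K h x y = kk h x y / kernel_mass S K h x" for h x y
    by (simp add: kappa_def kk_def)
  define h0 where "h0 = min 1 (s0 / \<rho>)"
  define C where "C = 1 + B / c + l / c + B * V * l / (c * c)"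
  have t: "0 \<le> B / c" "0 \<le> l / c" "0 \<le> B * V * l / (c * c)"
    using B c l0 V0 by auto
  have est: "kernel_bounds S K C h" if h: "0 < h" "h \<le> h0" for h
    unfolding kernel_bounds_def
  proof (intro conjI ballI allI impI)
    show "is_kernel K" "1 \<le> C" "0 < h" "h \<le> 1"
      using K t h by (simp_all add: C_def h0_def)
  next
    fix x y assume x: "x \<in> S"
    have m: "c \<le> kernel_mass S K h x" using h x by (intro mass_low) (auto simp: h0_def)
    show "0 \<le> kappa S K h x y" using m c kk0[OF h(1)] by (simp add: kappa_eq)
    have "kappa S K h x y \<le> B / h ^ ?D / c"
      unfolding kappa_eq by (intro frac_le kk0 kkB h c m) (use B h in auto)
    also have "\<dots> = (B / c) / h ^ ?D" by simp
    also have "\<dots> \<le> C / h ^ ?D"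
      using t h by (intro divide_right_mono) (auto simp: C_def)
    finally show "kappa S K h x y \<le> C / h ^ ?D" .
  next
    fix x y assume "kappa S K h x y \<noteq> 0"
    then have "K ((y - x) /\<^sub>R h) \<noteq> 0" by (auto simp: kappa_eq kk_def)
    from Ksupp[OF this] have "norm (y - x) / h \<le> 1"
      using h by (simp only: norm_scaleR) (simp add: divide_inverse mult.commute)
    then show "norm (y - x) \<le> h" using h by (simp add: divide_le_eq)
  next
    fix x assume x: "x \<in> S"
    have m: "c \<le> kernel_mass S K h x" using h x by (intro mass_low) (auto simp: h0_def)
    have "(\<integral>\<^sup>+y. ennreal (kappa S K h x y) * indicator S y \<partial>lborel)
        = (\<integral>\<^sup>+y. ennreal (indicator S y *\<^sub>R kappa S K h x y) \<partial>lborel)"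
      by (intro nn_integral_cong) (auto simp: indicator_def)
    also have "\<dots> = ennreal (LINT y|lborel. indicator S y *\<^sub>R kappa S K h x y)"
    proof (rule nn_integral_eq_integral)
      show "integrable lborel (\<lambda>y. indicator S y *\<^sub>R kappa S K h x y)"
        using set_integrable_divide[OF int[OF h(1), of x], of "kernel_mass S K h x"] m c
        by (simp add: set_integrable_def kappa_eq[abs_def])
      show "AE y in lborel. 0 \<le> indicator S y *\<^sub>R kappa S K h x y"
        using m c kk0[OF h(1)] by (auto simp: kappa_eq)
    qed
    also have "(LINT y|lborel. indicator S y *\<^sub>R kappa S K h x y) = 1"
      using m c by (simp add: kappa_eq mass_kk set_lebesgue_integral_def)
    finally show "(\<integral>\<^sup>+y. ennreal (kappa S K h x y) * indicator S y \<partial>lborel) = 1" by simp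
  next
    fix x x' y assume x: "x \<in> S" "x' \<in> S"
    have h1: "h \<le> 1" using h by (simp add: h0_def)
    let ?m = "kernel_mass S K h x" and ?m' = "kernel_mass S K h x'"
    have m: "c \<le> ?m" "c \<le> ?m'" using h x by (auto intro!: mass_low simp: h0_def)
    have eq: "kappa S K h x y - kappa S K h x' y
        = (kk h x y - kk h x' y) / ?m + kk h x' y * (?m' - ?m) / (?m * ?m')"
      using m c by (simp add: kappa_eq field_simps)
    have "\<bar>kappa S K h x y - kappa S K h x' y\<bar>
        \<le> \<bar>kk h x y - kk h x' y\<bar> / ?m + kk h x' y * \<bar>?m' - ?m\<bar> / (?m * ?m')"
      unfolding eq using m c kk0[OF h(1), of x' y]
      by (intro order.trans[OF abs_triangle_ineq]) (simp add: abs_mult)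
    also have "\<dots> \<le> (l / h ^ (?D + 1) * dist x x') / c
        + (B / h ^ ?D) * (V * (l / h ^ (?D + 1) * dist x x')) / (c * c)"
    proof (intro add_mono frac_le mult_mono)
      show "\<bar>?m' - ?m\<bar> \<le> V * (l / h ^ (?D + 1) * dist x x')"
        using mass_lip[OF h(1), of x' x] by (simp add: dist_commute)
    qed (use kkL kkB kk0 h m c B l0 V0 in \<open>auto intro!: mult_nonneg_nonneg divide_nonneg_nonneg\<close>)
    also have "\<dots> \<le> (l / h ^ (2 * ?D + 1) * dist x x') / c
        + (B / h ^ ?D) * (V * (l / h ^ (?D + 1) * dist x x')) / (c * c)"
      using h h1 l0 c V0 B
      by (intro add_mono divide_right_mono mult_right_mono divide_left_mono power_decreasing) auto
    also have "\<dots> = (l / c + B * V * l / (c * c)) / h ^ (2 * ?D + 1) * dist x x'"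
      by (simp add: add_divide_distrib distrib_left distrib_right mult_2 mult_2_right power_add mult_ac)
    also have "\<dots> \<le> C / h ^ (2 * ?D + 1) * dist x x'"
      using t h by (intro mult_right_mono divide_right_mono) (auto simp: C_def)
    finally show "\<bar>kappa S K h x y - kappa S K h x' y\<bar> \<le> C / h ^ (2 * ?D + 1) * dist x x'" .
  qed
  moreover have "0 < h0" using s0 \<rho> by (simp add: h0_def)
  ultimately show ?thesis by blast
qed

lemma kappa_measurable [measurable]:
  assumes "is_kernel K"
  shows "kappa S K h x \<in> borel_measurable borel"
proof -
  obtain l where "l-lipschitz_on UNIV K" using assms unfolding is_kernel_def by auto
  then have [measurable]: "K \<in> borel_measurable borel"
    by (intro borel_measurable_continuous_onI lipschitz_on_continuous_on)
  show ?thesis unfolding kappa_def[abs_def] by measurable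
qed

text \<open>A cone of fixed opening and height \<open>\<rho>\<close> contains, on its axis at distance \<open>r \<le> \<rho>/4\<close> from the
  apex, a ball of radius proportional to \<open>r\<close>: a point at distance less than \<open>\<delta> r\<close> from \<open>r \<xi>\<close> has a
  direction within \<open>2 \<delta>\<close> of the axis \<open>\<xi>\<close>.\<close>

lemma cone_condition_interior_balls:
  fixes S :: "'a::euclidean_space set"
  assumes "cone_condition S"
  shows "interior_balls S"
proof -
  obtain \<rho> \<eta> where \<rho>: "0 < \<rho>" and \<eta>: "0 < \<eta>"
    and cone: "\<And>z. z \<in> S \<Longrightarrow> \<exists>\<xi>. norm \<xi> = 1 \<and>
      {z + t *\<^sub>R v | t v. 0 < t \<and> t < \<rho> \<and> norm v = 1 \<and> norm (v - \<xi>) < \<eta>} \<subseteq> S"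
    using assms unfolding cone_condition_def by blast
  define \<delta> where "\<delta> = min (1/2) (\<eta> / 2)"
  have \<delta>: "0 < \<delta>" "\<delta> \<le> 1/2" "2 * \<delta> \<le> \<eta>" using \<eta> by (auto simp: \<delta>_def)
  have "\<exists>y. ball y (\<delta> / 2 * s) \<subseteq> S \<inter> cball z s" if z: "z \<in> S" and s: "0 < s" "s \<le> \<rho> / 2" for z s
  proof -
    obtain \<xi> where \<xi>: "norm \<xi> = 1"
      and sub: "{z + t *\<^sub>R v | t v. 0 < t \<and> t < \<rho> \<and> norm v = 1 \<and> norm (v - \<xi>) < \<eta>} \<subseteq> S"
      using cone[OF z] by blast
    define r where "r = s / 2"
    have r: "0 < r" "2 * r \<le> \<rho> / 2" using s by (auto simp: r_def)
    have "x \<in> S \<inter> cball z s" if x: "x \<in> ball (z + r *\<^sub>R \<xi>) (\<delta> / 2 * s)" for x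
    proof -
      define y where "y = x - z"
      define t where "t = norm y"
      have ny: "norm (y - r *\<^sub>R \<xi>) < \<delta> * r"
        using x by (simp add: y_def dist_norm norm_minus_commute r_def algebra_simps)
      have nr: "norm (r *\<^sub>R \<xi>) = r" using \<xi> r by simp
      have tr: "\<bar>t - r\<bar> < \<delta> * r"
        using norm_triangle_ineq3[of y "r *\<^sub>R \<xi>"] ny nr unfolding t_def by linarith
      have dr: "\<delta> * r \<le> r / 2" using \<delta> r by simp
      have t: "0 < t" "t < 2 * r" using tr dr r by linarith+
      have y0: "y = t *\<^sub>R (y /\<^sub>R t)" using t by simp
      have unit: "norm (y /\<^sub>R t) = 1" using t by (simp add: t_def)
      have "norm (y /\<^sub>R t - \<xi>) < \<eta>"
      proof -
        have "r * norm (y /\<^sub>R t - \<xi>) = norm (r *\<^sub>R (y /\<^sub>R t - \<xi>))" using r by simp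
        also have "\<dots> = norm ((y - r *\<^sub>R \<xi>) - (t - r) *\<^sub>R (y /\<^sub>R t))"
          using t by (simp add: algebra_simps)
        also have "\<dots> \<le> norm (y - r *\<^sub>R \<xi>) + norm ((t - r) *\<^sub>R (y /\<^sub>R t))"
          by (rule norm_triangle_ineq4)
        also have "norm ((t - r) *\<^sub>R (y /\<^sub>R t)) = \<bar>t - r\<bar>"
          unfolding norm_scaleR[of "t - r"] unit by simp
        also have "norm (y - r *\<^sub>R \<xi>) + \<bar>t - r\<bar> < r * (2 * \<delta>)"
          using add_strict_mono[OF ny tr] by (simp add: mult_ac)
        also have "\<dots> \<le> r * \<eta>" using \<delta> r by simp
        finally show ?thesis using r by simp
      qed
      moreover have "t < \<rho>" using t r \<rho> by linarith
      ultimately have "z + t *\<^sub>R (y /\<^sub>R t) \<in> S" using sub t unit by blast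
      then have "x \<in> S" using y0 by (simp add: y_def)
      moreover have "dist z x \<le> s" using t by (simp add: t_def y_def r_def dist_norm norm_minus_commute)
      ultimately show ?thesis by simp
    qed
    then show ?thesis by blast
  qed
  then show ?thesis unfolding interior_balls_def
    using \<rho> \<delta> by (intro exI[of _ "\<rho> / 2"] conjI exI[of _ "\<delta> / 2"]) auto
qed

text \<open>Shrink one ball inside the set towards the point \<open>x\<close>; by convexity the homothetic images stay
  inside.\<close>

lemma convex_interior_balls:
  fixes S :: "'a::euclidean_space set"
  assumes "convex S" "bounded S" "interior S \<noteq> {}"
  shows "interior_balls S"
proof -
  obtain c r where r: "0 < r" and c: "ball c r \<subseteq> S"
    using assms(3) by (auto simp: mem_interior)
  have cS: "c \<in> S" using c r by auto
  define R where "R = diameter S + r"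
  have diam: "dist x y \<le> diameter S" if "x \<in> S" "y \<in> S" for x y
    using diameter_bounded_bound[OF assms(2) that] .
  have R: "0 < R" using r diam[OF cS cS] by (simp add: R_def)
  have "\<exists>y. ball y (r / R * s) \<subseteq> S \<inter> cball x s" if x: "x \<in> S" and s: "0 < s" "s \<le> R" for x s
  proof -
    define t where "t = s / R"
    have t: "0 < t" "t \<le> 1" using s R by (auto simp: t_def)
    have "v \<in> S \<inter> cball x s" if v: "v \<in> ball ((1 - t) *\<^sub>R x + t *\<^sub>R c) (r / R * s)" for v
    proof -
      define p where "p = (v - (1 - t) *\<^sub>R x) /\<^sub>R t"
      have veq: "v = (1 - t) *\<^sub>R x + t *\<^sub>R p" using t by (simp add: p_def)
      have "t *\<^sub>R (c - p) = (1 - t) *\<^sub>R x + t *\<^sub>R c - v" by (simp add: veq algebra_simps)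
      then have "t * norm (c - p) = dist ((1 - t) *\<^sub>R x + t *\<^sub>R c) v"
        using t by (metis abs_of_pos dist_norm norm_scaleR)
      also have "\<dots> < r * t" using v by (simp add: t_def)
      finally have cp: "dist c p < r" using t by (simp add: dist_norm)
      then have p: "p \<in> S" using c by auto
      have "v \<in> S" unfolding veq using assms(1) x p t by (simp add: convex_alt)
      moreover have "dist x v \<le> s"
      proof -
        have "x - v = t *\<^sub>R (x - p)" by (simp add: veq algebra_simps)
        then have "dist x v = t * dist x p" using t by (simp add: dist_norm)
        also have "\<dots> \<le> t * R"
          using diam[OF x p] r t by (intro mult_left_mono) (auto simp: R_def)
        finally show ?thesis using R by (simp add: t_def)
      qed
      ultimately show ?thesis by simp
    qed
    then show ?thesis by blast
  qed
  then show ?thesis unfolding interior_balls_def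
    using r R by (intro exI[of _ R] conjI exI[of _ "r / R"]) auto
qed

lemma Omega_bar_compact: "compact (Omega_bar L)"
proof -
  have "Omega_bar L = cbox (0, 0) (L, L) \<inter> {x. fst x \<le> snd x}"
    by (auto simp: Omega_bar_def cbox_Pair_eq)
  moreover have "closed {x::real \<times> real. fst x \<le> snd x}"
    by (intro closed_Collect_le continuous_intros)
  ultimately show ?thesis by (simp add: compact_Int_closed)
qed

lemma Omega_bar_interior_balls:
  assumes "0 < L"
  shows "interior_balls (Omega_bar L)"
proof (rule convex_interior_balls)
  show "bounded (Omega_bar L)" by (rule compact_imp_bounded[OF Omega_bar_compact])
  show "convex (Omega_bar L)"
  proof (rule convexI)
    fix x y :: "real \<times> real" and u v :: real
    assume A: "x \<in> Omega_bar L" "y \<in> Omega_bar L" and uv: "0 \<le> u" "0 \<le> v" "u + v = 1"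
    have "u * snd x + v * snd y \<le> u * L + v * L"
      using A uv by (intro add_mono mult_left_mono) (auto simp: Omega_bar_def)
    also have "\<dots> = L" using uv by (simp flip: distrib_right)
    finally have "u * snd x + v * snd y \<le> L" .
    moreover have "u * fst x + v * fst y \<le> u * snd x + v * snd y" "0 \<le> u * fst x + v * fst y"
      using A uv by (auto simp: Omega_bar_def intro!: add_mono mult_left_mono)
    ultimately show "u *\<^sub>R x + v *\<^sub>R y \<in> Omega_bar L"
      by (simp add: Omega_bar_def case_prod_beta)
  qed
  have "open ({0<..<L/2} \<times> {L/2<..<L})" by (intro open_Times) auto
  moreover have "{0<..<L/2} \<times> {L/2<..<L} \<subseteq> Omega_bar L" by (auto simp: Omega_bar_def)
  moreover have "(L/4, 3*L/4) \<in> {0<..<L/2} \<times> {L/2<..<L}" using assms by auto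
  ultimately show "interior (Omega_bar L) \<noteq> {}" by (metis empty_iff interior_maximal subsetD)
qed

section \<open>Integrals against random diagrams\<close>

lemma space_diagram_space [simp]: "space (diagram_space L) = diagrams L"
  unfolding diagram_space_def by (rule space_measure_of) auto

lemma emeasure_diagram_measurable:
  assumes "A \<in> sets borel"
  shows "(\<lambda>a. emeasure (diagram_measure a) A) \<in> borel_measurable (diagram_space L)"
proof (rule measurableI)
  fix B :: "ennreal set" assume "B \<in> sets borel"
  then have "{a \<in> diagrams L. emeasure (diagram_measure a) A \<in> B} \<in> sets (diagram_space L)"
    unfolding diagram_space_def using assms by (subst sets_measure_of) auto
  then show "(\<lambda>a. emeasure (diagram_measure a) A) -` B \<inter> space (diagram_space L) \<in> sets (diagram_space L)"
    by (simp add: vimage_def Int_def conj_commute)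
qed simp

text \<open>Measurability passes from the evaluations at Borel sets, which generate the
  sigma-algebra on diagrams, to integrals of Borel functions by monotone approximation.\<close>

lemma nn_integral_diagram_measurable:
  assumes "\<phi> \<in> borel_measurable borel"
  shows "(\<lambda>a. \<integral>\<^sup>+x. \<phi> x \<partial>diagram_measure a) \<in> borel_measurable (diagram_space L)"
  using assms
proof (induction rule: borel_measurable_induct)
  case (cong f g)
  then show ?case by simp
next
  case (set A)
  then show ?case by (simp add: emeasure_diagram_measurable)
next
  case (mult u c)
  have [measurable]: "u \<in> borel_measurable (diagram_measure a)" for a
    using mult by (simp cong: measurable_cong_sets)
  show ?case using mult by (simp add: nn_integral_cmult)
next
  case (add u v)
  have [measurable]: "u \<in> borel_measurable (diagram_measure a)" "v \<in> borel_measurable (diagram_measure a)" for a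
    using add by (simp_all cong: measurable_cong_sets)
  show ?case using add by (simp add: nn_integral_add)
next
  case (seq U)
  have [measurable]: "U i \<in> borel_measurable (diagram_measure a)" for a i
    using seq by (simp cong: measurable_cong_sets)
  have "(\<integral>\<^sup>+x. (SUP i. U i) x \<partial>diagram_measure a) = (SUP i. \<integral>\<^sup>+x. U i x \<partial>diagram_measure a)" for a
    unfolding SUP_apply by (rule nn_integral_monotone_convergence_SUP) (use seq in auto)
  then show ?case using seq by simp
qed

lemma Omega_bar_borel [measurable]: "Omega_bar L \<in> sets borel"
  by (simp add: Omega_bar_compact compact_imp_closed)

lemma sets_weighted_measure [simp]:
  "sets (weighted_measure L w a) = sets (restrict_space borel (Omega_bar L))"
  unfolding weighted_measure_def by (simp add: sets_restrict_space)

lemma space_weighted_measure [simp]: "space (weighted_measure L w a) = Omega_bar L"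
  unfolding weighted_measure_def by (simp add: space_restrict_space)

lemma nn_integral_weighted_measure:
  assumes w: "is_weight L w" and \<phi> [measurable]: "\<phi> \<in> borel_measurable borel"
  shows "(\<integral>\<^sup>+v. \<phi> v \<partial>weighted_measure L w a)
    = (\<integral>\<^sup>+v. (ennreal (w v) * indicator (Omega_bar L) v) * \<phi> v \<partial>diagram_measure a)"
proof -
  have [measurable_cong]: "sets (diagram_measure a) = sets borel" by simp
  have w' [measurable]: "w \<in> borel_measurable (restrict_space (diagram_measure a) (Omega_bar L))"
  proof -
    have "sets (restrict_space (diagram_measure a) (Omega_bar L)) = sets (restrict_space borel (Omega_bar L))"
      by (simp add: sets_restrict_space)
    from measurable_cong_sets[OF this refl] show ?thesis using w unfolding is_weight_def by blast
  qed
  have \<phi>' [measurable]: "\<phi> \<in> borel_measurable (restrict_space (diagram_measure a) (Omega_bar L))"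
    by (intro measurable_restrict_space1) measurable
  show ?thesis unfolding weighted_measure_def
    by (simp add: nn_integral_density nn_integral_restrict_space mult_ac)
qed

lemma weight_borel_measurable:
  assumes "is_weight L w"
  shows "(\<lambda>v. ennreal (w v) * indicator (Omega_bar L) v) \<in> borel_measurable borel"
proof -
  have "(\<lambda>v. ennreal (w v)) \<in> borel_measurable (restrict_space borel (Omega_bar L))"
    using assms unfolding is_weight_def by (intro measurable_compose[OF _ measurable_ennreal]) blast
  then show ?thesis
    by (subst (asm) borel_measurable_restrict_space_iff_ennreal) auto
qed

lemma nn_integral_weighted_measurable:
  assumes w: "is_weight L w" and \<phi> [measurable]: "\<phi> \<in> borel_measurable borel"
  shows "(\<lambda>a. \<integral>\<^sup>+v. \<phi> v \<partial>weighted_measure L w a) \<in> borel_measurable (diagram_space L)"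
proof -
  note weight_borel_measurable[OF w, measurable]
  show ?thesis unfolding nn_integral_weighted_measure[OF w \<phi>]
    by (rule nn_integral_diagram_measurable) measurable
qed

lemma borel_measurable_weighted_measure:
  assumes "\<phi> \<in> borel_measurable borel"
  shows "\<phi> \<in> borel_measurable (weighted_measure L w a)"
proof -
  have "\<phi> \<in> borel_measurable (restrict_space borel (Omega_bar L))"
    by (rule measurable_restrict_space1[OF assms])
  then show ?thesis by (simp cong: measurable_cong_sets)
qed

text \<open>The defining property of conditional expectation, written with the factorised version \<open>g\<close> and a
  test function of \<open>Z\<close>.\<close>

lemma (in prob_space) cond_exp_given_integral:
  assumes Z [measurable]: "Z \<in> borel_measurable M"
    and X [measurable]: "X \<in> borel_measurable M"
    and ce: "is_cond_exp_given M Z S X g"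
    and f [measurable]: "f \<in> borel_measurable borel"
  shows "(\<integral>\<^sup>+\<omega>. f (Z \<omega>) * X \<omega> \<partial>M) = (\<integral>\<^sup>+\<omega>. f (Z \<omega>) * g (Z \<omega>) \<partial>M)"
proof -
  let ?F = "vimage_algebra (space M) Z borel"
  have sub: "subalgebra M ?F"
    unfolding subalgebra_def using Z by (auto simp: sets_vimage_algebra2 measurable_sets)
  interpret finite_measure_subalgebra M ?F
    by unfold_locales (rule sub)
  have [measurable]: "Z \<in> measurable ?F borel" by (rule measurable_vimage_algebra1) auto
  have "(\<integral>\<^sup>+\<omega>. f (Z \<omega>) * X \<omega> \<partial>M) = (\<integral>\<^sup>+\<omega>. f (Z \<omega>) * nn_cond_exp M ?F X \<omega> \<partial>M)"
    by (rule nn_cond_exp_intg[symmetric]) measurable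
  also have "\<dots> = (\<integral>\<^sup>+\<omega>. f (Z \<omega>) * g (Z \<omega>) \<partial>M)"
    using ce unfolding is_cond_exp_given_def
    by (intro nn_integral_cong_AE) (auto elim!: eventually_mono)
  finally show ?thesis .
qed

text \<open>Campbell's formula given the covariate. The hypothesis speaks of one set \<open>A\<close> at a time, with
  an exceptional null set depending on \<open>A\<close>; integrating against a test function of \<open>Z\<close> removes the null
  sets, and the identity then extends from indicators to all nonnegative Borel functions. The
  function \<open>l\<close> is a version of the intensity that is jointly Borel on the whole space.\<close>

lemma (in prob_space) cond_intensity_integral:
  fixes Z :: "'a \<Rightarrow> 'z::euclidean_space"
  assumes w: "is_weight L w"
    and Z [measurable]: "Z \<in> borel_measurable M" and D [measurable]: "D \<in> measurable M (diagram_space L)"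
    and ce: "\<And>A. A \<in> sets borel \<Longrightarrow> A \<subseteq> Omega_bar L \<Longrightarrow>
      is_cond_exp_given M Z S (\<lambda>\<omega>. emeasure (weighted_measure L w (D \<omega>)) A) (\<lambda>z. emeasure (\<Lambda> z) A)"
    and ZS: "AE \<omega> in M. Z \<omega> \<in> S"
    and dens: "\<And>z. z \<in> S \<Longrightarrow> \<Lambda> z = density (restrict_space lborel (Omega_bar L)) (\<lambda>u. ennreal (lam z u))"
    and lam [measurable]: "case_prod l \<in> borel_measurable borel"
    and l: "\<And>z u. z \<in> S \<Longrightarrow> l z u = ennreal (lam z u) * indicator (Omega_bar L) u"
    and f [measurable]: "f \<in> borel_measurable borel"
    and \<phi>: "\<phi> \<in> borel_measurable borel"
  shows "(\<integral>\<^sup>+\<omega>. f (Z \<omega>) * (\<integral>\<^sup>+v. \<phi> v \<partial>weighted_measure L w (D \<omega>)) \<partial>M)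
       = (\<integral>\<^sup>+\<omega>. f (Z \<omega>) * (\<integral>\<^sup>+v. \<phi> v * l (Z \<omega>) v \<partial>lborel) \<partial>M)"
proof -
  have lz [measurable]: "l z \<in> borel_measurable borel" for z
    using measurable_compose[OF measurable_Pair1'[of z "borel::'z measure" "borel::(real*real) measure", unfolded borel_prod] lam] by simp
  have lP [measurable]: "(\<lambda>(z, v). \<phi> v * l z v) \<in> borel_measurable (borel \<Otimes>\<^sub>M lborel)"
    if [measurable]: "\<phi> \<in> borel_measurable borel" for \<phi>
  proof -
    have "case_prod l \<in> borel_measurable (borel \<Otimes>\<^sub>M lborel)"
    proof -
      have "sets (borel \<Otimes>\<^sub>M lborel) = sets (borel \<Otimes>\<^sub>M borel :: ('z \<times> (real \<times> real)) measure)"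
        by (rule sets_pair_measure_cong) auto
      then have "sets (borel \<Otimes>\<^sub>M lborel) = sets (borel :: ('z \<times> (real \<times> real)) measure)"
        by (simp only: borel_prod)
      from measurable_cong_sets[OF this refl] show ?thesis using lam by blast
    qed
    note [measurable] = this
    show ?thesis by measurable
  qed
  have mW: "(\<lambda>\<omega>. \<integral>\<^sup>+v. \<phi> v \<partial>weighted_measure L w (D \<omega>)) \<in> borel_measurable M"
    if "\<phi> \<in> borel_measurable borel" for \<phi>
    by (rule measurable_compose[OF D nn_integral_weighted_measurable[OF w that]])
  have mL: "(\<lambda>\<omega>. \<integral>\<^sup>+v. \<phi> v * l (Z \<omega>) v \<partial>lborel) \<in> borel_measurable M"
    if "\<phi> \<in> borel_measurable borel" for \<phi>
    using lborel.borel_measurable_nn_integral[OF lP[OF that]] measurable_compose[OF Z] by auto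
  have fZ [measurable]: "(\<lambda>\<omega>. f (Z \<omega>)) \<in> borel_measurable M" by measurable
  show ?thesis using \<phi>
  proof (induction rule: borel_measurable_induct)
    case (cong f g)
    then show ?case by simp
  next
    case (set A)
    let ?A = "A \<inter> Omega_bar L"
    have A: "?A \<in> sets borel" using set by auto
    have WA: "(\<integral>\<^sup>+v. indicator A v \<partial>weighted_measure L w a) = emeasure (weighted_measure L w a) ?A" for a
    proof -
      have "(\<integral>\<^sup>+v. indicator A v \<partial>weighted_measure L w a) = (\<integral>\<^sup>+v. indicator ?A v \<partial>weighted_measure L w a)"
        by (intro nn_integral_cong) (auto simp: indicator_def)
      also have "\<dots> = emeasure (weighted_measure L w a) ?A"
        using A by (intro nn_integral_indicator) (auto simp: sets_restrict_space)
      finally show ?thesis .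
    qed
    have LA: "emeasure (\<Lambda> z) ?A = (\<integral>\<^sup>+v. indicator A v * l z v \<partial>lborel)" if z: "z \<in> S" for z
    proof -
      have "(\<lambda>v. ennreal (lam z v) * indicator (Omega_bar L) v) \<in> borel_measurable borel"
        using lz[of z] l[OF z] by (simp cong: measurable_cong)
      then have m: "(\<lambda>v. ennreal (lam z v)) \<in> borel_measurable (restrict_space lborel (Omega_bar L))"
        by (subst borel_measurable_restrict_space_iff_ennreal) auto
      have "emeasure (\<Lambda> z) ?A = (\<integral>\<^sup>+v. ennreal (lam z v) * indicator ?A v \<partial>restrict_space lborel (Omega_bar L))"
        unfolding dens[OF z] using A m by (intro emeasure_density) (auto simp: sets_restrict_space)
      also have "\<dots> = (\<integral>\<^sup>+v. ennreal (lam z v) * indicator ?A v * indicator (Omega_bar L) v \<partial>lborel)"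
        by (rule nn_integral_restrict_space) auto
      also have "\<dots> = (\<integral>\<^sup>+v. indicator A v * l z v \<partial>lborel)"
        by (intro nn_integral_cong) (auto simp: l[OF z] indicator_def)
      finally show ?thesis .
    qed
    have "(\<integral>\<^sup>+\<omega>. f (Z \<omega>) * (\<integral>\<^sup>+v. indicator A v \<partial>weighted_measure L w (D \<omega>)) \<partial>M)
        = (\<integral>\<^sup>+\<omega>. f (Z \<omega>) * emeasure (\<Lambda> (Z \<omega>)) ?A \<partial>M)"
      unfolding WA
      by (rule cond_exp_given_integral[OF Z _ ce f]) (use A mW[of "indicator A"] set in \<open>auto simp: WA\<close>)
    also have "\<dots> = (\<integral>\<^sup>+\<omega>. f (Z \<omega>) * (\<integral>\<^sup>+v. indicator A v * l (Z \<omega>) v \<partial>lborel) \<partial>M)"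
      using ZS by (intro nn_integral_cong_AE) (auto elim!: eventually_mono simp: LA)
    finally show ?case .
  next
    case (mult u c)
    have "(\<integral>\<^sup>+\<omega>. f (Z \<omega>) * (\<integral>\<^sup>+v. c * u v \<partial>weighted_measure L w (D \<omega>)) \<partial>M)
        = c * (\<integral>\<^sup>+\<omega>. f (Z \<omega>) * (\<integral>\<^sup>+v. u v \<partial>weighted_measure L w (D \<omega>)) \<partial>M)"
      using mult mW[of u]
      by (simp add: nn_integral_cmult borel_measurable_weighted_measure mult.left_commute)
    also have "\<dots> = c * (\<integral>\<^sup>+\<omega>. f (Z \<omega>) * (\<integral>\<^sup>+v. u v * l (Z \<omega>) v \<partial>lborel) \<partial>M)"
      using mult by simp
    also have "\<dots> = (\<integral>\<^sup>+\<omega>. f (Z \<omega>) * (\<integral>\<^sup>+v. c * u v * l (Z \<omega>) v \<partial>lborel) \<partial>M)"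
      using mult mL[of u] by (simp add: nn_integral_cmult mult.left_commute mult.assoc)
    finally show ?case .
  next
    case (add u v)
    have "(\<integral>\<^sup>+\<omega>. f (Z \<omega>) * (\<integral>\<^sup>+x. u x + v x \<partial>weighted_measure L w (D \<omega>)) \<partial>M)
        = (\<integral>\<^sup>+\<omega>. f (Z \<omega>) * (\<integral>\<^sup>+x. u x \<partial>weighted_measure L w (D \<omega>)) \<partial>M)
        + (\<integral>\<^sup>+\<omega>. f (Z \<omega>) * (\<integral>\<^sup>+x. v x \<partial>weighted_measure L w (D \<omega>)) \<partial>M)"
      using add mW[of u] mW[of v]
      by (simp add: nn_integral_add borel_measurable_weighted_measure distrib_left)
    also have "\<dots> = (\<integral>\<^sup>+\<omega>. f (Z \<omega>) * (\<integral>\<^sup>+x. u x * l (Z \<omega>) x \<partial>lborel) \<partial>M)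
        + (\<integral>\<^sup>+\<omega>. f (Z \<omega>) * (\<integral>\<^sup>+x. v x * l (Z \<omega>) x \<partial>lborel) \<partial>M)"
      using add by simp
    also have "\<dots> = (\<integral>\<^sup>+\<omega>. f (Z \<omega>) * (\<integral>\<^sup>+x. (u x + v x) * l (Z \<omega>) x \<partial>lborel) \<partial>M)"
      using add mL[of u] mL[of v] by (simp add: nn_integral_add distrib_left distrib_right)
    finally show ?case by (simp add: add.commute)
  next
    case (seq U)
    have inc: "incseq U" using seq by simp
    have incE: "i \<le> j \<Longrightarrow> U i x \<le> U j x" for i j x by (rule le_funD[OF incseqD[OF inc]])
    have W: "(\<integral>\<^sup>+x. (SUP i. U i) x \<partial>weighted_measure L w a) = (SUP i. \<integral>\<^sup>+x. U i x \<partial>weighted_measure L w a)" for a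
      unfolding SUP_apply using seq
      by (intro nn_integral_monotone_convergence_SUP) (auto intro: borel_measurable_weighted_measure)
    have La: "(\<integral>\<^sup>+x. (SUP i. U i) x * l z x \<partial>lborel) = (SUP i. \<integral>\<^sup>+x. U i x * l z x \<partial>lborel)" for z
    proof -
      have "(\<integral>\<^sup>+x. (SUP i. U i) x * l z x \<partial>lborel) = (\<integral>\<^sup>+x. (SUP i. U i x * l z x) \<partial>lborel)"
        by (simp only: SUP_apply SUP_mult_right_ennreal)
      also have "\<dots> = (SUP i. \<integral>\<^sup>+x. U i x * l z x \<partial>lborel)"
        using seq incE by (intro nn_integral_monotone_convergence_SUP) (auto simp: mono_def le_fun_def intro!: mult_right_mono)
      finally show ?thesis .
    qed
    have "(\<integral>\<^sup>+\<omega>. f (Z \<omega>) * (\<integral>\<^sup>+x. (SUP i. U i) x \<partial>weighted_measure L w (D \<omega>)) \<partial>M)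
        = (\<integral>\<^sup>+\<omega>. (SUP i. f (Z \<omega>) * (\<integral>\<^sup>+x. U i x \<partial>weighted_measure L w (D \<omega>))) \<partial>M)"
      by (simp only: W SUP_mult_left_ennreal)
    also have "\<dots> = (SUP i. \<integral>\<^sup>+\<omega>. f (Z \<omega>) * (\<integral>\<^sup>+x. U i x \<partial>weighted_measure L w (D \<omega>)) \<partial>M)"
      using seq mW incE
      by (intro nn_integral_monotone_convergence_SUP)
         (auto simp: mono_def le_fun_def intro!: mult_left_mono nn_integral_mono)
    also have "\<dots> = (SUP i. \<integral>\<^sup>+\<omega>. f (Z \<omega>) * (\<integral>\<^sup>+x. U i x * l (Z \<omega>) x \<partial>lborel) \<partial>M)"
      using seq by simp
    also have "\<dots> = (\<integral>\<^sup>+\<omega>. (SUP i. f (Z \<omega>) * (\<integral>\<^sup>+x. U i x * l (Z \<omega>) x \<partial>lborel)) \<partial>M)"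
      using seq mL incE
      by (intro nn_integral_monotone_convergence_SUP[symmetric])
         (auto simp: mono_def le_fun_def intro!: mult_left_mono mult_right_mono nn_integral_mono)
    also have "\<dots> = (\<integral>\<^sup>+\<omega>. f (Z \<omega>) * (\<integral>\<^sup>+x. (SUP i. U i) x * l (Z \<omega>) x \<partial>lborel) \<partial>M)"
      by (simp only: La SUP_mult_left_ennreal)
    finally show ?case .
  qed
qed

section \<open>Bias and size of the local averages\<close>

lemma integral_bound_by_mass:
  fixes f :: "'a \<Rightarrow> real" and c W :: real
  assumes f: "f \<in> borel_measurable N" and bd: "\<And>v. \<bar>f v\<bar> \<le> c" and c: "0 \<le> c"
    and mass: "emeasure N (space N) \<le> ennreal W" and W: "0 \<le> W"
  shows "integrable N f" "\<bar>integral\<^sup>L N f\<bar> \<le> c * W"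
proof -
  interpret finite_measure N
    by (rule finite_measureI) (use mass in \<open>auto simp: top_unique\<close>)
  show int: "integrable N f"
    by (rule integrable_const_bound[where B = c]) (use bd f in auto)
  have "\<bar>integral\<^sup>L N f\<bar> \<le> integral\<^sup>L N (\<lambda>v. \<bar>f v\<bar>)" by (rule integral_abs_bound)
  also have "\<dots> \<le> integral\<^sup>L N (\<lambda>_. c)"
    by (rule integral_mono) (use int bd in auto)
  also have "\<dots> = c * measure N (space N)" by (simp add: mult.commute)
  also have "\<dots> \<le> c * W"
    using mass W c by (intro mult_left_mono) (simp_all add: emeasure_eq_measure)
  finally show "\<bar>integral\<^sup>L N f\<bar> \<le> c * W" .
qed

lemma smoothed_diagram_eq:
  assumes K: "is_kernel KU" and nn: "\<And>v. 0 \<le> kappa (Omega_bar L) KU h u v"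
  shows "smoothed_diagram L w KU h a u
    = enn2real (\<integral>\<^sup>+v. ennreal (kappa (Omega_bar L) KU h u v) \<partial>weighted_measure L w a)"
  unfolding smoothed_diagram_def
  by (rule integral_eq_nn_integral)
     (use nn borel_measurable_weighted_measure[OF kappa_measurable[OF K]] in auto)

lemma smoothed_diagram_measurable:
  assumes w: "is_weight L w" and K: "is_kernel KU" and nn: "\<And>v. 0 \<le> kappa (Omega_bar L) KU h u v"
  shows "(\<lambda>a. smoothed_diagram L w KU h a u) \<in> borel_measurable (diagram_space L)"
proof -
  have "(\<lambda>v. ennreal (kappa (Omega_bar L) KU h u v)) \<in> borel_measurable borel"
    by (rule measurable_compose[OF kappa_measurable[OF K] measurable_ennreal])
  from nn_integral_weighted_measurable[OF w this]
  show ?thesis unfolding smoothed_diagram_eq[OF K nn] by measurable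
qed

text \<open>The sampling model: marked diagrams with a conditional intensity density \<open>lam\<close> that is Hoelder
  continuous, and a covariate density bounded away from zero and infinity.\<close>

locale conditional_intensity_model = prob_space M
  for M :: "'o measure" +
  fixes L :: real
    and Z :: "'o \<Rightarrow> real ^ 'd" and D :: "'o \<Rightarrow> diagram"
    and Zs :: "nat \<Rightarrow> 'o \<Rightarrow> real ^ 'd" and Ds :: "nat \<Rightarrow> 'o \<Rightarrow> diagram"
    and \<Z> :: "(real ^ 'd) set"
    and w :: "real \<times> real \<Rightarrow> real"
    and KZ :: "real ^ 'd \<Rightarrow> real" and KU :: "real \<times> real \<Rightarrow> real"
    and pZ :: "real ^ 'd \<Rightarrow> real" and cZ CZ :: real
    and \<Lambda> :: "real ^ 'd \<Rightarrow> (real \<times> real) measure"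
    and lam :: "real ^ 'd \<Rightarrow> real \<times> real \<Rightarrow> real"
    and Mw sZ sU LZ LU :: real
  assumes L_pos: "L > 0"
    and sample_indep: "indep_vars (\<lambda>_. borel \<Otimes>\<^sub>M diagram_space L)
          (\<lambda>i \<omega>. (Zs i \<omega>, Ds i \<omega>)) {1..}"
    and Z_rv: "Z \<in> borel_measurable M"
    and D_rv: "D \<in> measurable M (diagram_space L)"
    and sample_ident: "\<forall>i\<ge>1. distr M (borel \<Otimes>\<^sub>M diagram_space L) (\<lambda>\<omega>. (Zs i \<omega>, Ds i \<omega>)) =
          distr M (borel \<Otimes>\<^sub>M diagram_space L) (\<lambda>\<omega>. (Z \<omega>, D \<omega>))"
    and weight: "is_weight L w"
    and Lambda: "\<forall>i\<ge>1. \<forall>A\<in>sets borel. A \<subseteq> Omega_bar L \<longrightarrow>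
          is_cond_exp_given M (Zs i) \<Z> (\<lambda>\<omega>. emeasure (weighted_measure L w (Ds i \<omega>)) A)
            (\<lambda>z. emeasure (\<Lambda> z) A)"
    and KZ: "is_kernel KZ"
    and KU: "is_kernel KU"
    and Z_compact: "compact \<Z>"
    and Z_cone: "cone_condition \<Z>"
    and Z_density: "distributed M lborel Z (\<lambda>z. ennreal (pZ z) * indicator \<Z> z)"
    and pZ_bounds: "0 < cZ" "\<forall>z\<in>\<Z>. cZ \<le> pZ z \<and> pZ z \<le> CZ"
    and Lambda_density: "\<forall>z\<in>\<Z>. \<Lambda> z =
          density (restrict_space lborel (Omega_bar L)) (\<lambda>u. ennreal (lam z u))"
    and lam_nonneg: "\<forall>z\<in>\<Z>. \<forall>u\<in>Omega_bar L. 0 \<le> lam z u"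
    and lam_bounded: "bounded ((\<lambda>(z, u). lam z u) ` (\<Z> \<times> Omega_bar L))"
    and lam_ucont: "uniformly_continuous_on (\<Z> \<times> Omega_bar L) (\<lambda>(z, u). lam z u)"
    and mass_bound: "\<forall>i\<ge>1. AE \<omega> in M.
          emeasure (weighted_measure L w (Ds i \<omega>)) (Omega_bar L) \<le> ennreal Mw"
    and exponents: "0 < sZ" "sZ \<le> 1" "0 < sU" "sU \<le> 1"
    and lam_hoelder: "\<forall>z\<in>\<Z>. \<forall>z'\<in>\<Z>. \<forall>u\<in>Omega_bar L. \<forall>u'\<in>Omega_bar L.
          \<bar>lam z u - lam z' u'\<bar> \<le> LZ * norm (z - z') powr sZ + LU * norm (u - u') powr sU"
begin

lemma sample_measurable:
  assumes "1 \<le> i"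
  shows "(\<lambda>\<omega>. (Zs i \<omega>, Ds i \<omega>)) \<in> measurable M (borel \<Otimes>\<^sub>M diagram_space L)"
  using sample_indep assms unfolding indep_vars_def by simp

lemma Zs_measurable: "1 \<le> i \<Longrightarrow> Zs i \<in> borel_measurable M"
  using measurable_compose[OF sample_measurable measurable_fst] by simp

lemma Ds_measurable: "1 \<le> i \<Longrightarrow> Ds i \<in> measurable M (diagram_space L)"
  using measurable_compose[OF sample_measurable measurable_snd] by simp

lemma nn_integral_Zs:
  assumes i: "1 \<le> i" and g: "g \<in> borel_measurable borel"
  shows "(\<integral>\<^sup>+\<omega>. g (Zs i \<omega>) \<partial>M) = (\<integral>\<^sup>+z. ennreal (pZ z) * indicator \<Z> z * g z \<partial>lborel)"
proof -
  have ZD: "(\<lambda>\<omega>. (Z \<omega>, D \<omega>)) \<in> measurable M (borel \<Otimes>\<^sub>M diagram_space L)"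
    using Z_rv D_rv by (rule measurable_Pair)
  have g': "(\<lambda>x. g (fst x)) \<in> borel_measurable (borel \<Otimes>\<^sub>M diagram_space L)"
    by (rule measurable_compose[OF measurable_fst g])
  have "(\<integral>\<^sup>+\<omega>. g (Zs i \<omega>) \<partial>M)
      = (\<integral>\<^sup>+x. g (fst x) \<partial>distr M (borel \<Otimes>\<^sub>M diagram_space L) (\<lambda>\<omega>. (Zs i \<omega>, Ds i \<omega>)))"
    by (subst nn_integral_distr[OF sample_measurable[OF i]]) (use g' in simp_all)
  also have "\<dots> = (\<integral>\<^sup>+x. g (fst x) \<partial>distr M (borel \<Otimes>\<^sub>M diagram_space L) (\<lambda>\<omega>. (Z \<omega>, D \<omega>)))"
    using sample_ident i by simp
  also have "\<dots> = (\<integral>\<^sup>+\<omega>. g (Z \<omega>) \<partial>M)"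
    by (subst nn_integral_distr[OF ZD]) (use g' in simp_all)
  also have "\<dots> = (\<integral>\<^sup>+z. ennreal (pZ z) * indicator \<Z> z * g z \<partial>lborel)"
    using distributed_nn_integral[OF Z_density, of g] g by simp
  finally show ?thesis .
qed

lemma Z_borel: "\<Z> \<in> sets borel"
  using Z_compact by (simp add: compact_imp_closed)

lemma AE_Zs: 
  assumes i: "1 \<le> i"
  shows "AE \<omega> in M. Zs i \<omega> \<in> \<Z>"
proof -
  have m: "indicator (- \<Z>) \<in> borel_measurable borel"
    using Z_borel by (intro borel_measurable_indicator) auto
  have "(\<integral>\<^sup>+\<omega>. indicator (- \<Z>) (Zs i \<omega>) \<partial>M) = (\<integral>\<^sup>+z. 0 \<partial>(lborel :: (real ^ 'd) measure))"
    unfolding nn_integral_Zs[OF i m] by (intro nn_integral_cong) (simp add: indicator_def)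
  moreover have "(\<lambda>\<omega>. indicator (- \<Z>) (Zs i \<omega>) :: ennreal) \<in> borel_measurable M"
    by (rule measurable_compose[OF Zs_measurable[OF i] m])
  ultimately have "AE \<omega> in M. indicator (- \<Z>) (Zs i \<omega>) = (0 :: ennreal)"
    by (subst nn_integral_0_iff_AE[symmetric]) simp_all
  then show ?thesis by (rule eventually_mono) (simp add: indicator_def split: if_splits)
qed

lemma Z_nonempty: "\<Z> \<noteq> {}"
proof
  assume "\<Z> = {}"
  then have "(\<integral>\<^sup>+\<omega>. 1 \<partial>M) = 0" using nn_integral_Zs[of 1 "\<lambda>_. 1"] by simp
  then show False by (simp add: emeasure_space_1)
qed

lemma CZ_pos: "0 < CZ"
  using Z_nonempty pZ_bounds by force

text \<open>At least one, so that the mass bound can be absorbed into products of constants.\<close>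

definition W :: real where "W = max 1 Mw"

lemma mass_bound_W:
  assumes "1 \<le> i"
  shows "AE \<omega> in M. emeasure (weighted_measure L w (Ds i \<omega>)) (Omega_bar L) \<le> ennreal W"
proof -
  have "ennreal Mw \<le> ennreal W" by (rule ennreal_leI) (simp add: W_def)
  with mass_bound assms show ?thesis by (auto elim!: eventually_mono intro: order.trans)
qed

definition lam_sup :: real where
  "lam_sup = (SOME b. 0 < b \<and> (\<forall>z\<in>\<Z>. \<forall>u\<in>Omega_bar L. lam z u \<le> b))"

lemma lam_sup: "0 < lam_sup" "z \<in> \<Z> \<Longrightarrow> u \<in> Omega_bar L \<Longrightarrow> lam z u \<le> lam_sup"
proof -
  from lam_bounded obtain b where b: "0 < b" "\<forall>x\<in>(\<lambda>(z, u). lam z u) ` (\<Z> \<times> Omega_bar L). norm x \<le> b"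
    unfolding bounded_pos by blast
  have "lam z u \<le> b" if "z \<in> \<Z>" "u \<in> Omega_bar L" for z u
  proof -
    have "lam z u \<in> (\<lambda>(z, u). lam z u) ` (\<Z> \<times> Omega_bar L)"
      using that by (intro image_eqI[of _ _ "(z, u)"]) auto
    with b(2) have "norm (lam z u) \<le> b" by (rule bspec)
    then show ?thesis by simp
  qed
  with b(1) have "\<exists>b. 0 < b \<and> (\<forall>z\<in>\<Z>. \<forall>u\<in>Omega_bar L. lam z u \<le> b)" by blast
  from someI_ex[OF this] show "0 < lam_sup" "z \<in> \<Z> \<Longrightarrow> u \<in> Omega_bar L \<Longrightarrow> lam z u \<le> lam_sup"
    unfolding lam_sup_def by blast+
qed

text \<open>Extension of the intensity by zero. Continuity on the compact domain makes it Borel.\<close>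

definition lam_ext :: "real ^ 'd \<Rightarrow> real \<times> real \<Rightarrow> ennreal" where
  "lam_ext z u = ennreal (indicator (\<Z> \<times> Omega_bar L) (z, u) *\<^sub>R lam z u)"

lemma lam_ext_measurable: "case_prod lam_ext \<in> borel_measurable borel"
proof -
  have "(\<lambda>x. indicator (\<Z> \<times> Omega_bar L) x *\<^sub>R (\<lambda>(z, u). lam z u) x) \<in> borel_measurable borel"
  proof (rule borel_measurable_continuous_on_indicator)
    show "\<Z> \<times> Omega_bar L \<in> sets borel"
      using compact_Times[OF Z_compact Omega_bar_compact] by (simp add: compact_imp_closed)
    show "continuous_on (\<Z> \<times> Omega_bar L) (\<lambda>(z, u). lam z u)"
      by (rule uniformly_continuous_imp_continuous[OF lam_ucont])
  qed
  from measurable_compose[OF this measurable_ennreal]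
  have m: "(\<lambda>x. ennreal (indicator (\<Z> \<times> Omega_bar L) x *\<^sub>R (\<lambda>(z, u). lam z u) x)) \<in> borel_measurable borel" .
  have "case_prod lam_ext = (\<lambda>x. ennreal (indicator (\<Z> \<times> Omega_bar L) x *\<^sub>R (\<lambda>(z, u). lam z u) x))"
    by (simp add: fun_eq_iff lam_ext_def)
  with m show ?thesis by (simp only:)
qed

lemma lam_ext_eq: "z \<in> \<Z> \<Longrightarrow> lam_ext z u = ennreal (lam z u) * indicator (Omega_bar L) u"
  by (simp add: lam_ext_def indicator_def)

text \<open>The oscillation of the intensity within one bandwidth, as bounded by the Hoelder condition.\<close>

definition bias :: "real \<Rightarrow> real \<Rightarrow> real" where
  "bias a b = \<bar>LZ\<bar> * a powr sZ + \<bar>LU\<bar> * b powr sU"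

lemma bias_nonneg: "0 \<le> bias a b"
  by (simp add: bias_def)

lemma bias_le:
  assumes "0 < a" "a \<le> 1" "0 < b" "b \<le> 1"
  shows "bias a b \<le> \<bar>LZ\<bar> + \<bar>LU\<bar>"
proof -
  have "a powr sZ \<le> 1" "b powr sU \<le> 1" using assms exponents by (simp_all add: powr_le1)
  then have "\<bar>LZ\<bar> * a powr sZ \<le> \<bar>LZ\<bar> * 1" "\<bar>LU\<bar> * b powr sU \<le> \<bar>LU\<bar> * 1"
    by (intro mult_left_mono; simp)+
  then show ?thesis unfolding bias_def by linarith
qed

lemma lam_close:
  assumes "z \<in> \<Z>" "z' \<in> \<Z>" "u \<in> Omega_bar L" "v \<in> Omega_bar L" "norm (z' - z) \<le> a" "norm (v - u) \<le> b"
  shows "\<bar>lam z u - lam z' v\<bar> \<le> bias a b"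
proof -
  have "LZ * norm (z - z') powr sZ \<le> \<bar>LZ\<bar> * a powr sZ"
    using assms(5) exponents by (intro mult_mono powr_mono2) (auto simp: norm_minus_commute)
  moreover have "LU * norm (u - v) powr sU \<le> \<bar>LU\<bar> * b powr sU"
    using assms(6) exponents by (intro mult_mono powr_mono2) (auto simp: norm_minus_commute)
  moreover have "\<bar>lam z u - lam z' v\<bar> \<le> LZ * norm (z - z') powr sZ + LU * norm (u - v) powr sU"
    using lam_hoelder assms by blast
  ultimately show ?thesis unfolding bias_def by linarith
qed


text \<open>The almost sure properties of one smoothed diagram that hold simultaneously for all \<open>u\<close>; all
  of them follow from the bound on the total mass. The first conjunct says that the real-valued
  integral is not a default value.\<close>

definition regular_obs :: "real \<Rightarrow> real \<Rightarrow> nat \<Rightarrow> 'o \<Rightarrow> bool" where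
  "regular_obs AU b i \<omega> \<longleftrightarrow> (\<forall>u\<in>Omega_bar L.
        ennreal (smoothed_diagram L w KU b (Ds i \<omega>) u)
          = (\<integral>\<^sup>+v. ennreal (kappa (Omega_bar L) KU b u v) \<partial>weighted_measure L w (Ds i \<omega>)) \<and>
        smoothed_diagram L w KU b (Ds i \<omega>) u \<le> AU / b ^ 2 * W \<and>
        (\<forall>u'\<in>Omega_bar L. \<bar>smoothed_diagram L w KU b (Ds i \<omega>) u - smoothed_diagram L w KU b (Ds i \<omega>) u'\<bar>
          \<le> AU / b ^ 5 * dist u u' * W))"

text \<open>A single observation at fixed bandwidths, \<open>a\<close> in the covariate and \<open>b\<close> in the diagram plane.\<close>

context
  fixes a b AZ AU :: real and i :: nat
  assumes kbZ: "kernel_bounds \<Z> KZ AZ a" and kbU: "kernel_bounds (Omega_bar L) KU AU b"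
    and i: "1 \<le> i"
begin

lemma location_kernel:
  assumes z: "z \<in> \<Z>"
  shows "0 \<le> kappa \<Z> KZ a z y" "kappa \<Z> KZ a z y \<le> AZ / a ^ CARD('d)"
    "kappa \<Z> KZ a z y \<noteq> 0 \<Longrightarrow> norm (y - z) \<le> a"
    "z' \<in> \<Z> \<Longrightarrow> \<bar>kappa \<Z> KZ a z y - kappa \<Z> KZ a z' y\<bar> \<le> AZ / a ^ (2 * CARD('d) + 1) * dist z z'"
    "(\<integral>\<^sup>+y. ennreal (kappa \<Z> KZ a z y) * indicator \<Z> y \<partial>lborel) = 1"
  using kbZ z unfolding kernel_bounds_def by simp_all

lemma diagram_kernel:
  assumes u: "u \<in> Omega_bar L"
  shows "0 \<le> kappa (Omega_bar L) KU b u y" "kappa (Omega_bar L) KU b u y \<le> AU / b ^ 2"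
    "kappa (Omega_bar L) KU b u y \<noteq> 0 \<Longrightarrow> norm (y - u) \<le> b"
    "u' \<in> Omega_bar L \<Longrightarrow>
      \<bar>kappa (Omega_bar L) KU b u y - kappa (Omega_bar L) KU b u' y\<bar> \<le> AU / b ^ 5 * dist u u'"
    "(\<integral>\<^sup>+y. ennreal (kappa (Omega_bar L) KU b u y) * indicator (Omega_bar L) y \<partial>lborel) = 1"
proof -
  have d2: "DIM(real \<times> real) = 2" by simp
  note k = kbU[unfolded kernel_bounds_def d2]
  show "0 \<le> kappa (Omega_bar L) KU b u y" "kappa (Omega_bar L) KU b u y \<le> AU / b ^ 2"
    using k u by blast+
  show "norm (y - u) \<le> b" if "kappa (Omega_bar L) KU b u y \<noteq> 0"
    using k u that by blast
  show "\<bar>kappa (Omega_bar L) KU b u y - kappa (Omega_bar L) KU b u' y\<bar> \<le> AU / b ^ 5 * dist u u'"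
    if "u' \<in> Omega_bar L"
  proof -
    have "\<bar>kappa (Omega_bar L) KU b u y - kappa (Omega_bar L) KU b u' y\<bar> \<le> AU / b ^ (2 * 2 + 1) * dist u u'"
      using k u that by blast
    then show ?thesis by (simp only: numeral_eq_Suc) (simp add: numeral_eq_Suc)
  qed
  show "(\<integral>\<^sup>+y. ennreal (kappa (Omega_bar L) KU b u y) * indicator (Omega_bar L) y \<partial>lborel) = 1"
    using k u by blast
qed

lemma bandwidth_bounds: "0 < a" "a \<le> 1" "0 < b" "b \<le> 1" "1 \<le> AZ" "1 \<le> AU" "1 \<le> W"
  using kbZ kbU unfolding kernel_bounds_def W_def by simp_all

lemma kernels_measurable:
  "(\<lambda>y. ennreal (kappa \<Z> KZ a z y)) \<in> borel_measurable borel"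
  "(\<lambda>v. ennreal (kappa (Omega_bar L) KU b u v)) \<in> borel_measurable borel"
  by (rule measurable_compose[OF kappa_measurable[OF KZ] measurable_ennreal]
           measurable_compose[OF kappa_measurable[OF KU] measurable_ennreal])+

lemma smoothed_nonneg: "u \<in> Omega_bar L \<Longrightarrow> 0 \<le> smoothed_diagram L w KU b (Ds i \<omega>) u"
  by (subst smoothed_diagram_eq[OF KU diagram_kernel(1)]) simp_all

lemma AE_smoothed: "AE \<omega> in M. regular_obs AU b i \<omega>"
  using mass_bound_W[OF i]
proof (rule eventually_mono, unfold regular_obs_def, intro ballI conjI)
  fix \<omega> u
  assume mass0: "emeasure (weighted_measure L w (Ds i \<omega>)) (Omega_bar L) \<le> ennreal W"
    and u: "u \<in> Omega_bar L"
  let ?N = "weighted_measure L w (Ds i \<omega>)"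
  let ?k = "\<lambda>u v. kappa (Omega_bar L) KU b u v"
  have mass: "emeasure ?N (space ?N) \<le> ennreal W" using mass0 by simp
  have W0: "0 \<le> W" using bandwidth_bounds by simp
  have meas: "?k u \<in> borel_measurable ?N" for u
    by (rule borel_measurable_weighted_measure) (rule kappa_measurable[OF KU])
  have c0: "0 \<le> AU / b ^ 2" using bandwidth_bounds by simp
  have bd: "\<bar>?k u v\<bar> \<le> AU / b ^ 2" if "u \<in> Omega_bar L" for u v
    using diagram_kernel(1,2)[OF that, of v] by simp
  note I = integral_bound_by_mass[OF meas bd c0 mass W0]
  show "ennreal (smoothed_diagram L w KU b (Ds i \<omega>) u) = (\<integral>\<^sup>+v. ennreal (?k u v) \<partial>?N)"
    unfolding smoothed_diagram_def
    by (rule nn_integral_eq_integral[symmetric, OF I(1)[OF u]]) (simp add: diagram_kernel(1)[OF u])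
  show "smoothed_diagram L w KU b (Ds i \<omega>) u \<le> AU / b ^ 2 * W"
    using I(2)[OF u] unfolding smoothed_diagram_def by linarith
  fix u' assume u': "u' \<in> Omega_bar L"
  have meas': "(\<lambda>v. ?k u v - ?k u' v) \<in> borel_measurable ?N"
    by (rule borel_measurable_diff[OF meas meas])
  have c5: "0 \<le> AU / b ^ 5 * dist u u'" using bandwidth_bounds by simp
  have "smoothed_diagram L w KU b (Ds i \<omega>) u - smoothed_diagram L w KU b (Ds i \<omega>) u'
      = integral\<^sup>L ?N (\<lambda>v. ?k u v - ?k u' v)"
    unfolding smoothed_diagram_def
    by (rule Bochner_Integration.integral_diff[symmetric, OF I(1)[OF u] I(1)[OF u']])
  with integral_bound_by_mass(2)[OF meas' diagram_kernel(4)[OF u u'] c5 mass W0]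
  show "\<bar>smoothed_diagram L w KU b (Ds i \<omega>) u - smoothed_diagram L w KU b (Ds i \<omega>) u'\<bar>
      \<le> AU / b ^ 5 * dist u u' * W" by (simp only:)
qed

lemma local_weight_rv: "(\<lambda>\<omega>. kappa \<Z> KZ a z (Zs i \<omega>)) \<in> borel_measurable M"
  by (rule measurable_compose[OF Zs_measurable[OF i] kappa_measurable[OF KZ]])

lemma smoothed_obs_rv:
  "u \<in> Omega_bar L \<Longrightarrow> (\<lambda>\<omega>. smoothed_diagram L w KU b (Ds i \<omega>) u) \<in> borel_measurable M"
  by (rule measurable_compose[OF Ds_measurable[OF i] smoothed_diagram_measurable[OF weight KU diagram_kernel(1)]])

lemma nn_integral_local_weight:
  assumes z: "z \<in> \<Z>"
  shows "ennreal (expectation (\<lambda>\<omega>. kappa \<Z> KZ a z (Zs i \<omega>))) = (\<integral>\<^sup>+\<omega>. ennreal (kappa \<Z> KZ a z (Zs i \<omega>)) \<partial>M)"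
proof (rule nn_integral_eq_integral[symmetric])
  show "integrable M (\<lambda>\<omega>. kappa \<Z> KZ a z (Zs i \<omega>))"
  proof (rule integrable_const_bound[where B = "AZ / a ^ CARD('d)"])
    show "AE \<omega> in M. norm (kappa \<Z> KZ a z (Zs i \<omega>)) \<le> AZ / a ^ CARD('d)"
    proof (rule AE_I2)
      fix \<omega>
      show "norm (kappa \<Z> KZ a z (Zs i \<omega>)) \<le> AZ / a ^ CARD('d)"
        using location_kernel(1,2)[OF z, of "Zs i \<omega>"] by simp
    qed
  qed (rule local_weight_rv)
qed (simp add: location_kernel(1)[OF z])

text \<open>The normalised kernel has integral one over \<open>\<Z>\<close>, so its mean against \<open>pZ\<close> lies between the bounds
  of the density.\<close>

lemma local_weight_mean:
  assumes z: "z \<in> \<Z>"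
  shows "cZ \<le> expectation (\<lambda>\<omega>. kappa \<Z> KZ a z (Zs i \<omega>))" (is "_ \<le> ?E")
    and "expectation (\<lambda>\<omega>. kappa \<Z> KZ a z (Zs i \<omega>)) \<le> CZ"
proof -
  let ?k = "\<lambda>y. ennreal (kappa \<Z> KZ a z y)"
  have E: "ennreal ?E = (\<integral>\<^sup>+y. ennreal (pZ y) * indicator \<Z> y * ?k y \<partial>lborel)"
    unfolding nn_integral_local_weight[OF z] by (rule nn_integral_Zs[OF i kernels_measurable(1)])
  have m: "(\<lambda>y. ?k y * indicator \<Z> y) \<in> borel_measurable lborel"
    using borel_measurable_times_ennreal[OF kernels_measurable(1) borel_measurable_indicator[OF Z_borel]] by simp
  have const: "(\<integral>\<^sup>+y. c * (?k y * indicator \<Z> y) \<partial>lborel) = c" for c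
    using nn_integral_cmult[OF m, of c] location_kernel(5)[OF z] by simp
  have E0: "0 \<le> ?E" by (rule integral_nonneg_AE) (simp add: location_kernel(1)[OF z])
  have "ennreal cZ = (\<integral>\<^sup>+y. ennreal cZ * (?k y * indicator \<Z> y) \<partial>lborel)" by (rule const[symmetric])
  also have "\<dots> \<le> ennreal ?E"
    unfolding E
  proof (rule nn_integral_mono)
    fix y
    show "ennreal cZ * (?k y * indicator \<Z> y) \<le> ennreal (pZ y) * indicator \<Z> y * ?k y"
    proof (cases "y \<in> \<Z>")
      case True
      then have "ennreal cZ \<le> ennreal (pZ y)" using pZ_bounds by (intro ennreal_leI) blast
      from mult_right_mono[OF this, of "?k y"] True show ?thesis by simp
    qed simp
  qed
  finally show "cZ \<le> ?E" using E0 by (simp only: ennreal_le_iff)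
  have "ennreal ?E \<le> (\<integral>\<^sup>+y. ennreal CZ * (?k y * indicator \<Z> y) \<partial>lborel)"
    unfolding E
  proof (rule nn_integral_mono)
    fix y
    show "ennreal (pZ y) * indicator \<Z> y * ?k y \<le> ennreal CZ * (?k y * indicator \<Z> y)"
    proof (cases "y \<in> \<Z>")
      case True
      then have "ennreal (pZ y) \<le> ennreal CZ" using pZ_bounds by (intro ennreal_leI) blast
      from mult_right_mono[OF this, of "?k y"] True show ?thesis by simp
    qed simp
  qed
  also have "\<dots> = ennreal CZ" by (rule const)
  finally show "?E \<le> CZ" using less_imp_le[OF CZ_pos] by (simp only: ennreal_le_iff)
qed

lemma weighted_obs_rv:
  "u \<in> Omega_bar L \<Longrightarrow>
    (\<lambda>\<omega>. kappa \<Z> KZ a z (Zs i \<omega>) * smoothed_diagram L w KU b (Ds i \<omega>) u) \<in> borel_measurable M"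
  by (rule borel_measurable_times[OF local_weight_rv smoothed_obs_rv])

lemma AE_weighted_obs_bound:
  "AE \<omega> in M. \<forall>z\<in>\<Z>. \<forall>u\<in>Omega_bar L.
     kappa \<Z> KZ a z (Zs i \<omega>) * smoothed_diagram L w KU b (Ds i \<omega>) u
       \<le> AZ * AU * W / (a ^ CARD('d) * b ^ 2)"
  using AE_smoothed
proof (rule eventually_mono, intro ballI)
  fix \<omega> z u
  assume Y: "regular_obs AU b i \<omega>"
    and z: "z \<in> \<Z>" and u: "u \<in> Omega_bar L"
  have "kappa \<Z> KZ a z (Zs i \<omega>) * smoothed_diagram L w KU b (Ds i \<omega>) u
      \<le> (AZ / a ^ CARD('d)) * (AU / b ^ 2 * W)"
  proof (rule mult_mono)
    show "kappa \<Z> KZ a z (Zs i \<omega>) \<le> AZ / a ^ CARD('d)" by (rule location_kernel(2)[OF z])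
    show "smoothed_diagram L w KU b (Ds i \<omega>) u \<le> AU / b ^ 2 * W" using Y u unfolding regular_obs_def by blast
    show "0 \<le> AZ / a ^ CARD('d)" using bandwidth_bounds by simp
  qed (rule smoothed_nonneg[OF u])
  also have "\<dots> = AZ * AU * W / (a ^ CARD('d) * b ^ 2)" by simp
  finally show "kappa \<Z> KZ a z (Zs i \<omega>) * smoothed_diagram L w KU b (Ds i \<omega>) u
      \<le> AZ * AU * W / (a ^ CARD('d) * b ^ 2)" .
qed

text \<open>The product rule for Lipschitz constants; both sup bounds are weakened to the powers of the
  Lipschitz bounds, which are larger because the bandwidths are at most one.\<close>

lemma AE_weighted_obs_lipschitz:
  "AE \<omega> in M. \<forall>x\<in>\<Z> \<times> Omega_bar L. \<forall>y\<in>\<Z> \<times> Omega_bar L.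
     \<bar>kappa \<Z> KZ a (fst x) (Zs i \<omega>) * smoothed_diagram L w KU b (Ds i \<omega>) (snd x)
      - kappa \<Z> KZ a (fst y) (Zs i \<omega>) * smoothed_diagram L w KU b (Ds i \<omega>) (snd y)\<bar>
       \<le> 2 * (AZ * AU * W) / (a ^ (2 * CARD('d) + 1) * b ^ 5) * dist x y"
  using AE_smoothed
proof (rule eventually_mono, intro ballI)
  fix \<omega> x y
  assume Y: "regular_obs AU b i \<omega>"
    and x: "x \<in> \<Z> \<times> Omega_bar L" and y: "y \<in> \<Z> \<times> Omega_bar L"
  let ?k = "\<lambda>x. kappa \<Z> KZ a (fst x) (Zs i \<omega>)"
  let ?Y = "\<lambda>x. smoothed_diagram L w KU b (Ds i \<omega>) (snd x)"
  have x': "fst x \<in> \<Z>" "snd x \<in> Omega_bar L" and y': "fst y \<in> \<Z>" "snd y \<in> Omega_bar L"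
    using x y by (simp_all add: mem_Times_iff)
  let ?d = "dist x y"
  have dz: "dist (fst x) (fst y) \<le> ?d" and du: "dist (snd x) (snd y) \<le> ?d"
    by (rule dist_fst_le, rule dist_snd_le)
  have pow: "1 / a ^ CARD('d) \<le> 1 / a ^ (2 * CARD('d) + 1)" "1 / b ^ 2 \<le> 1 / b ^ 5"
    using bandwidth_bounds by (intro divide_left_mono power_decreasing; simp)+
  have Ylip: "\<bar>?Y x - ?Y y\<bar> \<le> AU * W * (1 / b ^ 5) * ?d"
  proof -
    have "\<bar>?Y x - ?Y y\<bar> \<le> AU / b ^ 5 * dist (snd x) (snd y) * W"
      using Y x'(2) y'(2) unfolding regular_obs_def by blast
    also have "\<dots> \<le> AU / b ^ 5 * ?d * W"
      using bandwidth_bounds du by (intro mult_right_mono mult_left_mono) simp_all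
    finally show ?thesis by (simp add: mult_ac)
  qed
  have klip: "\<bar>?k x - ?k y\<bar> \<le> AZ * (1 / a ^ (2 * CARD('d) + 1)) * ?d"
  proof -
    have "\<bar>?k x - ?k y\<bar> \<le> AZ / a ^ (2 * CARD('d) + 1) * dist (fst x) (fst y)"
      by (rule location_kernel(4)[OF x'(1) y'(1)])
    also have "\<dots> \<le> AZ / a ^ (2 * CARD('d) + 1) * ?d"
      using bandwidth_bounds dz by (intro mult_left_mono) simp_all
    finally show ?thesis by simp
  qed
  have kb: "\<bar>?k x\<bar> \<le> AZ * (1 / a ^ (2 * CARD('d) + 1))"
  proof -
    have "\<bar>?k x\<bar> \<le> AZ * (1 / a ^ CARD('d))" using location_kernel(1,2)[OF x'(1), of "Zs i \<omega>"] by simp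
    also have "\<dots> \<le> AZ * (1 / a ^ (2 * CARD('d) + 1))"
      using pow bandwidth_bounds by (intro mult_left_mono) simp_all
    finally show ?thesis .
  qed
  have Yb: "\<bar>?Y y\<bar> \<le> AU * W * (1 / b ^ 5)"
  proof -
    have "?Y y \<le> AU / b ^ 2 * W" using Y y'(2) unfolding regular_obs_def by blast
    then have "\<bar>?Y y\<bar> \<le> AU * W * (1 / b ^ 2)" using smoothed_nonneg[OF y'(2), of \<omega>] by simp
    also have "\<dots> \<le> AU * W * (1 / b ^ 5)"
      using pow bandwidth_bounds by (intro mult_left_mono) simp_all
    finally show ?thesis .
  qed
  have "?k x * ?Y x - ?k y * ?Y y = ?k x * (?Y x - ?Y y) + (?k x - ?k y) * ?Y y"
    by (simp add: algebra_simps)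
  also have "\<bar>\<dots>\<bar> \<le> \<bar>?k x\<bar> * \<bar>?Y x - ?Y y\<bar> + \<bar>?k x - ?k y\<bar> * \<bar>?Y y\<bar>"
    unfolding abs_mult[symmetric] by (rule abs_triangle_ineq)
  also have "\<dots> \<le> (AZ * (1 / a ^ (2 * CARD('d) + 1))) * (AU * W * (1 / b ^ 5) * ?d)
      + (AZ * (1 / a ^ (2 * CARD('d) + 1)) * ?d) * (AU * W * (1 / b ^ 5))"
    using bandwidth_bounds by (intro add_mono mult_mono Ylip klip kb Yb) simp_all
  also have "\<dots> = 2 * (AZ * AU * W) / (a ^ (2 * CARD('d) + 1) * b ^ 5) * ?d"
    by (simp add: mult_ac)
  finally show "\<bar>?k x * ?Y x - ?k y * ?Y y\<bar>
      \<le> 2 * (AZ * AU * W) / (a ^ (2 * CARD('d) + 1) * b ^ 5) * ?d" .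
qed

lemma integrable_weighted_obs:
  assumes z: "z \<in> \<Z>" and u: "u \<in> Omega_bar L"
  shows "integrable M (\<lambda>\<omega>. kappa \<Z> KZ a z (Zs i \<omega>) * smoothed_diagram L w KU b (Ds i \<omega>) u)"
proof (rule integrable_const_bound)
  show "AE \<omega> in M. norm (kappa \<Z> KZ a z (Zs i \<omega>) * smoothed_diagram L w KU b (Ds i \<omega>) u)
      \<le> AZ * AU * W / (a ^ CARD('d) * b ^ 2)"
    using AE_weighted_obs_bound
  proof (rule eventually_mono)
    fix \<omega>
    assume *: "\<forall>z\<in>\<Z>. \<forall>u\<in>Omega_bar L. kappa \<Z> KZ a z (Zs i \<omega>) * smoothed_diagram L w KU b (Ds i \<omega>) u
       \<le> AZ * AU * W / (a ^ CARD('d) * b ^ 2)"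
    have "0 \<le> kappa \<Z> KZ a z (Zs i \<omega>) * smoothed_diagram L w KU b (Ds i \<omega>) u"
      by (rule mult_nonneg_nonneg[OF location_kernel(1)[OF z] smoothed_nonneg[OF u]])
    with bspec[OF bspec[OF * z] u]
    show "norm (kappa \<Z> KZ a z (Zs i \<omega>) * smoothed_diagram L w KU b (Ds i \<omega>) u)
      \<le> AZ * AU * W / (a ^ CARD('d) * b ^ 2)" by simp
  qed
qed (rule weighted_obs_rv[OF u])

text \<open>The tower property: the smoothed diagram may be replaced by the smoothed intensity at the
  covariate.\<close>

lemma nn_integral_weighted_obs:
  assumes z: "z \<in> \<Z>" and u: "u \<in> Omega_bar L"
  shows "ennreal (expectation (\<lambda>\<omega>. kappa \<Z> KZ a z (Zs i \<omega>) * smoothed_diagram L w KU b (Ds i \<omega>) u))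
    = (\<integral>\<^sup>+\<omega>. ennreal (kappa \<Z> KZ a z (Zs i \<omega>)) *
        (\<integral>\<^sup>+v. ennreal (kappa (Omega_bar L) KU b u v) * lam_ext (Zs i \<omega>) v \<partial>lborel) \<partial>M)"
proof -
  let ?f = "\<lambda>\<omega>. kappa \<Z> KZ a z (Zs i \<omega>) * smoothed_diagram L w KU b (Ds i \<omega>) u"
  have "ennreal (expectation ?f) = (\<integral>\<^sup>+\<omega>. ennreal (?f \<omega>) \<partial>M)"
  proof (rule nn_integral_eq_integral[symmetric, OF integrable_weighted_obs[OF z u]])
    show "AE \<omega> in M. 0 \<le> ?f \<omega>"
      by (intro AE_I2 mult_nonneg_nonneg location_kernel(1)[OF z] smoothed_nonneg[OF u])
  qed
  also have "\<dots> = (\<integral>\<^sup>+\<omega>. ennreal (kappa \<Z> KZ a z (Zs i \<omega>)) *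
      (\<integral>\<^sup>+v. ennreal (kappa (Omega_bar L) KU b u v) \<partial>weighted_measure L w (Ds i \<omega>)) \<partial>M)"
  proof (rule nn_integral_cong_AE)
    show "AE \<omega> in M. ennreal (?f \<omega>) = ennreal (kappa \<Z> KZ a z (Zs i \<omega>)) *
      (\<integral>\<^sup>+v. ennreal (kappa (Omega_bar L) KU b u v) \<partial>weighted_measure L w (Ds i \<omega>))"
      using AE_smoothed
      by (rule eventually_mono) (simp add: regular_obs_def ennreal_mult' location_kernel(1)[OF z] u)
  qed
  also have "\<dots> = (\<integral>\<^sup>+\<omega>. ennreal (kappa \<Z> KZ a z (Zs i \<omega>)) *
        (\<integral>\<^sup>+v. ennreal (kappa (Omega_bar L) KU b u v) * lam_ext (Zs i \<omega>) v \<partial>lborel) \<partial>M)"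
  proof (rule cond_intensity_integral[where S = \<Z> and \<Lambda> = \<Lambda> and lam = lam])
    show "is_cond_exp_given M (Zs i) \<Z> (\<lambda>\<omega>. emeasure (weighted_measure L w (Ds i \<omega>)) A) (\<lambda>z. emeasure (\<Lambda> z) A)"
      if "A \<in> sets borel" "A \<subseteq> Omega_bar L" for A
      using Lambda i that by blast
    show "\<Lambda> z = density (restrict_space lborel (Omega_bar L)) (\<lambda>u. ennreal (lam z u))" if "z \<in> \<Z>" for z
      using Lambda_density that by blast
  qed (rule weight Zs_measurable[OF i] Ds_measurable[OF i] AE_Zs[OF i] lam_ext_measurable
         lam_ext_eq kernels_measurable; assumption?)+
  finally show ?thesis .
qed

text \<open>Wherever both kernels are nonzero, the intensity differs from \<open>lam z u\<close> by at most
  \<open>bias a b\<close>. Averaging first over the diagram plane, where the kernel has mass one, and then over the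
  covariate, where the mean weight is at most \<open>CZ\<close>, gives the bias. Upper and lower estimates are
  derived separately, in a form without subtraction, because the integrals take
  extended nonnegative values.\<close>

lemma weighted_obs_mean:
  assumes z: "z \<in> \<Z>" and u: "u \<in> Omega_bar L"
  shows "\<bar>expectation (\<lambda>\<omega>. kappa \<Z> KZ a z (Zs i \<omega>) * smoothed_diagram L w KU b (Ds i \<omega>) u)
      - lam z u * expectation (\<lambda>\<omega>. kappa \<Z> KZ a z (Zs i \<omega>))\<bar> \<le> bias a b * CZ"
proof -
  let ?k = "\<lambda>y. ennreal (kappa \<Z> KZ a z y)"
  let ?\<phi> = "\<lambda>v. ennreal (kappa (Omega_bar L) KU b u v)"
  let ?G = "\<lambda>y. \<integral>\<^sup>+v. ?\<phi> v * lam_ext y v \<partial>lborel"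
  let ?EY = "expectation (\<lambda>\<omega>. kappa \<Z> KZ a z (Zs i \<omega>) * smoothed_diagram L w KU b (Ds i \<omega>) u)"
  let ?EZ = "expectation (\<lambda>\<omega>. kappa \<Z> KZ a z (Zs i \<omega>))"
  let ?\<beta> = "bias a b"
  have lam0: "0 \<le> lam z u" using lam_nonneg z u by blast
  have b0: "0 \<le> ?\<beta>" by (rule bias_nonneg)
  have EZ0: "0 \<le> ?EZ" using local_weight_mean(1)[OF z] pZ_bounds(1) by linarith
  have EY0: "0 \<le> ?EY"
    by (intro integral_nonneg_AE AE_I2 mult_nonneg_nonneg location_kernel(1)[OF z] smoothed_nonneg[OF u])
  have m\<phi>: "(\<lambda>v. ?\<phi> v * indicator (Omega_bar L) v) \<in> borel_measurable lborel"
    using kernels_measurable(2) Omega_bar_borel by simp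
  have const: "(\<integral>\<^sup>+v. c * (?\<phi> v * indicator (Omega_bar L) v) \<partial>lborel) = c" for c
    using nn_integral_cmult[OF m\<phi>, of c] diagram_kernel(5)[OF u] by simp
  have ml: "(\<lambda>v. lam_ext y v) \<in> borel_measurable borel" for y
    using measurable_compose[OF measurable_Pair1'[of y "borel::(real^'d) measure" "borel::(real*real) measure", unfolded borel_prod] lam_ext_measurable]
    by simp
  have m\<phi>l: "(\<lambda>v. ?\<phi> v * lam_ext y v) \<in> borel_measurable lborel" for y
    using kernels_measurable(2) ml[of y] by simp
  have close: "lam y v \<le> lam z u + ?\<beta>" "lam z u \<le> lam y v + ?\<beta>"
    if "y \<in> \<Z>" "norm (y - z) \<le> a" "v \<in> Omega_bar L" "kappa (Omega_bar L) KU b u v \<noteq> 0" for y v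
    using lam_close[OF z that(1) u that(3) that(2) diagram_kernel(3)[OF u that(4)]] by linarith+
  have upG: "?G y \<le> ennreal (lam z u + ?\<beta>)" if y: "y \<in> \<Z>" "norm (y - z) \<le> a" for y
  proof -
    have "?G y \<le> (\<integral>\<^sup>+v. ennreal (lam z u + ?\<beta>) * (?\<phi> v * indicator (Omega_bar L) v) \<partial>lborel)"
    proof (rule nn_integral_mono)
      fix v
      show "?\<phi> v * lam_ext y v \<le> ennreal (lam z u + ?\<beta>) * (?\<phi> v * indicator (Omega_bar L) v)"
      proof (cases "v \<in> Omega_bar L \<and> kappa (Omega_bar L) KU b u v \<noteq> 0")
        case True
        then have "ennreal (lam y v) \<le> ennreal (lam z u + ?\<beta>)"
          using close(1)[OF y] by (intro ennreal_leI) simp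
        then have "?\<phi> v * ennreal (lam y v) \<le> ?\<phi> v * ennreal (lam z u + ?\<beta>)"
          by (intro mult_left_mono) simp_all
        then show ?thesis using True by (simp add: lam_ext_eq[OF y(1)] mult.commute)
      next
        case False
        then have "?\<phi> v * lam_ext y v = 0" by (auto simp: lam_ext_eq[OF y(1)])
        then show ?thesis by (simp only: zero_le)
      qed
    qed
    then show ?thesis unfolding const .
  qed
  have loG: "ennreal (lam z u) \<le> ?G y + ennreal ?\<beta>" if y: "y \<in> \<Z>" "norm (y - z) \<le> a" for y
  proof -
    have "ennreal (lam z u) = (\<integral>\<^sup>+v. ennreal (lam z u) * (?\<phi> v * indicator (Omega_bar L) v) \<partial>lborel)"
      unfolding const ..
    also have "\<dots> \<le> (\<integral>\<^sup>+v. ?\<phi> v * lam_ext y v + ennreal ?\<beta> * (?\<phi> v * indicator (Omega_bar L) v) \<partial>lborel)"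
    proof (rule nn_integral_mono)
      fix v
      show "ennreal (lam z u) * (?\<phi> v * indicator (Omega_bar L) v)
        \<le> ?\<phi> v * lam_ext y v + ennreal ?\<beta> * (?\<phi> v * indicator (Omega_bar L) v)"
      proof (cases "v \<in> Omega_bar L \<and> kappa (Omega_bar L) KU b u v \<noteq> 0")
        case True
        have l0: "0 \<le> lam y v" using lam_nonneg y True by blast
        have "ennreal (lam z u) \<le> ennreal (lam y v + ?\<beta>)"
          using close(2)[OF y] True by (intro ennreal_leI) simp
        also have "\<dots> = ennreal (lam y v) + ennreal ?\<beta>" by (rule ennreal_plus[OF l0 b0])
        finally have "?\<phi> v * ennreal (lam z u) \<le> ?\<phi> v * (ennreal (lam y v) + ennreal ?\<beta>)"
          by (intro mult_left_mono) simp_all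
        then show ?thesis using True by (simp add: lam_ext_eq[OF y(1)] mult.commute distrib_left)
      next
        case False
        then have "?\<phi> v * indicator (Omega_bar L) v = 0" by auto
        then show ?thesis by (simp only: mult_zero_right zero_le)
      qed
    qed
    also have "\<dots> = ?G y + (\<integral>\<^sup>+v. ennreal ?\<beta> * (?\<phi> v * indicator (Omega_bar L) v) \<partial>lborel)"
      by (rule nn_integral_add[OF m\<phi>l]) (use m\<phi> in simp)
    finally show ?thesis unfolding const .
  qed
  have mk: "(\<lambda>\<omega>. ?k (Zs i \<omega>)) \<in> borel_measurable M"
    by (rule measurable_compose[OF Zs_measurable[OF i] kernels_measurable(1)])
  have EZ: "(\<integral>\<^sup>+\<omega>. c * ?k (Zs i \<omega>) \<partial>M) = c * ennreal ?EZ" for c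
    unfolding nn_integral_local_weight[OF z] by (rule nn_integral_cmult[OF mk])
  have "ennreal ?EY \<le> (\<integral>\<^sup>+\<omega>. ennreal (lam z u + ?\<beta>) * ?k (Zs i \<omega>) \<partial>M)"
    unfolding nn_integral_weighted_obs[OF z u]
  proof (rule nn_integral_mono_AE, rule eventually_mono[OF AE_Zs[OF i]])
    fix \<omega> assume y: "Zs i \<omega> \<in> \<Z>"
    show "?k (Zs i \<omega>) * ?G (Zs i \<omega>) \<le> ennreal (lam z u + ?\<beta>) * ?k (Zs i \<omega>)"
    proof (cases "kappa \<Z> KZ a z (Zs i \<omega>) = 0")
      case False
      have "?k (Zs i \<omega>) * ?G (Zs i \<omega>) \<le> ?k (Zs i \<omega>) * ennreal (lam z u + ?\<beta>)"
        by (rule mult_left_mono[OF upG[OF y location_kernel(3)[OF z False]]]) simp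
      then show ?thesis by (simp add: mult.commute)
    qed simp
  qed
  also have "\<dots> = ennreal ((lam z u + ?\<beta>) * ?EZ)"
    unfolding EZ using lam0 b0 EZ0 by (intro ennreal_mult[symmetric]) simp_all
  finally have up: "?EY \<le> (lam z u + ?\<beta>) * ?EZ"
    using lam0 b0 EZ0 by (subst (asm) ennreal_le_iff) simp_all
  have mkG: "(\<lambda>\<omega>. ?k (Zs i \<omega>) * ?G (Zs i \<omega>)) \<in> borel_measurable M"
  proof -
    have "(\<lambda>(y, v). ?\<phi> v * lam_ext y v) \<in> borel_measurable (borel \<Otimes>\<^sub>M lborel)"
    proof -
      have "sets (borel \<Otimes>\<^sub>M lborel) = sets (borel \<Otimes>\<^sub>M borel :: ((real^'d) \<times> (real \<times> real)) measure)"
        by (rule sets_pair_measure_cong) auto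
      then have e: "sets (borel \<Otimes>\<^sub>M lborel) = sets (borel :: ((real^'d) \<times> (real \<times> real)) measure)"
        by (simp only: borel_prod)
      have 1: "case_prod lam_ext \<in> borel_measurable (borel \<Otimes>\<^sub>M lborel)"
        using measurable_cong_sets[OF e refl] lam_ext_measurable by blast
      have 2: "(\<lambda>x. ?\<phi> (snd x)) \<in> borel_measurable (borel \<Otimes>\<^sub>M lborel)"
        by (rule measurable_compose[OF measurable_snd]) (use kernels_measurable(2) in simp)
      from borel_measurable_times_ennreal[OF 2 1] show ?thesis by (simp add: case_prod_beta')
    qed
    from lborel.borel_measurable_nn_integral[OF this]
    have "?G \<in> borel_measurable borel" by simp
    from borel_measurable_times_ennreal[OF mk measurable_compose[OF Zs_measurable[OF i] this]]
    show ?thesis .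
  qed
  have "ennreal (lam z u * ?EZ) = (\<integral>\<^sup>+\<omega>. ennreal (lam z u) * ?k (Zs i \<omega>) \<partial>M)"
    unfolding EZ using lam0 EZ0 by (intro ennreal_mult) simp_all
  also have "\<dots> \<le> (\<integral>\<^sup>+\<omega>. ?k (Zs i \<omega>) * ?G (Zs i \<omega>) + ennreal ?\<beta> * ?k (Zs i \<omega>) \<partial>M)"
  proof (rule nn_integral_mono_AE, rule eventually_mono[OF AE_Zs[OF i]])
    fix \<omega> assume y: "Zs i \<omega> \<in> \<Z>"
    show "ennreal (lam z u) * ?k (Zs i \<omega>) \<le> ?k (Zs i \<omega>) * ?G (Zs i \<omega>) + ennreal ?\<beta> * ?k (Zs i \<omega>)"
    proof (cases "kappa \<Z> KZ a z (Zs i \<omega>) = 0")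
      case False
      have "?k (Zs i \<omega>) * ennreal (lam z u) \<le> ?k (Zs i \<omega>) * (?G (Zs i \<omega>) + ennreal ?\<beta>)"
        by (rule mult_left_mono[OF loG[OF y location_kernel(3)[OF z False]]]) simp
      then show ?thesis by (simp add: mult.commute distrib_left)
    qed simp
  qed
  also have "\<dots> = (\<integral>\<^sup>+\<omega>. ?k (Zs i \<omega>) * ?G (Zs i \<omega>) \<partial>M) + (\<integral>\<^sup>+\<omega>. ennreal ?\<beta> * ?k (Zs i \<omega>) \<partial>M)"
    by (rule nn_integral_add[OF mkG]) (use mk in simp)
  also have "\<dots> = ennreal ?EY + ennreal ?\<beta> * ennreal ?EZ"
    unfolding nn_integral_weighted_obs[OF z u] EZ ..
  also have "\<dots> = ennreal (?EY + ?\<beta> * ?EZ)"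
    unfolding ennreal_mult[OF b0 EZ0, symmetric]
    by (rule ennreal_plus[symmetric, OF EY0 mult_nonneg_nonneg[OF b0 EZ0]])
  finally have lo: "lam z u * ?EZ \<le> ?EY + ?\<beta> * ?EZ"
    using EY0 b0 EZ0 by (subst (asm) ennreal_le_iff) simp_all
  have "?\<beta> * ?EZ \<le> ?\<beta> * CZ"
    by (rule mult_left_mono[OF local_weight_mean(2)[OF z] b0])
  with up lo show ?thesis unfolding distrib_right by linarith
qed

end
end

section \<open>Uniform rates of convergence\<close>

text \<open>Perturbation of a quotient whose denominator is bounded below by \<open>n c / 2\<close>. In the application
  \<open>EN\<close> and \<open>EP\<close> are the expectations, \<open>l\<close> is the intensity, and \<open>d1\<close>, \<open>d2\<close>, \<open>\<beta>\<close> are the two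
  fluctuations and the bias per observation.\<close>

lemma ratio_error:
  fixes N P :: real
  assumes n: "0 < n" and c: "0 < c"
    and N: "\<bar>N - EN\<bar> \<le> n * d1" and P: "\<bar>P - EP\<bar> \<le> n * d2"
    and bias: "\<bar>EN - l * EP\<bar> \<le> n * \<beta>" and EP: "n * c \<le> EP" and d2: "d2 \<le> c / 2"
    and l: "0 \<le> l" "l \<le> l'"
  shows "0 < P" "\<bar>N / P - l\<bar> \<le> 2 / c * (d1 + l' * d2 + \<beta>)"
proof -
  have "n * d2 \<le> n * (c / 2)" using n d2 by (intro mult_left_mono) auto
  then have P2: "n * c / 2 \<le> P" using P EP by simp
  have nc: "0 < n * c / 2" using n c by simp
  then show P0: "0 < P" using P2 by linarith
  have d20: "0 \<le> n * d2" using P by linarith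
  have "N - l * P = (N - EN) - l * (P - EP) + (EN - l * EP)" by (simp add: algebra_simps)
  then have "\<bar>N - l * P\<bar> \<le> \<bar>N - EN\<bar> + \<bar>l * (P - EP)\<bar> + \<bar>EN - l * EP\<bar>" by linarith
  also have "\<bar>l * (P - EP)\<bar> \<le> l' * (n * d2)"
    unfolding abs_mult using l P d20 by (intro mult_mono) auto
  finally have num: "\<bar>N - l * P\<bar> \<le> n * (d1 + l' * d2 + \<beta>)"
    using N bias by (simp add: algebra_simps)
  have "\<bar>N / P - l\<bar> = \<bar>N - l * P\<bar> / P" using P0 by (simp add: field_simps abs_divide)
  also have "\<dots> \<le> (n * (d1 + l' * d2 + \<beta>)) / (n * c / 2)"
    by (rule frac_le[OF _ num nc P2]) (use num in linarith)
  also have "\<dots> = 2 / c * (d1 + l' * d2 + \<beta>)" using n c by simp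
  finally show "\<bar>N / P - l\<bar> \<le> 2 / c * (d1 + l' * d2 + \<beta>)" .
qed

lemma abs_sup_dist_le:
  assumes "A \<noteq> {}" "B \<noteq> {}" and le: "\<And>z u. z \<in> A \<Longrightarrow> u \<in> B \<Longrightarrow> \<bar>f z u - g z u\<bar> \<le> c"
  shows "\<bar>sup_dist A B f g\<bar> \<le> ereal c"
proof -
  obtain z u where zu: "z \<in> A" "u \<in> B" using assms(1,2) by blast
  have "ereal 0 \<le> ereal \<bar>f z u - g z u\<bar>" by simp
  also have "\<dots> \<le> (SUP u\<in>B. ereal \<bar>f z u - g z u\<bar>)" by (rule SUP_upper[OF zu(2)])
  also have "\<dots> \<le> sup_dist A B f g" unfolding sup_dist_def by (rule SUP_upper[OF zu(1)])
  finally have "0 \<le> sup_dist A B f g" by (simp only: zero_ereal_def)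
  moreover have "sup_dist A B f g \<le> ereal c"
    unfolding sup_dist_def by (intro SUP_least) (simp only: ereal_less_eq le)
  ultimately show ?thesis by simp
qed

lemma big_OP_mono:
  assumes X: "big_OP M X r" and le: "\<forall>\<^sub>F n in sequentially. 0 \<le> r n \<and> r n \<le> k * s n" and k: "0 \<le> k"
  shows "big_OP M X s"
  unfolding big_OP_def
proof (intro allI impI)
  fix \<epsilon> :: real assume "0 < \<epsilon>"
  with X obtain C where C: "\<forall>\<^sub>F n in sequentially.
      \<exists>E\<in>sets M. {\<omega> \<in> space M. \<bar>X n \<omega>\<bar> > ereal (C * r n)} \<subseteq> E \<and> measure M E \<le> \<epsilon>"
    unfolding big_OP_def by blast
  show "\<exists>C. \<forall>\<^sub>F n in sequentially.
      \<exists>E\<in>sets M. {\<omega> \<in> space M. \<bar>X n \<omega>\<bar> > ereal (C * s n)} \<subseteq> E \<and> measure M E \<le> \<epsilon>"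
  proof (rule exI[of _ "\<bar>C\<bar> * k"])
    show "\<forall>\<^sub>F n in sequentially.
      \<exists>E\<in>sets M. {\<omega> \<in> space M. \<bar>X n \<omega>\<bar> > ereal (\<bar>C\<bar> * k * s n)} \<subseteq> E \<and> measure M E \<le> \<epsilon>"
      using C le
    proof eventually_elim
      case (elim n)
      have "C * r n \<le> \<bar>C\<bar> * r n" using elim(2) by (intro mult_right_mono) auto
      also have "\<dots> \<le> \<bar>C\<bar> * (k * s n)" using elim(2) by (intro mult_left_mono) auto
      finally have "ereal (C * r n) \<le> ereal (\<bar>C\<bar> * k * s n)" by (simp add: mult.assoc)
      then have "{\<omega> \<in> space M. \<bar>X n \<omega>\<bar> > ereal (\<bar>C\<bar> * k * s n)} \<subseteq> {\<omega> \<in> space M. \<bar>X n \<omega>\<bar> > ereal (C * r n)}"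
      proof (intro subsetI CollectI conjI)
        fix \<omega> assume \<omega>: "\<omega> \<in> {\<omega> \<in> space M. \<bar>X n \<omega>\<bar> > ereal (\<bar>C\<bar> * k * s n)}"
        then show "\<omega> \<in> space M" by blast
        from \<omega> have "ereal (\<bar>C\<bar> * k * s n) < \<bar>X n \<omega>\<bar>" by blast
        with \<open>ereal (C * r n) \<le> ereal (\<bar>C\<bar> * k * s n)\<close>
        show "ereal (C * r n) < \<bar>X n \<omega>\<bar>" by (rule le_less_trans)
      qed
      with elim(1) show ?case by (meson order_trans)
    qed
  qed
qed

context conditional_intensity_model
begin

text \<open>A constant large enough for the sup bounds, second moments and Lipschitz constants of both
  numerator and denominator.\<close>

definition dev_const :: "real \<Rightarrow> real \<Rightarrow> real" where
  "dev_const AZ AU = 2 * (AZ * AU * W) * (1 + lam_sup + \<bar>LZ\<bar> + \<bar>LU\<bar>) * (1 + CZ)"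

lemma dev_const_ge:
  assumes "1 \<le> AZ" "1 \<le> AU"
  shows "2 * (AZ * AU * W) \<le> dev_const AZ AU"
    and "AZ * AU * W * ((lam_sup + \<bar>LZ\<bar> + \<bar>LU\<bar>) * CZ) \<le> dev_const AZ AU"
    and "AZ * AU * W * CZ \<le> dev_const AZ AU"
    and "1 \<le> AZ * AU * W" "AZ \<le> AZ * AU * W"
proof -
  have W1: "1 \<le> W" by (simp add: W_def)
  have "1 * 1 \<le> AU * W" using assms W1 by (intro mult_mono) auto
  then have AW: "1 \<le> AU * W" by simp
  have "AZ * 1 \<le> AZ * (AU * W)" using AW assms by (intro mult_left_mono) auto
  then show A: "AZ \<le> AZ * AU * W" by (simp add: mult.assoc)
  then show P: "1 \<le> AZ * AU * W" using assms by linarith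
  define P where "P = AZ * AU * W"
  define q where "q = lam_sup + \<bar>LZ\<bar> + \<bar>LU\<bar>"
  have q: "0 \<le> q" using lam_sup(1) by (simp add: q_def)
  have P1: "1 \<le> P" using P by (simp add: P_def)
  have d: "dev_const AZ AU = 2 * (P * ((1 + q) * (1 + CZ)))"
    by (simp add: dev_const_def P_def q_def mult.assoc add.assoc)
  have CZ0: "0 \<le> CZ" using CZ_pos by simp
  have "1 \<le> (1 + q) * (1 + CZ)" "q * CZ \<le> (1 + q) * (1 + CZ)" "CZ \<le> (1 + q) * (1 + CZ)"
    using q CZ0 mult_nonneg_nonneg[OF q CZ0] by (simp_all add: distrib_left distrib_right)
  note m = this[THEN mult_left_mono, of P]
  have P0: "0 \<le> P" using P1 by simp
  have nn: "0 \<le> P * ((1 + q) * (1 + CZ))" using P0 q CZ0 by simp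
  then have half: "P * ((1 + q) * (1 + CZ)) \<le> dev_const AZ AU" unfolding d by linarith
  have "2 * P * 1 \<le> 2 * (P * ((1 + q) * (1 + CZ)))" using m(1)[OF P0] by linarith
  then have "2 * P \<le> dev_const AZ AU" unfolding d by linarith
  moreover have "P * (q * CZ) \<le> dev_const AZ AU" "P * CZ \<le> dev_const AZ AU"
    using order.trans[OF m(2)[OF P0] half] order.trans[OF m(3)[OF P0] half] .
  ultimately show "2 * (AZ * AU * W) \<le> dev_const AZ AU"
    "AZ * AU * W * ((lam_sup + \<bar>LZ\<bar> + \<bar>LU\<bar>) * CZ) \<le> dev_const AZ AU"
    "AZ * AU * W * CZ \<le> dev_const AZ AU"
    unfolding P_def[symmetric] q_def[symmetric] by simp_all
qed

lemma indep_sample_functional: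
  assumes "g \<in> borel_measurable (borel \<Otimes>\<^sub>M diagram_space L)"
  shows "indep_vars (\<lambda>_. borel) (\<lambda>i \<omega>. g (Zs i \<omega>, Ds i \<omega>)) {1..n}"
  by (rule indep_vars_compose2[OF indep_vars_subset[OF sample_indep]]) (use assms in auto)

text \<open>The deviation bound is applied to the numerator \<open>f1\<close> and to the denominator \<open>f2\<close> over the
  same index set \<open>T\<close>, on which \<open>f2\<close> does not depend on the second coordinate. For \<open>\<epsilon>\<close>
  given, both exceptional events have probability at most \<open>\<epsilon> / 2\<close>, and outside them
  \<open>ratio_error\<close> applies pointwise.\<close>

lemma uniform_rate:
  fixes hZ hU :: "nat \<Rightarrow> real"
  assumes hZ: "\<forall>n\<ge>1. hZ n > 0" and hU: "\<forall>n\<ge>1. hU n > 0"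
    and hZ0: "hZ \<longlonglongrightarrow> 0" and hU0: "hU \<longlonglongrightarrow> 0"
    and lim: "filterlim (\<lambda>n. real n * hZ n ^ CARD('d) * hU n ^ 2 / ln (real n)) at_top sequentially"
  shows "big_OP M
         (\<lambda>n \<omega>. sup_dist \<Z> (Omega_bar L)
            (lambda_hat L w \<Z> KZ KU (hZ n) (hU n) n (\<lambda>i. Zs i \<omega>) (\<lambda>i. Ds i \<omega>)) lam)
         (\<lambda>n. hZ n powr sZ + hU n powr sU
            + sqrt (ln (real n) / (real n * hZ n ^ CARD('d) * hU n ^ 2))
            + ln (real n) / (real n * hZ n ^ CARD('d) * hU n ^ 2))"
proof -
  let ?d = "CARD('d)"
  from kernel_bounds_small_bandwidth[OF Z_compact cone_condition_interior_balls[OF Z_cone] KZ]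
  obtain AZ a0 where kZ: "0 < a0" "\<And>h. 0 < h \<Longrightarrow> h \<le> a0 \<Longrightarrow> kernel_bounds \<Z> KZ AZ h" by blast
  from kernel_bounds_small_bandwidth[OF Omega_bar_compact Omega_bar_interior_balls[OF L_pos] KU]
  obtain AU b0 where kU: "0 < b0" "\<And>h. 0 < h \<Longrightarrow> h \<le> b0 \<Longrightarrow> kernel_bounds (Omega_bar L) KU AU h" by blast
  have A1: "1 \<le> AZ" "1 \<le> AU"
    using kZ(2)[OF kZ(1)] kU(2)[OF kU(1)] unfolding kernel_bounds_def by auto
  define B where "B = dev_const AZ AU"
  define P where "P = AZ * AU * W"
  have PB: "2 * P \<le> B" "P * ((lam_sup + \<bar>LZ\<bar> + \<bar>LU\<bar>) * CZ) \<le> B" "P * CZ \<le> B" "1 \<le> P" "AZ \<le> P"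
    unfolding P_def B_def by (rule dev_const_ge[OF A1])+
  have B0: "0 < B" using PB by linarith
  define H where "H n = hZ n ^ ?d * hU n ^ 2" for n
  define T where "T = \<Z> \<times> Omega_bar L"
  define f1 where "f1 n i x \<omega> = kappa \<Z> KZ (hZ n) (fst x) (Zs i \<omega>) * smoothed_diagram L w KU (hU n) (Ds i \<omega>) (snd x)"
    for n i x \<omega>
  define f2 where "f2 n i x \<omega> = kappa \<Z> KZ (hZ n) (fst x) (Zs i \<omega>)" for n i and x :: "(real^'d) \<times> (real \<times> real)" and \<omega>
  have lim0: "(\<lambda>n. ln (real n) / (real n * H n)) \<longlonglongrightarrow> 0"
    using tendsto_inverse_0_at_top[OF lim] by (simp add: H_def mult.assoc)
  have ge1: "\<forall>\<^sub>F n in sequentially. 1 \<le> real n * hZ n ^ ?d * hU n ^ 2 / ln (real n)"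
    using lim unfolding filterlim_at_top by blast
  \<comment> \<open>The indices beyond which every estimate holds. That the bandwidths are at least \<open>1/n\<close> follows from \<open>n H \<ge> 1\<close>, since \<open>H\<close> is at most each of them.\<close>
  define G where "G n \<longleftrightarrow> 3 \<le> n \<and> kernel_bounds \<Z> KZ AZ (hZ n) \<and> kernel_bounds (Omega_bar L) KU AU (hU n)
      \<and> 0 < H n \<and> H n \<le> 1 \<and> 1 / hZ n \<le> real n \<and> 1 / hU n \<le> real n" for n
  have good: "\<forall>\<^sub>F n in sequentially. G n"
    using order_tendstoD(2)[OF hZ0 kZ(1)] order_tendstoD(2)[OF hU0 kU(1)] ge1 eventually_ge_at_top[of 3]
  proof eventually_elim
    case (elim n)
    have n: "1 \<le> n" "3 \<le> n" using elim(4) by auto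
    have pos: "0 < hZ n" "0 < hU n" using hZ hU n by auto
    have kb: "kernel_bounds \<Z> KZ AZ (hZ n)" "kernel_bounds (Omega_bar L) KU AU (hU n)"
      using kZ(2)[OF pos(1)] kU(2)[OF pos(2)] elim(1,2) by auto
    then have le: "hZ n \<le> 1" "hU n \<le> 1" unfolding kernel_bounds_def by auto
    have "exp 1 \<le> real n" using exp_le n by linarith
    then have ln: "1 \<le> ln (real n)" using n by (simp add: ln_ge_iff)
    then have big: "1 \<le> real n * H n"
      using elim(3) by (simp add: H_def mult.assoc le_divide_eq)
    have pw: "hZ n ^ ?d \<le> hZ n" "hU n ^ 2 \<le> hU n" "hZ n ^ ?d \<le> 1" "hU n ^ 2 \<le> 1"
      using pos le by (simp_all add: power_le_one power_le_one_iff power_decreasing[of 1, simplified] Suc_leI)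
    have H0: "0 < H n" using pos by (simp add: H_def)
    have H1: "H n \<le> 1 * 1" "H n \<le> hZ n * 1" "H n \<le> 1 * hU n"
      unfolding H_def by (rule mult_mono; use pos pw in simp)+
    have "1 \<le> real n * hZ n" "1 \<le> real n * hU n"
      using big H1(2,3) mult_left_mono[of "H n" "hZ n" "real n"] mult_left_mono[of "H n" "hU n" "real n"]
      by simp_all
    then have "1 / hZ n \<le> real n" "1 / hU n \<le> real n" using pos by (simp_all add: divide_le_eq)
    with n kb H0 H1 show ?case by (simp add: G_def)
  qed
  have T: "bounded T" unfolding T_def
    by (intro bounded_Times compact_imp_bounded Z_compact Omega_bar_compact)
  have memT: "fst x \<in> \<Z>" "snd x \<in> Omega_bar L" if "x \<in> T" for x
    using that by (simp_all add: T_def mem_Times_iff)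
  let ?r = "\<lambda>n. sqrt (ln (real n) / (real n * H n))"
  \<comment> \<open>The bound \<open>1/n\<close> from below makes the Lipschitz constants polynomial in \<open>n\<close>.\<close>
  have pw: "1 / (hZ n ^ (2 * ?d + 1) * hU n ^ 5) \<le> real n ^ (2 * ?d + 6)"
    if n: "G n" for n
  proof -
    have pos: "0 < hZ n" "0 < hU n" using n unfolding G_def kernel_bounds_def by blast+
    have "1 / (hZ n ^ (2 * ?d + 1) * hU n ^ 5) = (1 / hZ n) ^ (2 * ?d + 1) * (1 / hU n) ^ 5"
      by (simp add: power_one_over)
    also have "\<dots> \<le> real n ^ (2 * ?d + 1) * real n ^ 5"
      using n pos unfolding G_def by (intro mult_mono power_mono) auto
    also have "\<dots> = real n ^ (2 * ?d + 6)" unfolding power_add[symmetric] by (simp add: add.commute)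
    finally show ?thesis .
  qed
  have f10: "0 \<le> f1 n i x \<omega>" if n: "G n" and i: "i \<in> {1..n}" and x: "x \<in> T" for n i x \<omega>
  proof -
    from n i have k: "kernel_bounds \<Z> KZ AZ (hZ n)" "kernel_bounds (Omega_bar L) KU AU (hU n)" "1 \<le> i"
      unfolding G_def by auto
    show ?thesis unfolding f1_def
      by (rule mult_nonneg_nonneg[OF location_kernel(1)[OF k memT(1)[OF x]] smoothed_nonneg[OF k memT(2)[OF x]]])
  qed
  have f20: "0 \<le> f2 n i x \<omega>" if n: "G n" and i: "i \<in> {1..n}" and x: "x \<in> T" for n i x \<omega>
  proof -
    from n i have k: "kernel_bounds \<Z> KZ AZ (hZ n)" "kernel_bounds (Omega_bar L) KU AU (hU n)" "1 \<le> i"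
      unfolding G_def by auto
    show ?thesis unfolding f2_def by (rule location_kernel(1)[OF k memT(1)[OF x]])
  qed
  have sup1: "AE \<omega> in M. f1 n i x \<omega> \<le> P / H n" if n: "G n" and i: "i \<in> {1..n}" and x: "x \<in> T" for n i x
  proof -
    from n i have k: "kernel_bounds \<Z> KZ AZ (hZ n)" "kernel_bounds (Omega_bar L) KU AU (hU n)" "1 \<le> i"
      unfolding G_def by auto
    show ?thesis using AE_weighted_obs_bound[OF k]
      by (rule eventually_mono) (use memT[OF x] in \<open>unfold f1_def P_def H_def, blast\<close>)
  qed
  have sup2: "f2 n i x \<omega> \<le> P / H n" if n: "G n" and i: "i \<in> {1..n}" and x: "x \<in> T" for n i x \<omega>
  proof -
    from n i have k: "kernel_bounds \<Z> KZ AZ (hZ n)" "kernel_bounds (Omega_bar L) KU AU (hU n)" "1 \<le> i"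
      unfolding G_def by auto
    have "f2 n i x \<omega> \<le> AZ / hZ n ^ ?d" unfolding f2_def by (rule location_kernel(2)[OF k memT(1)[OF x]])
    also have "\<dots> \<le> P / H n"
    proof (rule frac_le)
      show "0 \<le> P" "AZ \<le> P" using PB by simp_all
      show "0 < H n" using n by (simp add: G_def)
      have b: "0 < hZ n" "0 < hU n" "hU n \<le> 1" using bandwidth_bounds[OF k] by auto
      then have "hZ n ^ ?d * hU n ^ 2 \<le> hZ n ^ ?d * 1"
        by (intro mult_left_mono power_le_one) auto
      then show "H n \<le> hZ n ^ ?d" by (simp add: H_def)
    qed
    finally show ?thesis .
  qed
  have PH: "P / H n \<le> B / H n" "0 \<le> P / H n" if "G n" for n
    using that PB B0 unfolding G_def by (simp_all add: divide_right_mono)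
  have meas1: "f1 n i x \<in> borel_measurable M" and meas2: "f2 n i x \<in> borel_measurable M"
    if n: "G n" and i: "i \<in> {1..n}" and x: "x \<in> T" for n i x
  proof -
    from n i have k: "kernel_bounds \<Z> KZ AZ (hZ n)" "kernel_bounds (Omega_bar L) KU AU (hU n)" "1 \<le> i"
      unfolding G_def by auto
    show "f1 n i x \<in> borel_measurable M"
      unfolding f1_def[abs_def] by (rule weighted_obs_rv[OF k memT(2)[OF x]])
    show "f2 n i x \<in> borel_measurable M"
      unfolding f2_def[abs_def] by (rule local_weight_rv[OF k])
  qed
  have mean2: "cZ \<le> expectation (f2 n i x)" "expectation (f2 n i x) \<le> CZ"
    if n: "G n" and i: "i \<in> {1..n}" and x: "x \<in> T" for n i x
  proof -
    from n i have k: "kernel_bounds \<Z> KZ AZ (hZ n)" "kernel_bounds (Omega_bar L) KU AU (hU n)" "1 \<le> i"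
      unfolding G_def by auto
    show "cZ \<le> expectation (f2 n i x)" "expectation (f2 n i x) \<le> CZ"
      unfolding f2_def[abs_def] by (rule local_weight_mean[OF k memT(1)[OF x]])+
  qed
  have mean1: "\<bar>expectation (f1 n i x) - lam (fst x) (snd x) * expectation (f2 n i x)\<bar>
      \<le> bias (hZ n) (hU n) * CZ"
    if n: "G n" and i: "i \<in> {1..n}" and x: "x \<in> T" for n i x
  proof -
    from n i have k: "kernel_bounds \<Z> KZ AZ (hZ n)" "kernel_bounds (Omega_bar L) KU AU (hU n)" "1 \<le> i"
      unfolding G_def by auto
    show ?thesis unfolding f1_def[abs_def] f2_def[abs_def]
      by (rule weighted_obs_mean[OF k memT[OF x]])
  qed
  have mean1_le: "expectation (f1 n i x) \<le> (lam_sup + \<bar>LZ\<bar> + \<bar>LU\<bar>) * CZ"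
    if n: "G n" and i: "i \<in> {1..n}" and x: "x \<in> T" for n i x
  proof -
    have b: "bias (hZ n) (hU n) * CZ \<le> (\<bar>LZ\<bar> + \<bar>LU\<bar>) * CZ"
    proof (rule mult_right_mono)
      show "bias (hZ n) (hU n) \<le> \<bar>LZ\<bar> + \<bar>LU\<bar>"
        using n unfolding G_def kernel_bounds_def by (intro bias_le) auto
    qed (use CZ_pos in simp)
    have "lam (fst x) (snd x) * expectation (f2 n i x) \<le> lam_sup * CZ"
      using lam_sup(1) lam_sup(2)[OF memT[OF x]] mean2[OF that] pZ_bounds(1)
      by (intro mult_mono) auto
    with b mean1[OF that] show ?thesis by (simp add: distrib_right)
  qed
  have indep1: "indep_vars (\<lambda>_. borel) (\<lambda>i. f1 n i x) {1..n}" if n: "G n" and x: "x \<in> T" for n x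
  proof -
    have kU': "0 \<le> kappa (Omega_bar L) KU (hU n) (snd x) v" for v
      using n memT(2)[OF x] unfolding G_def kernel_bounds_def by blast
    have "(\<lambda>p. kappa \<Z> KZ (hZ n) (fst x) (fst p) * smoothed_diagram L w KU (hU n) (snd p) (snd x))
        \<in> borel_measurable (borel \<Otimes>\<^sub>M diagram_space L)"
      by (intro borel_measurable_times measurable_compose[OF measurable_fst kappa_measurable[OF KZ]]
          measurable_compose[OF measurable_snd smoothed_diagram_measurable[OF weight KU kU']])
    from indep_sample_functional[OF this] show ?thesis
      unfolding f1_def[abs_def] fst_conv snd_conv .
  qed
  have indep2: "indep_vars (\<lambda>_. borel) (\<lambda>i. f2 n i x) {1..n}" for n x
  proof -
    have "(\<lambda>p. kappa \<Z> KZ (hZ n) (fst x) (fst p)) \<in> borel_measurable (borel \<Otimes>\<^sub>M diagram_space L)"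
      by (rule measurable_compose[OF measurable_fst kappa_measurable[OF KZ]])
    from indep_sample_functional[OF this] show ?thesis
      unfolding f2_def[abs_def] fst_conv snd_conv .
  qed
  have bdd1: "AE \<omega> in M. \<bar>f1 n i x \<omega>\<bar> \<le> B / H n"
    if n: "G n" and i: "i \<in> {1..n}" and x: "x \<in> T" for n i x
    using sup1[OF that]
  proof (rule eventually_mono)
    fix \<omega> assume "f1 n i x \<omega> \<le> P / H n"
    then show "\<bar>f1 n i x \<omega>\<bar> \<le> B / H n" using f10[OF that, of \<omega>] PH(1)[OF n] by linarith
  qed
  have bdd2: "AE \<omega> in M. \<bar>f2 n i x \<omega>\<bar> \<le> B / H n"
    if n: "G n" and i: "i \<in> {1..n}" and x: "x \<in> T" for n i x
  proof (rule AE_I2)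
    fix \<omega>
    show "\<bar>f2 n i x \<omega>\<bar> \<le> B / H n" using sup2[OF that, of \<omega>] f20[OF that, of \<omega>] PH(1)[OF n] by linarith
  qed
  have var1: "expectation (\<lambda>\<omega>. (f1 n i x \<omega>)\<^sup>2) \<le> B / H n"
    if n: "G n" and i: "i \<in> {1..n}" and x: "x \<in> T" for n i x
  proof -
    have "expectation (\<lambda>\<omega>. (f1 n i x \<omega>)\<^sup>2) \<le> P / H n * ((lam_sup + \<bar>LZ\<bar> + \<bar>LU\<bar>) * CZ)"
      by (rule second_moment_le[OF meas1[OF that] f10[OF that] sup1[OF that] mean1_le[OF that] PH(2)[OF n]])
    also have "\<dots> = P * ((lam_sup + \<bar>LZ\<bar> + \<bar>LU\<bar>) * CZ) / H n" by simp
    also have "\<dots> \<le> B / H n" using PB(2) n unfolding G_def by (intro divide_right_mono) auto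
    finally show ?thesis .
  qed
  have var2: "expectation (\<lambda>\<omega>. (f2 n i x \<omega>)\<^sup>2) \<le> B / H n"
    if n: "G n" and i: "i \<in> {1..n}" and x: "x \<in> T" for n i x
  proof -
    have "expectation (\<lambda>\<omega>. (f2 n i x \<omega>)\<^sup>2) \<le> P / H n * CZ"
      by (rule second_moment_le[OF meas2[OF that] f20[OF that] AE_I2[OF sup2[OF that]] mean2(2)[OF that] PH(2)[OF n]])
    also have "\<dots> = P * CZ / H n" by simp
    also have "\<dots> \<le> B / H n" using PB(3) n unfolding G_def by (intro divide_right_mono) auto
    finally show ?thesis .
  qed
  have lip1: "AE \<omega> in M. \<forall>x\<in>T. \<forall>y\<in>T. \<bar>f1 n i x \<omega> - f1 n i y \<omega>\<bar> \<le> B * real n ^ (2 * ?d + 6) * dist x y"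
    if n: "G n" and i: "i \<in> {1..n}" for n i
  proof -
    from n i have k: "kernel_bounds \<Z> KZ AZ (hZ n)" "kernel_bounds (Omega_bar L) KU AU (hU n)" "1 \<le> i"
      unfolding G_def by auto
    have c: "2 * P / (hZ n ^ (2 * ?d + 1) * hU n ^ 5) \<le> B * real n ^ (2 * ?d + 6)"
    proof -
      have "2 * P / (hZ n ^ (2 * ?d + 1) * hU n ^ 5) = 2 * P * (1 / (hZ n ^ (2 * ?d + 1) * hU n ^ 5))"
        by simp
      also have "\<dots> \<le> B * real n ^ (2 * ?d + 6)"
        using PB(1) B0 bandwidth_bounds[OF k] by (intro mult_mono[OF _ pw[OF n]]) simp_all
      finally show ?thesis .
    qed
    show ?thesis using AE_weighted_obs_lipschitz[OF k]
    proof (rule eventually_mono, intro ballI)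
      fix \<omega> x y
      assume *: "\<forall>x\<in>\<Z> \<times> Omega_bar L. \<forall>y\<in>\<Z> \<times> Omega_bar L.
       \<bar>kappa \<Z> KZ (hZ n) (fst x) (Zs i \<omega>) * smoothed_diagram L w KU (hU n) (Ds i \<omega>) (snd x)
        - kappa \<Z> KZ (hZ n) (fst y) (Zs i \<omega>) * smoothed_diagram L w KU (hU n) (Ds i \<omega>) (snd y)\<bar>
         \<le> 2 * (AZ * AU * W) / (hZ n ^ (2 * ?d + 1) * hU n ^ 5) * dist x y"
        and x: "x \<in> T" and y: "y \<in> T"
      have "\<bar>f1 n i x \<omega> - f1 n i y \<omega>\<bar> \<le> 2 * P / (hZ n ^ (2 * ?d + 1) * hU n ^ 5) * dist x y"
        unfolding f1_def P_def using bspec[OF bspec[OF * x[unfolded T_def]] y[unfolded T_def]] .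
      also have "\<dots> \<le> B * real n ^ (2 * ?d + 6) * dist x y"
        by (rule mult_right_mono[OF c zero_le_dist])
      finally show "\<bar>f1 n i x \<omega> - f1 n i y \<omega>\<bar> \<le> B * real n ^ (2 * ?d + 6) * dist x y" .
    qed
  qed
  have lip2: "AE \<omega> in M. \<forall>x\<in>T. \<forall>y\<in>T. \<bar>f2 n i x \<omega> - f2 n i y \<omega>\<bar> \<le> B * real n ^ (2 * ?d + 6) * dist x y"
    if n: "G n" and i: "i \<in> {1..n}" for n i
  proof (intro AE_I2 ballI)
    fix \<omega> x y assume x: "x \<in> T" and y: "y \<in> T"
    from n i have k: "kernel_bounds \<Z> KZ AZ (hZ n)" "kernel_bounds (Omega_bar L) KU AU (hU n)" "1 \<le> i"
      unfolding G_def by auto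
    note bw = bandwidth_bounds[OF k]
    have "\<bar>f2 n i x \<omega> - f2 n i y \<omega>\<bar> \<le> AZ / hZ n ^ (2 * ?d + 1) * dist (fst x) (fst y)"
      unfolding f2_def by (rule location_kernel(4)[OF k memT(1)[OF x] memT(1)[OF y]])
    also have "\<dots> \<le> (B * real n ^ (2 * ?d + 6)) * dist x y"
    proof (rule mult_mono)
      show "dist (fst x) (fst y) \<le> dist x y" by (rule dist_fst_le)
      have "1 / hZ n ^ (2 * ?d + 1) \<le> 1 / (hZ n ^ (2 * ?d + 1) * hU n ^ 5)"
      proof (rule divide_left_mono)
        show "hZ n ^ (2 * ?d + 1) * hU n ^ 5 \<le> hZ n ^ (2 * ?d + 1)"
          using bw by (intro mult_left_le power_le_one) simp_all
      qed (use bw in simp_all)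
      also note pw[OF n]
      finally have q: "1 / hZ n ^ (2 * ?d + 1) \<le> real n ^ (2 * ?d + 6)" .
      have "AZ / hZ n ^ (2 * ?d + 1) = AZ * (1 / hZ n ^ (2 * ?d + 1))" by simp
      also have "\<dots> \<le> B * real n ^ (2 * ?d + 6)"
        using PB A1 bw B0 by (intro mult_mono[OF _ q]) simp_all
      finally show "AZ / hZ n ^ (2 * ?d + 1) \<le> B * real n ^ (2 * ?d + 6)" .
    qed (use B0 in simp_all)
    finally show "\<bar>f2 n i x \<omega> - f2 n i y \<omega>\<bar> \<le> B * real n ^ (2 * ?d + 6) * dist x y" .
  qed
  have "\<exists>C>0. \<forall>\<epsilon>>0. \<forall>\<^sub>F n in sequentially. \<exists>E\<in>events. prob E \<le> \<epsilon> \<and>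
    (\<forall>\<omega>\<in>space M - E. \<forall>x\<in>T. \<bar>\<Sum>i=1..n. f1 n i x \<omega> - expectation (f1 n i x)\<bar>
      \<le> real n * (C * ?r n))"
  proof (rule uniform_deviation_rate[OF T B0 _ lim0, where p = "2 * ?d + 6"])
    show "\<forall>\<^sub>F n in sequentially. 0 < H n \<and> H n \<le> 1"
      using good by (rule eventually_mono) (simp add: G_def)
    show "\<forall>\<^sub>F n in sequentially. \<forall>x\<in>T. indep_vars (\<lambda>_. borel) (\<lambda>i. f1 n i x) {1..n}"
      using good by (rule eventually_mono) (use indep1 in blast)
    show "\<forall>\<^sub>F n in sequentially. \<forall>i\<in>{1..n}. \<forall>x\<in>T. AE \<omega> in M. \<bar>f1 n i x \<omega>\<bar> \<le> B / H n"
      using good by (rule eventually_mono) (use bdd1 in blast)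
    show "\<forall>\<^sub>F n in sequentially. \<forall>i\<in>{1..n}. \<forall>x\<in>T. expectation (\<lambda>\<omega>. (f1 n i x \<omega>)\<^sup>2) \<le> B / H n"
      using good by (rule eventually_mono) (use var1 in blast)
    show "\<forall>\<^sub>F n in sequentially. \<forall>i\<in>{1..n}. AE \<omega> in M. \<forall>x\<in>T. \<forall>y\<in>T.
      \<bar>f1 n i x \<omega> - f1 n i y \<omega>\<bar> \<le> B * real n ^ (2 * ?d + 6) * dist x y"
      using good by (rule eventually_mono) (use lip1 in blast)
  qed
  then obtain C1 where C1: "0 < C1" and dev1: "\<And>\<epsilon>. 0 < \<epsilon> \<Longrightarrow> \<forall>\<^sub>F n in sequentially. \<exists>E\<in>events. prob E \<le> \<epsilon> \<and>
    (\<forall>\<omega>\<in>space M - E. \<forall>x\<in>T. \<bar>\<Sum>i=1..n. f1 n i x \<omega> - expectation (f1 n i x)\<bar>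
      \<le> real n * (C1 * ?r n))" by (elim exE conjE) (rule that; blast)
  have "\<exists>C>0. \<forall>\<epsilon>>0. \<forall>\<^sub>F n in sequentially. \<exists>E\<in>events. prob E \<le> \<epsilon> \<and>
    (\<forall>\<omega>\<in>space M - E. \<forall>x\<in>T. \<bar>\<Sum>i=1..n. f2 n i x \<omega> - expectation (f2 n i x)\<bar>
      \<le> real n * (C * ?r n))"
  proof (rule uniform_deviation_rate[OF T B0 _ lim0, where p = "2 * ?d + 6"])
    show "\<forall>\<^sub>F n in sequentially. 0 < H n \<and> H n \<le> 1"
      using good by (rule eventually_mono) (simp add: G_def)
    show "\<forall>\<^sub>F n in sequentially. \<forall>x\<in>T. indep_vars (\<lambda>_. borel) (\<lambda>i. f2 n i x) {1..n}"
      by (intro always_eventually allI ballI indep2)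
    show "\<forall>\<^sub>F n in sequentially. \<forall>i\<in>{1..n}. \<forall>x\<in>T. AE \<omega> in M. \<bar>f2 n i x \<omega>\<bar> \<le> B / H n"
      using good by (rule eventually_mono) (use bdd2 in blast)
    show "\<forall>\<^sub>F n in sequentially. \<forall>i\<in>{1..n}. \<forall>x\<in>T. expectation (\<lambda>\<omega>. (f2 n i x \<omega>)\<^sup>2) \<le> B / H n"
      using good by (rule eventually_mono) (use var2 in blast)
    show "\<forall>\<^sub>F n in sequentially. \<forall>i\<in>{1..n}. AE \<omega> in M. \<forall>x\<in>T. \<forall>y\<in>T.
      \<bar>f2 n i x \<omega> - f2 n i y \<omega>\<bar> \<le> B * real n ^ (2 * ?d + 6) * dist x y"
      using good by (rule eventually_mono) (use lip2 in blast)
  qed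
  then obtain C2 where C2: "0 < C2" and dev2: "\<And>\<epsilon>. 0 < \<epsilon> \<Longrightarrow> \<forall>\<^sub>F n in sequentially. \<exists>E\<in>events. prob E \<le> \<epsilon> \<and>
    (\<forall>\<omega>\<in>space M - E. \<forall>x\<in>T. \<bar>\<Sum>i=1..n. f2 n i x \<omega> - expectation (f2 n i x)\<bar>
      \<le> real n * (C2 * ?r n))" by (elim exE conjE) (rule that; blast)
  \<comment> \<open>The constant does not depend on \<open>\<epsilon>\<close>: only the index from which the bound holds does.\<close>
  define C where "C = 2 / cZ * (C1 + lam_sup * C2 + (\<bar>LZ\<bar> + \<bar>LU\<bar>) * CZ)"
  have "(\<lambda>n. C2 * ?r n) \<longlonglongrightarrow> C2 * sqrt 0" by (intro tendsto_intros lim0)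
  then have small: "\<forall>\<^sub>F n in sequentially. C2 * ?r n < cZ / 2"
    by (rule order_tendstoD(2)) (use pZ_bounds(1) in simp)
  have Omega_ne: "Omega_bar L \<noteq> {}"
  proof -
    have "(0, 0) \<in> Omega_bar L" using L_pos by (simp add: Omega_bar_def)
    then show ?thesis by blast
  qed
  show ?thesis unfolding big_OP_def
  proof (intro allI impI exI[of _ C])
    fix \<epsilon> :: real assume "0 < \<epsilon>"
    then have e2: "0 < \<epsilon> / 2" by simp
    show "\<forall>\<^sub>F n in sequentially. \<exists>E\<in>events.
      {\<omega> \<in> space M. \<bar>sup_dist \<Z> (Omega_bar L)
            (lambda_hat L w \<Z> KZ KU (hZ n) (hU n) n (\<lambda>i. Zs i \<omega>) (\<lambda>i. Ds i \<omega>)) lam\<bar>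
        > ereal (C * (hZ n powr sZ + hU n powr sU
            + sqrt (ln (real n) / (real n * hZ n ^ CARD('d) * hU n ^ 2))
            + ln (real n) / (real n * hZ n ^ CARD('d) * hU n ^ 2)))} \<subseteq> E \<and> prob E \<le> \<epsilon>"
      using good small dev1[OF e2] dev2[OF e2]
    proof eventually_elim
      case (elim n)
      note n = elim(1)
      from elim(3) obtain E1 where E1: "E1 \<in> events" and E1': "prob E1 \<le> \<epsilon> / 2 \<and>
        (\<forall>\<omega>\<in>space M - E1. \<forall>x\<in>T. \<bar>\<Sum>i=1..n. f1 n i x \<omega> - expectation (f1 n i x)\<bar>
        \<le> real n * (C1 * ?r n))" ..
      from elim(4) obtain E2 where E2: "E2 \<in> events" and E2': "prob E2 \<le> \<epsilon> / 2 \<and>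
        (\<forall>\<omega>\<in>space M - E2. \<forall>x\<in>T. \<bar>\<Sum>i=1..n. f2 n i x \<omega> - expectation (f2 n i x)\<bar>
        \<le> real n * (C2 * ?r n))" ..
      note D1 = bspec[OF bspec[OF conjunct2[OF E1']]] and D2 = bspec[OF bspec[OF conjunct2[OF E2']]]
      have n3: "3 \<le> n" and H0: "0 < H n" and kb: "kernel_bounds \<Z> KZ AZ (hZ n)" "kernel_bounds (Omega_bar L) KU AU (hU n)"
        using n by (simp_all add: G_def)
      have npos: "0 < real n" using n3 by simp
      have ln0: "0 \<le> ln (real n)" using n3 by simp
      define R where "R = hZ n powr sZ + hU n powr sU + ?r n + ln (real n) / (real n * H n)"
      have r0: "0 \<le> ?r n" "0 \<le> ln (real n) / (real n * H n)" using ln0 npos H0 by simp_all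
      have bR: "bias (hZ n) (hU n) \<le> (\<bar>LZ\<bar> + \<bar>LU\<bar>) * R"
      proof -
        have "hZ n powr sZ \<le> R" "hU n powr sU \<le> R" using r0 unfolding R_def by simp_all
        then show ?thesis unfolding bias_def distrib_right by (intro add_mono mult_left_mono) simp_all
      qed
      have rR: "?r n \<le> R" using r0 unfolding R_def by simp
      have err: "\<bar>lambda_hat L w \<Z> KZ KU (hZ n) (hU n) n (\<lambda>i. Zs i \<omega>) (\<lambda>i. Ds i \<omega>) z u - lam z u\<bar> \<le> C * R"
        if \<omega>: "\<omega> \<in> space M - (E1 \<union> E2)" and z: "z \<in> \<Z>" and u: "u \<in> Omega_bar L" for \<omega> z u
      proof -
        have x: "(z, u) \<in> T" using z u by (simp add: T_def)
        have \<omega>': "\<omega> \<in> space M - E1" "\<omega> \<in> space M - E2" using \<omega> by simp_all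
        let ?x = "(z, u)"
        let ?N = "\<Sum>i=1..n. f1 n i ?x \<omega>" and ?P = "\<Sum>i=1..n. f2 n i ?x \<omega>"
        let ?EN = "\<Sum>i=1..n. expectation (f1 n i ?x)" and ?EP = "\<Sum>i=1..n. expectation (f2 n i ?x)"
        have dN: "\<bar>?N - ?EN\<bar> \<le> real n * (C1 * ?r n)"
          unfolding sum_subtractf[symmetric] by (rule D1[OF \<omega>'(1) x])
        have dP: "\<bar>?P - ?EP\<bar> \<le> real n * (C2 * ?r n)"
          unfolding sum_subtractf[symmetric] by (rule D2[OF \<omega>'(2) x])
        have "?EN - lam z u * ?EP = (\<Sum>i=1..n. expectation (f1 n i ?x) - lam z u * expectation (f2 n i ?x))"
          unfolding sum_subtractf sum_distrib_left ..
        also have "\<bar>\<dots>\<bar> \<le> (\<Sum>i=1..n. \<bar>expectation (f1 n i ?x) - lam z u * expectation (f2 n i ?x)\<bar>)"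
          by (rule sum_abs)
        also have "\<dots> \<le> (\<Sum>i=1..n. bias (hZ n) (hU n) * CZ)"
        proof (rule sum_mono)
          fix i assume i: "i \<in> {1..n}"
          show "\<bar>expectation (f1 n i ?x) - lam z u * expectation (f2 n i ?x)\<bar> \<le> bias (hZ n) (hU n) * CZ"
            using mean1[OF n i x] unfolding fst_conv snd_conv .
        qed
        finally have dB: "\<bar>?EN - lam z u * ?EP\<bar> \<le> real n * (bias (hZ n) (hU n) * CZ)" by simp
        have "(\<Sum>i=1..n. cZ) \<le> ?EP" by (rule sum_mono) (rule mean2(1)[OF n _ x])
        then have EP: "real n * cZ \<le> ?EP" by simp
        have l: "0 \<le> lam z u" "lam z u \<le> lam_sup" using lam_nonneg z u lam_sup(2)[OF z u] by blast+
        note res = ratio_error[OF npos pZ_bounds(1) dN dP dB EP less_imp_le[OF elim(2)] l]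
        have "lambda_hat L w \<Z> KZ KU (hZ n) (hU n) n (\<lambda>i. Zs i \<omega>) (\<lambda>i. Ds i \<omega>) z u = ?N / ?P"
          using res(1) unfolding lambda_hat_def f1_def f2_def fst_conv snd_conv by simp
        then have "\<bar>lambda_hat L w \<Z> KZ KU (hZ n) (hU n) n (\<lambda>i. Zs i \<omega>) (\<lambda>i. Ds i \<omega>) z u - lam z u\<bar>
            \<le> 2 / cZ * (C1 * ?r n + lam_sup * (C2 * ?r n) + bias (hZ n) (hU n) * CZ)"
          using res(2) by (simp only:)
        also have "\<dots> \<le> 2 / cZ * (C1 * R + lam_sup * (C2 * R) + (\<bar>LZ\<bar> + \<bar>LU\<bar>) * R * CZ)"
          using rR bR C1 C2 lam_sup(1) CZ_pos pZ_bounds(1)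
          by (intro mult_left_mono add_mono mult_right_mono) simp_all
        also have "\<dots> = C * R" unfolding C_def by (simp add: algebra_simps)
        finally show ?thesis .
      qed
      have Rform: "hZ n powr sZ + hU n powr sU
            + sqrt (ln (real n) / (real n * hZ n ^ CARD('d) * hU n ^ 2))
            + ln (real n) / (real n * hZ n ^ CARD('d) * hU n ^ 2) = R"
        unfolding R_def H_def mult.assoc ..
      show ?case unfolding Rform
      proof (rule bexI[of _ "E1 \<union> E2"], intro conjI subsetI)
        show "E1 \<union> E2 \<in> events" using E1 E2 by (rule sets.Un)
        have "prob (E1 \<union> E2) \<le> prob E1 + prob E2" by (rule measure_Un_le[OF E1 E2])
        then show "prob (E1 \<union> E2) \<le> \<epsilon>" using conjunct1[OF E1'] conjunct1[OF E2'] by linarith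
        fix \<omega>
        assume \<omega>: "\<omega> \<in> {\<omega> \<in> space M. ereal (C * R) < \<bar>sup_dist \<Z> (Omega_bar L)
            (lambda_hat L w \<Z> KZ KU (hZ n) (hU n) n (\<lambda>i. Zs i \<omega>) (\<lambda>i. Ds i \<omega>)) lam\<bar>}"
        show "\<omega> \<in> E1 \<union> E2"
        proof (rule ccontr)
          assume "\<omega> \<notin> E1 \<union> E2"
          then have "\<omega> \<in> space M - (E1 \<union> E2)" using \<omega> by blast
          from abs_sup_dist_le[OF Z_nonempty Omega_ne err[OF this]] \<omega> show False
            by (simp add: not_le[symmetric])
        qed
      qed
    qed
  qed
qed

end

lemma log_over_n_powr_tendsto_0:
  fixes e :: real
  assumes "0 < e"
  shows "(\<lambda>n. (ln (real n) / real n) powr e) \<longlonglongrightarrow> 0"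
proof -
  have "(\<lambda>n. ln (real n) / real n) \<longlonglongrightarrow> 0" by real_asymp
  moreover have "\<forall>\<^sub>F n in sequentially. 0 \<le> ln (real n) / real n"
    using eventually_ge_at_top[of 1] by (rule eventually_mono) simp
  ultimately show ?thesis
    using tendsto_zero_powrI[of "\<lambda>n. ln (real n) / real n" sequentially "\<lambda>_. e" e] assms by simp
qed

text \<open>Up to constants, the balancing bandwidths are \<open>h\<^sub>Z = x\<^sup>\<alpha>\<close> and \<open>h\<^sub>U = x\<^sup>\<beta>\<close> with
  \<open>\<alpha> s\<^sub>Z = \<beta> s\<^sub>U = 1/Q\<close>, where \<open>x = ln n / n\<close>; so both bias terms are \<open>x\<close> to the power \<open>1/Q\<close>. The
  third identity gives \<open>ln n / (n H) = x / H\<close> the order of \<open>x\<close> to the power \<open>2/Q\<close>, whose root is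
  again the bias rate.\<close>

lemma optimal_bandwidth_exponents:
  fixes d sZ sU :: real
  assumes "0 < sZ" "0 < sU" "0 \<le> d"
  defines "Q \<equiv> 2 + d / sZ + 2 / sU"
  shows "1 / (2 * sZ + d + 2 * sZ / sU) * sZ = 1 / Q"
    and "1 / (2 * sU + 2 + d * sU / sZ) * sU = 1 / Q"
    and "1 / (2 * sZ + d + 2 * sZ / sU) * d + 1 / (2 * sU + 2 + d * sU / sZ) * 2 = 1 - 2 / Q"
    and "2 \<le> Q" "0 < 1 / (2 * sZ + d + 2 * sZ / sU)" "0 < 1 / (2 * sU + 2 + d * sU / sZ)"
proof -
  have Q: "0 < Q" using assms by (simp add: Q_def add_pos_nonneg)
  have z: "2 * sZ + d + 2 * sZ / sU = sZ * Q" and u: "2 * sU + 2 + d * sU / sZ = sU * Q"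
    using assms by (simp_all add: Q_def field_simps)
  show "1 / (2 * sZ + d + 2 * sZ / sU) * sZ = 1 / Q" "1 / (2 * sU + 2 + d * sU / sZ) * sU = 1 / Q"
    unfolding z u using assms by simp_all
  have "1 / (sZ * Q) * d + 1 / (sU * Q) * 2 = (d / sZ + 2 / sU) / Q"
    by (simp add: add_divide_distrib)
  also have "\<dots> = (Q - 2) / Q" by (simp add: Q_def)
  also have "\<dots> = 1 - 2 / Q" using Q by (simp add: diff_divide_distrib)
  finally show "1 / (2 * sZ + d + 2 * sZ / sU) * d + 1 / (2 * sU + 2 + d * sU / sZ) * 2 = 1 - 2 / Q"
    unfolding z u .
  show "0 < 1 / (2 * sZ + d + 2 * sZ / sU)" "0 < 1 / (2 * sU + 2 + d * sU / sZ)"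
    unfolding z u using Q assms by simp_all
  show "2 \<le> Q" using assms by (simp add: Q_def)
qed


text \<open>At these bandwidths the squared fluctuation \<open>v\<close> is of the order of the squared bias. That \<open>v\<close>
  tends to zero is also the condition under which the general rate holds.\<close>

lemma (in conditional_intensity_model) optimal_rate:
  fixes hZ hU :: "nat \<Rightarrow> real"
  assumes hZ: "\<forall>n\<ge>1. hZ n > 0" and hU: "\<forall>n\<ge>1. hU n > 0"
    and hZ_Theta: "hZ \<in> \<Theta>(\<lambda>n. (ln (real n) / real n) powr (1 / (2 * sZ + real CARD('d) + 2 * sZ / sU)))"
    and hU_Theta: "hU \<in> \<Theta>(\<lambda>n. (ln (real n) / real n) powr (1 / (2 * sU + 2 + real CARD('d) * sU / sZ)))"
  shows "big_OP M
         (\<lambda>n \<omega>. sup_dist \<Z> (Omega_bar L)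
            (lambda_hat L w \<Z> KZ KU (hZ n) (hU n) n (\<lambda>i. Zs i \<omega>) (\<lambda>i. Ds i \<omega>)) lam)
         (\<lambda>n. (ln (real n) / real n) powr (1 / (2 + real CARD('d) / sZ + 2 / sU)))"
proof -
  define d where "d = real CARD('d)"
  define \<alpha> where "\<alpha> = 1 / (2 * sZ + d + 2 * sZ / sU)"
  define \<beta> where "\<beta> = 1 / (2 * sU + 2 + d * sU / sZ)"
  define Q where "Q = 2 + d / sZ + 2 / sU"
  define x where "x n = ln (real n) / real n" for n :: nat
  have d0: "0 \<le> d" by (simp add: d_def)
  note ex = optimal_bandwidth_exponents[OF exponents(1,3) d0, folded \<alpha>_def \<beta>_def Q_def]
  have Q0: "0 < Q" using ex(4) by linarith
  have x: "\<forall>\<^sub>F n in sequentially. 0 < x n \<and> x n \<le> 1"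
    using eventually_ge_at_top[of 3]
  proof (rule eventually_mono)
    fix n :: nat assume n: "3 \<le> n"
    then have "0 < ln (real n)" by simp
    moreover have "ln (real n) \<le> real n" using ln_le_minus_one[of "real n"] n by simp
    ultimately show "0 < x n \<and> x n \<le> 1" using n by (simp add: x_def divide_le_eq)
  qed
  have ThZ: "hZ \<in> \<Theta>(\<lambda>n. x n powr \<alpha>)" and ThU: "hU \<in> \<Theta>(\<lambda>n. x n powr \<beta>)"
    using hZ_Theta hU_Theta unfolding x_def \<alpha>_def \<beta>_def d_def by simp_all
  obtain cz' where cz': "0 < cz'" "\<forall>\<^sub>F n in sequentially. norm (hZ n) \<le> cz' * norm (x n powr \<alpha>)"
    using bigthetaD1[OF ThZ] by (rule landau_o.bigE)
  obtain cz where cz: "0 < cz" "\<forall>\<^sub>F n in sequentially. norm (hZ n) \<ge> cz * norm (x n powr \<alpha>)"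
    using bigthetaD2[OF ThZ] by (rule landau_omega.bigE)
  obtain cu' where cu': "0 < cu'" "\<forall>\<^sub>F n in sequentially. norm (hU n) \<le> cu' * norm (x n powr \<beta>)"
    using bigthetaD1[OF ThU] by (rule landau_o.bigE)
  obtain cu where cu: "0 < cu" "\<forall>\<^sub>F n in sequentially. norm (hU n) \<ge> cu * norm (x n powr \<beta>)"
    using bigthetaD2[OF ThU] by (rule landau_omega.bigE)
  have x0: "(\<lambda>n. x n powr e) \<longlonglongrightarrow> 0" if "0 < e" for e
    unfolding x_def by (rule log_over_n_powr_tendsto_0[OF that])
  have hZ0: "hZ \<longlonglongrightarrow> 0"
  proof (rule Lim_null_comparison)
    show "\<forall>\<^sub>F n in sequentially. norm (hZ n) \<le> cz' * x n powr \<alpha>" using cz'(2) by simp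
    show "(\<lambda>n. cz' * x n powr \<alpha>) \<longlonglongrightarrow> 0" using x0[OF ex(5)] by (rule tendsto_mult_right_zero)
  qed
  have hU0: "hU \<longlonglongrightarrow> 0"
  proof (rule Lim_null_comparison)
    show "\<forall>\<^sub>F n in sequentially. norm (hU n) \<le> cu' * x n powr \<beta>" using cu'(2) by simp
    show "(\<lambda>n. cu' * x n powr \<beta>) \<longlonglongrightarrow> 0" using x0[OF ex(6)] by (rule tendsto_mult_right_zero)
  qed
  define v where "v n = ln (real n) / (real n * hZ n ^ CARD('d) * hU n ^ 2)" for n
  define k where "k = cz ^ CARD('d) * cu ^ 2"
  have k: "0 < k" using cz cu by (simp add: k_def)
  have bounds: "\<forall>\<^sub>F n in sequentially. 0 < v n \<and> v n \<le> 1 / k * x n powr (2 / Q) \<and>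
      hZ n powr sZ \<le> cz' powr sZ * x n powr (1 / Q) \<and> hU n powr sU \<le> cu' powr sU * x n powr (1 / Q)
      \<and> 0 < x n \<and> x n \<le> 1"
    using x cz(2) cz'(2) cu(2) cu'(2) eventually_ge_at_top[of 3]
  proof eventually_elim
    case (elim n)
    have n: "0 < real n" and pos: "0 < hZ n" "0 < hU n" using elim(6) hZ hU by auto
    have xn: "0 < x n" "x n \<le> 1" using elim(1) by auto
    have lo: "cz * x n powr \<alpha> \<le> hZ n" "cu * x n powr \<beta> \<le> hU n"
      and hi: "hZ n \<le> cz' * x n powr \<alpha>" "hU n \<le> cu' * x n powr \<beta>"
      using elim(2-5) pos by simp_all
    have vx: "v n = x n / (hZ n ^ CARD('d) * hU n ^ 2)" by (simp add: v_def x_def)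
    have pp: "(x n powr e) ^ m = x n powr (e * real m)" for e m
      using xn by (simp add: powr_powr flip: powr_realpow)
    have "k * x n powr (1 - 2 / Q) = (cz * x n powr \<alpha>) ^ CARD('d) * (cu * x n powr \<beta>) ^ 2"
      unfolding k_def power_mult_distrib pp ex(3)[symmetric] powr_add d_def by simp
    also have "\<dots> \<le> hZ n ^ CARD('d) * hU n ^ 2"
      using lo cz cu pos by (intro mult_mono power_mono) simp_all
    finally have den: "k * x n powr (1 - 2 / Q) \<le> hZ n ^ CARD('d) * hU n ^ 2" .
    have dpos: "0 < k * x n powr (1 - 2 / Q)" using k xn by simp
    have "v n \<le> x n / (k * x n powr (1 - 2 / Q))"
      unfolding vx using den dpos xn by (intro divide_left_mono) (simp_all add: pos)
    also have "\<dots> = 1 / k * x n powr (2 / Q)"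
    proof -
      have "x n = x n powr (1 - 2 / Q) * x n powr (2 / Q)"
        unfolding powr_add[symmetric] using xn by simp
      then have "x n / (k * x n powr (1 - 2 / Q))
          = (x n powr (1 - 2 / Q) * x n powr (2 / Q)) / (k * x n powr (1 - 2 / Q))" by simp
      also have "\<dots> = 1 / k * x n powr (2 / Q)" using dpos k xn by simp
      finally show ?thesis .
    qed
    finally have v: "v n \<le> 1 / k * x n powr (2 / Q)" .
    have "hZ n powr sZ \<le> (cz' * x n powr \<alpha>) powr sZ"
      using hi pos exponents by (intro powr_mono2) simp_all
    also have "\<dots> = cz' powr sZ * x n powr (1 / Q)"
      using cz' by (simp add: powr_mult powr_powr ex(1))
    finally have z: "hZ n powr sZ \<le> cz' powr sZ * x n powr (1 / Q)" .
    have "hU n powr sU \<le> (cu' * x n powr \<beta>) powr sU"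
      using hi pos exponents by (intro powr_mono2) simp_all
    also have "\<dots> = cu' powr sU * x n powr (1 / Q)"
      using cu' by (simp add: powr_mult powr_powr ex(2))
    finally have u: "hU n powr sU \<le> cu' powr sU * x n powr (1 / Q)" .
    have "0 < v n" unfolding vx using xn pos by simp
    with v z u xn show ?case by blast
  qed
  have "v \<longlonglongrightarrow> 0"
  proof (rule Lim_null_comparison)
    show "\<forall>\<^sub>F n in sequentially. norm (v n) \<le> 1 / k * x n powr (2 / Q)"
      using bounds by (rule eventually_mono) simp
    show "(\<lambda>n. 1 / k * x n powr (2 / Q)) \<longlonglongrightarrow> 0"
      by (rule tendsto_mult_right_zero) (use x0 Q0 in simp)
  qed
  moreover have "\<forall>\<^sub>F n in sequentially. 0 < v n" using bounds by (rule eventually_mono) blast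
  ultimately have "filterlim (\<lambda>n. inverse (v n)) at_top sequentially"
    by (rule filterlim_inverse_at_top)
  then have lim: "filterlim (\<lambda>n. real n * hZ n ^ CARD('d) * hU n ^ 2 / ln (real n)) at_top sequentially"
    by (simp add: v_def)
  define K where "K = cz' powr sZ + cu' powr sU + sqrt (1 / k) + 1 / k"
  have K0: "0 \<le> K" using k by (simp add: K_def)
  have "big_OP M
         (\<lambda>n \<omega>. sup_dist \<Z> (Omega_bar L)
            (lambda_hat L w \<Z> KZ KU (hZ n) (hU n) n (\<lambda>i. Zs i \<omega>) (\<lambda>i. Ds i \<omega>)) lam)
         (\<lambda>n. x n powr (1 / Q))"
  proof (rule big_OP_mono[OF uniform_rate[OF hZ hU hZ0 hU0 lim] _ K0])
    show "\<forall>\<^sub>F n in sequentially.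
      0 \<le> hZ n powr sZ + hU n powr sU
            + sqrt (ln (real n) / (real n * hZ n ^ CARD('d) * hU n ^ 2))
            + ln (real n) / (real n * hZ n ^ CARD('d) * hU n ^ 2) \<and>
      hZ n powr sZ + hU n powr sU
            + sqrt (ln (real n) / (real n * hZ n ^ CARD('d) * hU n ^ 2))
            + ln (real n) / (real n * hZ n ^ CARD('d) * hU n ^ 2) \<le> K * x n powr (1 / Q)"
      unfolding v_def[symmetric]
      using bounds
    proof (rule eventually_mono, elim conjE)
      fix n
      assume v: "0 < v n" "v n \<le> 1 / k * x n powr (2 / Q)"
        and z: "hZ n powr sZ \<le> cz' powr sZ * x n powr (1 / Q)"
        and u: "hU n powr sU \<le> cu' powr sU * x n powr (1 / Q)"
        and xn: "0 < x n" "x n \<le> 1"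
      have sq: "x n powr (2 / Q) = (x n powr (1 / Q))\<^sup>2"
        using xn by (simp add: powr_powr flip: powr_realpow)
      have p: "0 \<le> x n powr (1 / Q)" "x n powr (1 / Q) \<le> 1"
        using xn Q0 by (simp_all add: powr_le1)
      have "sqrt (v n) \<le> sqrt (1 / k * (x n powr (1 / Q))\<^sup>2)"
        using v(2) unfolding sq by (rule real_sqrt_le_mono)
      also have "\<dots> = sqrt (1 / k) * x n powr (1 / Q)"
        unfolding real_sqrt_mult using p by simp
      finally have s: "sqrt (v n) \<le> sqrt (1 / k) * x n powr (1 / Q)" .
      have "(x n powr (1 / Q))\<^sup>2 \<le> x n powr (1 / Q)"
        unfolding power2_eq_square by (rule mult_left_le[OF p(2) p(1)])
      then have "1 / k * (x n powr (1 / Q))\<^sup>2 \<le> 1 / k * x n powr (1 / Q)"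
        using k by (intro mult_left_mono) simp_all
      with v(2) have l: "v n \<le> 1 / k * x n powr (1 / Q)" unfolding sq by linarith
      have "0 \<le> hZ n powr sZ" "0 \<le> hU n powr sU" "0 \<le> sqrt (v n)" using v by simp_all
      with v(1) z u s l
      show "0 \<le> hZ n powr sZ + hU n powr sU + sqrt (v n) + v n \<and>
        hZ n powr sZ + hU n powr sU + sqrt (v n) + v n \<le> K * x n powr (1 / Q)"
        unfolding K_def distrib_right by linarith
    qed
  qed
  then show ?thesis unfolding x_def Q_def d_def .
qed

theorem corollary1:
  fixes L :: real
    and M :: "'o measure"
    and Z :: "'o \<Rightarrow> real ^ 'd" and D :: "'o \<Rightarrow> diagram"
    and Zs :: "nat \<Rightarrow> 'o \<Rightarrow> real ^ 'd" and Ds :: "nat \<Rightarrow> 'o \<Rightarrow> diagram"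
    and \<Z> :: "(real ^ 'd) set"
    and w :: "real \<times> real \<Rightarrow> real"
    and KZ :: "real ^ 'd \<Rightarrow> real" and KU :: "real \<times> real \<Rightarrow> real"
    and pZ :: "real ^ 'd \<Rightarrow> real" and cZ CZ :: real
    and \<Lambda> :: "real ^ 'd \<Rightarrow> (real \<times> real) measure"
    and lam :: "real ^ 'd \<Rightarrow> real \<times> real \<Rightarrow> real"
    and Mw sZ sU LZ LU :: real
  assumes L_pos: "L > 0"
    and prob: "prob_space M"
    and Z_rv: "Z \<in> borel_measurable M"
    and D_rv: "D \<in> measurable M (diagram_space L)"
    and sample_indep: "prob_space.indep_vars M (\<lambda>_. borel \<Otimes>\<^sub>M diagram_space L)
          (\<lambda>i \<omega>. (Zs i \<omega>, Ds i \<omega>)) {1..}"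
    and sample_ident: "\<forall>i\<ge>1. distr M (borel \<Otimes>\<^sub>M diagram_space L) (\<lambda>\<omega>. (Zs i \<omega>, Ds i \<omega>)) =
          distr M (borel \<Otimes>\<^sub>M diagram_space L) (\<lambda>\<omega>. (Z \<omega>, D \<omega>))"
    and weight: "is_weight L w"
    and Lambda: "\<forall>i\<ge>1. \<forall>A\<in>sets borel. A \<subseteq> Omega_bar L \<longrightarrow>
          is_cond_exp_given M (Zs i) \<Z> (\<lambda>\<omega>. emeasure (weighted_measure L w (Ds i \<omega>)) A)
            (\<lambda>z. emeasure (\<Lambda> z) A)"
    and w_bounded: "bounded (w ` Omega_bar L)"
    and w_lipschitz: "\<exists>C. C-lipschitz_on (Omega_bar L) w"
    and KZ: "is_kernel KZ"
    and KU: "is_kernel KU"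
    and Z_compact: "compact \<Z>"
    and Z_cone: "cone_condition \<Z>"
    and Z_density: "distributed M lborel Z (\<lambda>z. ennreal (pZ z) * indicator \<Z> z)"
    and pZ_bounds: "0 < cZ" "\<forall>z\<in>\<Z>. cZ \<le> pZ z \<and> pZ z \<le> CZ"
    and Lambda_density: "\<forall>z\<in>\<Z>. \<Lambda> z =
          density (restrict_space lborel (Omega_bar L)) (\<lambda>u. ennreal (lam z u))"
    and lam_nonneg: "\<forall>z\<in>\<Z>. \<forall>u\<in>Omega_bar L. 0 \<le> lam z u"
    and lam_bounded: "bounded ((\<lambda>(z, u). lam z u) ` (\<Z> \<times> Omega_bar L))"
    and lam_ucont: "uniformly_continuous_on (\<Z> \<times> Omega_bar L) (\<lambda>(z, u). lam z u)"
    and mass_bound: "\<forall>i\<ge>1. AE \<omega> in M.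
          emeasure (weighted_measure L w (Ds i \<omega>)) (Omega_bar L) \<le> ennreal Mw"
    and exponents: "0 < sZ" "sZ \<le> 1" "0 < sU" "sU \<le> 1"
    and lam_hoelder: "\<forall>z\<in>\<Z>. \<forall>z'\<in>\<Z>. \<forall>u\<in>Omega_bar L. \<forall>u'\<in>Omega_bar L.
          \<bar>lam z u - lam z' u'\<bar> \<le> LZ * norm (z - z') powr sZ + LU * norm (u - u') powr sU"
  shows
    "(\<forall>hZ hU :: nat \<Rightarrow> real.
       (\<forall>n\<ge>1. hZ n > 0) \<and> (\<forall>n\<ge>1. hU n > 0) \<and> hZ \<longlonglongrightarrow> 0 \<and> hU \<longlonglongrightarrow> 0 \<and>
       filterlim (\<lambda>n. real n * hZ n ^ CARD('d) * hU n ^ 2 / ln (real n)) at_top sequentially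
       \<longrightarrow> big_OP M
         (\<lambda>n \<omega>. sup_dist \<Z> (Omega_bar L)
            (lambda_hat L w \<Z> KZ KU (hZ n) (hU n) n (\<lambda>i. Zs i \<omega>) (\<lambda>i. Ds i \<omega>)) lam)
         (\<lambda>n. hZ n powr sZ + hU n powr sU
            + sqrt (ln (real n) / (real n * hZ n ^ CARD('d) * hU n ^ 2))
            + ln (real n) / (real n * hZ n ^ CARD('d) * hU n ^ 2))) \<and>
     (\<forall>hZ hU :: nat \<Rightarrow> real.
       (\<forall>n\<ge>1. hZ n > 0) \<and> (\<forall>n\<ge>1. hU n > 0) \<and>
       hZ \<in> \<Theta>(\<lambda>n. (ln (real n) / real n) powr (1 / (2 * sZ + real CARD('d) + 2 * sZ / sU))) \<and>
       hU \<in> \<Theta>(\<lambda>n. (ln (real n) / real n) powr (1 / (2 * sU + 2 + real CARD('d) * sU / sZ)))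
       \<longrightarrow> big_OP M
         (\<lambda>n \<omega>. sup_dist \<Z> (Omega_bar L)
            (lambda_hat L w \<Z> KZ KU (hZ n) (hU n) n (\<lambda>i. Zs i \<omega>) (\<lambda>i. Ds i \<omega>)) lam)
         (\<lambda>n. (ln (real n) / real n) powr (1 / (2 + real CARD('d) / sZ + 2 / sU)))) \<and>
     (\<forall>s. sZ = s \<and> sU = s \<longrightarrow> (\<forall>hZ hU :: nat \<Rightarrow> real.
       (\<forall>n\<ge>1. hZ n > 0) \<and> (\<forall>n\<ge>1. hU n > 0) \<and>
       hZ \<in> \<Theta>(\<lambda>n. (ln (real n) / real n) powr (1 / (2 * sZ + real CARD('d) + 2 * sZ / sU))) \<and>
       hU \<in> \<Theta>(\<lambda>n. (ln (real n) / real n) powr (1 / (2 * sU + 2 + real CARD('d) * sU / sZ)))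
       \<longrightarrow> big_OP M
         (\<lambda>n \<omega>. sup_dist \<Z> (Omega_bar L)
            (lambda_hat L w \<Z> KZ KU (hZ n) (hU n) n (\<lambda>i. Zs i \<omega>) (\<lambda>i. Ds i \<omega>)) lam)
         (\<lambda>n. (ln (real n) / real n) powr (s / (2 * s + real CARD('d) + 2)))))"
proof -
  interpret prob_space M by (rule prob)
  interpret conditional_intensity_model M L Z D Zs Ds \<Z> w KZ KU pZ cZ CZ \<Lambda> lam Mw sZ sU LZ LU
    by unfold_locales
      (fact L_pos sample_indep Z_rv D_rv sample_ident weight Lambda KZ KU Z_compact Z_cone Z_density
        pZ_bounds Lambda_density lam_nonneg lam_bounded lam_ucont mass_bound exponents lam_hoelder)+
  have isotropic: "1 / (2 + real CARD('d) / sZ + 2 / sU) = s / (2 * s + real CARD('d) + 2)"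
    if s: "sZ = s \<and> sU = s" for s
  proof -
    have "0 < s" using exponents s by simp
    then have "2 + real CARD('d) / s + 2 / s = (2 * s + real CARD('d) + 2) / s"
      by (simp add: add_divide_distrib)
    with s show ?thesis by simp
  qed
  show ?thesis
  proof (intro conjI allI impI; elim conjE)
    fix hZ hU :: "nat \<Rightarrow> real"
    assume "\<forall>n\<ge>1. hZ n > 0" "\<forall>n\<ge>1. hU n > 0" "hZ \<longlonglongrightarrow> 0" "hU \<longlonglongrightarrow> 0"
      "filterlim (\<lambda>n. real n * hZ n ^ CARD('d) * hU n ^ 2 / ln (real n)) at_top sequentially"
    then show "big_OP M
         (\<lambda>n \<omega>. sup_dist \<Z> (Omega_bar L)
            (lambda_hat L w \<Z> KZ KU (hZ n) (hU n) n (\<lambda>i. Zs i \<omega>) (\<lambda>i. Ds i \<omega>)) lam)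
         (\<lambda>n. hZ n powr sZ + hU n powr sU
            + sqrt (ln (real n) / (real n * hZ n ^ CARD('d) * hU n ^ 2))
            + ln (real n) / (real n * hZ n ^ CARD('d) * hU n ^ 2))"
      by (rule uniform_rate)
  next
    fix hZ hU :: "nat \<Rightarrow> real"
    assume "\<forall>n\<ge>1. hZ n > 0" "\<forall>n\<ge>1. hU n > 0"
      "hZ \<in> \<Theta>(\<lambda>n. (ln (real n) / real n) powr (1 / (2 * sZ + real CARD('d) + 2 * sZ / sU)))"
      "hU \<in> \<Theta>(\<lambda>n. (ln (real n) / real n) powr (1 / (2 * sU + 2 + real CARD('d) * sU / sZ)))"
    then show "big_OP M
         (\<lambda>n \<omega>. sup_dist \<Z> (Omega_bar L)
            (lambda_hat L w \<Z> KZ KU (hZ n) (hU n) n (\<lambda>i. Zs i \<omega>) (\<lambda>i. Ds i \<omega>)) lam)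
         (\<lambda>n. (ln (real n) / real n) powr (1 / (2 + real CARD('d) / sZ + 2 / sU)))"
      by (rule optimal_rate)
  next
    fix s :: real and hZ hU :: "nat \<Rightarrow> real"
    assume s: "sZ = s" "sU = s"
      and h: "\<forall>n\<ge>1. hZ n > 0" "\<forall>n\<ge>1. hU n > 0"
      "hZ \<in> \<Theta>(\<lambda>n. (ln (real n) / real n) powr (1 / (2 * sZ + real CARD('d) + 2 * sZ / sU)))"
      "hU \<in> \<Theta>(\<lambda>n. (ln (real n) / real n) powr (1 / (2 * sU + 2 + real CARD('d) * sU / sZ)))"
    show "big_OP M
         (\<lambda>n \<omega>. sup_dist \<Z> (Omega_bar L)
            (lambda_hat L w \<Z> KZ KU (hZ n) (hU n) n (\<lambda>i. Zs i \<omega>) (\<lambda>i. Ds i \<omega>)) lam)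
         (\<lambda>n. (ln (real n) / real n) powr (s / (2 * s + real CARD('d) + 2)))"
      using optimal_rate[OF h] unfolding isotropic[OF conjI[OF s]] .
  qed
qed

end
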